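(* Let $A$ be an Artinian Gorenstein local $K$-algebra with Hilbert function $(1,h,n,1)$. If $n\le 4$, then $A$ is smoothable.
   Context: $K$ is an algebraically closed field of characteristic $0$. Artinian $K$-algebras are commutative and finite-dimensional over $K$; in particular local ones have residue field $K$. For an Artinian local $K$-algebra $A$ with maximal ideal $\mathfrak m$, the Hilbert function is $HF_A(i)=\dim_K \mathfrak m^i/\mathfrak m^{i+1}$; saying that $A$ has Hilbert function $(1,h,n,1)$ means $HF_A(0)=1$, $HF_A(1)=h$, $HF_A(2)=n$, $HF_A(3)=1$ and $HF_A(i)=0$ for $i\ge4$, where $h,n$ are positive integers. Smoothability: let $\mathcal{H}ilb_d(\mathbb A^d)$ be the Hilbert scheme parameterizing zero-dimensional closed subschemes of length $d$ of affine space $\mathbb A^d$ over $K$. An Artinian $K$-algebra $A$ of length $d$ is smoothable if the scheme $\mathrm{Spec}(A)\in\mathcal{H}ilb_d(\mathbb A^d)$ (for a closed embedding $\mathrm{Spec}(A)\subseteq\mathbb A^d$; the notion does not depend on the choice) lies in the closure $\mathcal{H}ilb_d^{gen}(\mathbb A^d)$, inside $\mathcal{H}ilb_d(\mathbb A^d)$, of the locus of points representing reduced schemes. *)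

theory Defs
  imports
    "HOL-Analysis.Function_Topology"
    "HOL-Computational_Algebra.Polynomial"
    "HOL-Library.Poly_Mapping"
begin

section \<open>Ideals and quotient spaces\<close>

text \<open>
  The ring is passed as a carrier \<open>R\<close> (a subring of the ambient type), so that the same notion
  applies to an algebra given by a whole type and to the polynomial ring in finitely many of the
  variables \<open>x\<^sub>0, x\<^sub>1, \<dots>\<close>.
\<close>

definition is_ideal :: "'a::comm_ring_1 set \<Rightarrow> 'a set \<Rightarrow> bool" where
  "is_ideal R I \<longleftrightarrow>
     I \<subseteq> R \<and> 0 \<in> I \<and> (\<forall>x\<in>I. \<forall>y\<in>I. x + y \<in> I) \<and> (\<forall>r\<in>R. \<forall>x\<in>I. r * x \<in> I)"

definition is_maximal_ideal :: "'a::comm_ring_1 set \<Rightarrow> bool" where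
  "is_maximal_ideal M \<longleftrightarrow> is_ideal UNIV M \<and> M \<noteq> UNIV \<and>
     (\<forall>J. is_ideal UNIV J \<and> M \<subseteq> J \<longrightarrow> J = M \<or> J = UNIV)"

text \<open>The ambient ring is local with maximal ideal \<open>M\<close>.\<close>

definition local_with :: "'a::comm_ring_1 set \<Rightarrow> bool" where
  "local_with M \<longleftrightarrow> is_maximal_ideal M \<and> (\<forall>M'. is_maximal_ideal M' \<longrightarrow> M' = M)"

fun ideal_power :: "'a::comm_ring_1 set \<Rightarrow> nat \<Rightarrow> 'a set" where
  "ideal_power I 0 = UNIV"
| "ideal_power I (Suc k) = module.span (*) {x * y | x y. x \<in> I \<and> y \<in> ideal_power I k}"

text \<open>
  Quotients \<open>W/U\<close> of vector spaces are handled through representatives: \<open>c\<close> is a coordinate vector,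
  supported on \<open>B\<close>, of the class of \<open>w\<close> with respect to the classes of the \<open>v b\<close>, \<open>b \<in> B\<close>.
\<close>

definition quot_coords ::
  "('k::field \<Rightarrow> 'v::ab_group_add \<Rightarrow> 'v) \<Rightarrow> 'v set \<Rightarrow> 'b set \<Rightarrow> ('b \<Rightarrow> 'v) \<Rightarrow> 'v \<Rightarrow> ('b \<Rightarrow> 'k) \<Rightarrow> bool" where
  "quot_coords smul U B v w c \<longleftrightarrow>
     (\<forall>b. b \<notin> B \<longrightarrow> c b = 0) \<and> w - (\<Sum>b\<in>B. smul (c b) (v b)) \<in> U"

definition is_quot_basis ::
  "('k::field \<Rightarrow> 'v::ab_group_add \<Rightarrow> 'v) \<Rightarrow> 'v set \<Rightarrow> 'v set \<Rightarrow> 'b set \<Rightarrow> ('b \<Rightarrow> 'v) \<Rightarrow> bool" where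
  "is_quot_basis smul W U B v \<longleftrightarrow>
     finite B \<and> v ` B \<subseteq> W \<and> (\<forall>w\<in>W. \<exists>!c. quot_coords smul U B v w c)"

text \<open>\<open>W/U\<close> is finite-dimensional, of dimension \<open>n\<close>.\<close>

definition has_quot_dim ::
  "('k::field \<Rightarrow> 'v::ab_group_add \<Rightarrow> 'v) \<Rightarrow> 'v set \<Rightarrow> 'v set \<Rightarrow> nat \<Rightarrow> bool" where
  "has_quot_dim smul W U n \<longleftrightarrow> (\<exists>B. is_quot_basis smul W U B (\<lambda>b. b) \<and> card B = n)"


section \<open>Artinian algebras\<close>

locale artinian_algebra = vector_space smul
  for smul :: "'k::field \<Rightarrow> 'a::comm_ring_1 \<Rightarrow> 'a" +
  assumes smul_mult: "smul c x * y = smul c (x * y)"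
    and finite_dim: "\<exists>B. finite B \<and> span B = UNIV"

definition hilbert_function ::
  "('k::field \<Rightarrow> 'a::comm_ring_1 \<Rightarrow> 'a) \<Rightarrow> 'a set \<Rightarrow> nat \<Rightarrow> nat" where
  "hilbert_function smul M i = (THE k. has_quot_dim smul (ideal_power M i) (ideal_power M (Suc i)) k)"

definition socle :: "'a::comm_ring_1 set \<Rightarrow> 'a set" where
  "socle M = {x. \<forall>y\<in>M. x * y = 0}"

text \<open>
  For an Artinian local algebra with maximal ideal \<open>M\<close> and residue field equal to the ground field:
  Gorenstein means that the type \<open>dim (0 : M)\<close> is \<open>1\<close>.
\<close>

definition gorenstein :: "('k::field \<Rightarrow> 'a::comm_ring_1 \<Rightarrow> 'a) \<Rightarrow> 'a set \<Rightarrow> bool" where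
  "gorenstein smul M \<longleftrightarrow> vector_space.dim smul (socle M) = 1"


section \<open>Polynomials\<close>

type_synonym 'x monomial = "'x \<Rightarrow>\<^sub>0 nat"
type_synonym ('x, 'k) mpoly = "'x monomial \<Rightarrow>\<^sub>0 'k"

definition monomials :: "'x set \<Rightarrow> 'x monomial set" where
  "monomials V = {m. Poly_Mapping.keys m \<subseteq> V}"

text \<open>The polynomial ring in the variables \<open>V\<close>.\<close>

definition polys :: "'x set \<Rightarrow> ('x, 'k::comm_ring_1) mpoly set" where
  "polys V = {p. Poly_Mapping.keys p \<subseteq> monomials V}"

definition mono_poly :: "'x monomial \<Rightarrow> ('x, 'k::comm_ring_1) mpoly" where
  "mono_poly m = Poly_Mapping.single m 1"

definition poly_scale :: "'k::comm_ring_1 \<Rightarrow> ('x, 'k) mpoly \<Rightarrow> ('x, 'k) mpoly" where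
  "poly_scale c p = Poly_Mapping.single 0 c * p"

text \<open>The value of \<open>p\<close> at a tuple \<open>a\<close> of elements of an algebra with scalar multiplication \<open>smul\<close>.\<close>

definition poly_eval ::
  "('k::comm_ring_1 \<Rightarrow> 'a::comm_ring_1 \<Rightarrow> 'a) \<Rightarrow> ('x \<Rightarrow> 'a) \<Rightarrow> ('x, 'k) mpoly \<Rightarrow> 'a" where
  "poly_eval smul a p =
     (\<Sum>m\<in>Poly_Mapping.keys p. smul (Poly_Mapping.lookup p m)
        (\<Prod>x\<in>Poly_Mapping.keys m. a x ^ Poly_Mapping.lookup m x))"


section \<open>The Hilbert scheme of points of affine space\<close>

text \<open>
  The closed points of the Hilbert scheme of \<open>d\<close> points of \<open>N\<close>-dimensional affine space over an
  algebraically closed field: the ideals of colength \<open>d\<close> in the polynomial ring in \<open>N\<close> variables.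
\<close>

definition hilb :: "nat \<Rightarrow> nat \<Rightarrow> (nat, 'k::field) mpoly set set" where
  "hilb N d = {I. is_ideal (polys {..<N}) I \<and> has_quot_dim poly_scale (polys {..<N}) I d}"

text \<open>
  For a set \<open>B\<close> of \<open>d\<close> monomials, the ideals modulo which \<open>B\<close> is a basis form an affine open
  subscheme. Its coordinate ring is generated by the functions \<open>chart_coord B (m, b)\<close>, where
  \<open>chart_coord B (m, b) I\<close> is the coefficient of \<open>b\<close> in the expansion of the monomial \<open>m\<close> modulo
  \<open>I\<close> with respect to \<open>B\<close>. These charts cover the Hilbert scheme.
\<close>

definition chart :: "nat \<Rightarrow> nat \<Rightarrow> nat monomial set \<Rightarrow> (nat, 'k::field) mpoly set set" where
  "chart N d B = {I \<in> hilb N d. is_quot_basis poly_scale (polys {..<N}) I B mono_poly}"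

definition chart_coord ::
  "nat monomial set \<Rightarrow> nat monomial \<times> nat monomial \<Rightarrow> (nat, 'k::field) mpoly set \<Rightarrow> 'k" where
  "chart_coord B mb I = (THE c. quot_coords poly_scale I B mono_poly (mono_poly (fst mb)) c) (snd mb)"

text \<open>
  The Zariski topology on the closed points: a basis is formed by the principal open subsets of the
  charts, that is, the non-vanishing loci of polynomials \<open>f\<close> in the chart coordinates.
\<close>

definition principal_open ::
  "nat \<Rightarrow> nat \<Rightarrow> nat monomial set \<Rightarrow> (nat monomial \<times> nat monomial, 'k::field) mpoly
     \<Rightarrow> (nat, 'k) mpoly set set" where
  "principal_open N d B f =
     {I \<in> chart N d B. poly_eval (*) (\<lambda>mb. chart_coord B mb I) f \<noteq> 0}"

definition hilb_topology :: "nat \<Rightarrow> nat \<Rightarrow> (nat, 'k::field) mpoly set topology" where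
  "hilb_topology N d = topology_generated_by
     {principal_open N d B f | B f.
        finite B \<and> card B = d \<and> B \<subseteq> monomials {..<N} \<and> f \<in> polys (monomials {..<N} \<times> B)}"

text \<open>The points representing reduced schemes: the quotient ring has no nonzero nilpotents.\<close>

definition hilb_reduced :: "nat \<Rightarrow> nat \<Rightarrow> (nat, 'k::field) mpoly set set" where
  "hilb_reduced N d = {I \<in> hilb N d. \<forall>p\<in>polys {..<N}. \<forall>k. p ^ k \<in> I \<longrightarrow> p \<in> I}"

definition hilb_gen :: "nat \<Rightarrow> nat \<Rightarrow> (nat, 'k::field) mpoly set set" where
  "hilb_gen N d = (hilb_topology N d) closure_of (hilb_reduced N d)"


section \<open>Smoothability\<close>

text \<open>
  A morphism from \<open>Spec A\<close> to \<open>N\<close>-dimensional affine space is given by \<open>N\<close> elements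
  \<open>a 0, \<dots>, a (N - 1)\<close> of \<open>A\<close>; it is a closed embedding if evaluation at \<open>a\<close> is surjective, and
  the ideal of its image is then the kernel of the evaluation.
\<close>

definition closed_embedding ::
  "('k::field \<Rightarrow> 'a::comm_ring_1 \<Rightarrow> 'a) \<Rightarrow> nat \<Rightarrow> (nat \<Rightarrow> 'a) \<Rightarrow> bool" where
  "closed_embedding smul N a \<longleftrightarrow> poly_eval smul a ` polys {..<N} = UNIV"

definition embedding_ideal ::
  "('k::field \<Rightarrow> 'a::comm_ring_1 \<Rightarrow> 'a) \<Rightarrow> nat \<Rightarrow> (nat \<Rightarrow> 'a) \<Rightarrow> (nat, 'k) mpoly set" where
  "embedding_ideal smul N a = {p \<in> polys {..<N}. poly_eval smul a p = 0}"

text \<open>The choice of the embedding does not matter, and embeddings exist for \<open>N = dim A\<close>.\<close>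

definition smoothable :: "('k::field \<Rightarrow> 'a::comm_ring_1 \<Rightarrow> 'a) \<Rightarrow> bool" where
  "smoothable smul \<longleftrightarrow>
     (let d = vector_space.dim smul UNIV in
      \<exists>a. closed_embedding smul d a \<and> embedding_ideal smul d a \<in> hilb_gen d d)"

end

theory Submission
  imports Defs "Jordan_Normal_Form.Determinant"
begin

text \<open>
  The proof works with functionals instead of algebras. A Gorenstein algebra \<open>A\<close> carries a linear
  functional \<open>\<epsilon>\<close> for which the form \<open>\<epsilon> (x * y)\<close> is nondegenerate, so the ideal of an embedding by
  elements \<open>a i\<close> consists of the polynomials \<open>q\<close> with \<open>\<epsilon> (m(a) * q(a)) = 0\<close> for all monomials \<open>m\<close>:
  it is the \<open>annihilator\<close> of the functional \<open>m \<mapsto> \<epsilon> (m(a))\<close> on polynomials.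

  For the Hilbert function \<open>(1, h, n, 1)\<close> the generators can be normalized
  (\<open>gorenstein_normal_form\<close>): \<open>\<epsilon>\<close> vanishes on all monomials in \<open>a 0, \<dots>, a (h - 1)\<close> except the cubic
  ones in the first \<open>n\<close> variables and the squares of the other \<open>h - n\<close>, on which it is \<open>1\<close>. In the
  language of inverse systems, the dual generator is a cubic form in \<open>n\<close> variables plus a sum of
  \<open>h - n\<close> squares. Hence the ideal only depends on the values \<open>T\<close> on the cubic monomials, and it
  remains to show that the \<open>cubic_functional\<close> of every \<open>T\<close> is a limit of functionals supported at
  \<open>n + h + 2\<close> points.

  Limits are taken with \<open>open_family\<close>. If the values of a family of functionals are regular functions
  of a parameter and their Hankel matrices \<open>e (m + m')\<close> have rank at most \<open>d\<close>, then by Cramer's rule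
  the chart coordinates of the annihilators are quotients of regular functions of the parameter; hence
  a neighbourhood of one annihilator contains those at all parameters where some regular function does
  not vanish. This is applied to two families.

  The first family consists of all \<open>T\<close>. For \<open>n \<le> 4\<close>, sums of \<open>n + 1\<close> cubes of linear forms are dense
  among the cubic forms: at \<open>x\<^sub>1\<^sup>3 + \<dots> + x\<^sub>n\<^sup>3 + (x\<^sub>1 + \<dots> + x\<^sub>n)\<^sup>3\<close> their tangent space, the degree
  three part of the ideal of the squares of these linear forms, is the space of all cubic forms
  (\<open>cube_sums_tangent_space\<close>), and a nonzero polynomial function does not vanish identically on all
  curves that issue from one point in all directions (\<open>nonzero_on_curves_in_some_direction\<close>).

  The second family has one parameter \<open>u\<close> and starts at a sum of cubes of \<open>n + 1\<close> linear forms \<open>l j\<close>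
  with a relation \<open>(\<Sum>j\<le>n. \<alpha> j * l j) = 0\<close>, all \<open>\<alpha> j\<close> nonzero. For \<open>u \<noteq> 0\<close> it is supported at the
  \<open>n + 1\<close> pairs of points \<open>\<plusminus> u\<^sup>2 * \<kappa> j * l j\<close> with \<open>(\<kappa> j)\<^sup>2 = 1 / \<alpha> j\<close>, moved slightly in the remaining
  \<open>h - n\<close> directions, and at one point on each of the \<open>h - n\<close> remaining axes. The weights at these
  points have poles in \<open>u\<close>, but by the relation and the choice of the small displacements all poles
  cancel in the values on monomials, and the limit at \<open>u = 0\<close> is the given cubic functional (\<open>points_near_sum_of_cubes\<close>). Annihilators of
  functionals supported at points are radical (\<open>point_functional_radical\<close>).
\<close>

section \<open>Monomials and linear functionals on polynomials\<close>

declare ideal_power.simps(2) [simp del]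

definition monomial_value :: "('x \<Rightarrow> 'a::comm_ring_1) \<Rightarrow> 'x monomial \<Rightarrow> 'a" where
  "monomial_value a m = (\<Prod>x\<in>Poly_Mapping.keys m. a x ^ Poly_Mapping.lookup m x)"

lemma monomial_value_superset:
  assumes "finite V" "Poly_Mapping.keys m \<subseteq> V"
  shows "monomial_value a m = (\<Prod>x\<in>V. a x ^ Poly_Mapping.lookup m x)"
  unfolding monomial_value_def
  by (rule prod.mono_neutral_left) (use assms in \<open>auto simp: in_keys_iff\<close>)

lemma monomial_value_0 [simp]: "monomial_value a 0 = 1"
  by (simp add: monomial_value_def)

lemma monomial_value_single [simp]: "monomial_value a (Poly_Mapping.single x n) = a x ^ n"
  by (cases "n = 0") (simp_all add: monomial_value_def)

lemma monomial_value_add: "monomial_value a (m + m') = monomial_value a m * monomial_value a m'"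
proof -
  let ?V = "Poly_Mapping.keys m \<union> Poly_Mapping.keys m'"
  have "Poly_Mapping.keys (m + m') \<subseteq> ?V"
    by (rule Poly_Mapping.keys_add)
  then show ?thesis
    by (simp add: monomial_value_superset[of ?V] lookup_add power_add prod.distrib)
qed

lemma monomial_value_mult:
  "monomial_value (\<lambda>x. a x * b x) m = monomial_value a m * monomial_value b m"
  by (simp add: monomial_value_def power_mult_distrib prod.distrib)

definition weighted_degree :: "('x \<Rightarrow> nat) \<Rightarrow> 'x monomial \<Rightarrow> nat" where
  "weighted_degree w m = (\<Sum>x\<in>Poly_Mapping.keys m. w x * Poly_Mapping.lookup m x)"

abbreviation total_degree :: "'x monomial \<Rightarrow> nat" where
  "total_degree \<equiv> weighted_degree (\<lambda>_. 1)"

lemma weighted_degree_0 [simp]: "weighted_degree w 0 = 0"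
  by (simp add: weighted_degree_def)

lemma weighted_degree_single [simp]: "weighted_degree w (Poly_Mapping.single x n) = w x * n"
  by (cases "n = 0") (simp_all add: weighted_degree_def)

lemma weighted_degree_add [simp]:
  "weighted_degree w (m + m') = weighted_degree w m + weighted_degree w m'"
proof -
  have sup: "weighted_degree w p = (\<Sum>x\<in>V. w x * Poly_Mapping.lookup p x)"
    if "finite V" "Poly_Mapping.keys p \<subseteq> V" for V p
    unfolding weighted_degree_def
    by (rule sum.mono_neutral_left) (use that in \<open>auto simp: in_keys_iff\<close>)
  let ?V = "Poly_Mapping.keys m \<union> Poly_Mapping.keys m'"
  have "Poly_Mapping.keys (m + m') \<subseteq> ?V"
    by (rule Poly_Mapping.keys_add)
  then show ?thesis
    by (simp add: sup[of ?V] lookup_add distrib_left sum.distrib)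
qed

lemma monomial_value_power: "monomial_value (\<lambda>x. s ^ w x) m = s ^ weighted_degree w m"
  by (simp add: monomial_value_def weighted_degree_def power_sum power_mult)

lemma total_degree_eq_0_iff: "total_degree m = 0 \<longleftrightarrow> m = 0"
  by (auto simp: weighted_degree_def in_keys_iff poly_mapping_eq_iff fun_eq_iff)

lemma monomial_split_variable:
  fixes m :: "'x monomial"
  assumes "x \<in> Poly_Mapping.keys m"
  obtains m' where "m = Poly_Mapping.single x 1 + m'"
    "Poly_Mapping.keys m' \<subseteq> Poly_Mapping.keys m"
proof
  let ?m' = "m - Poly_Mapping.single x 1"
  show "m = Poly_Mapping.single x 1 + ?m'"
    using assms by (intro poly_mapping_eqI)
      (auto simp: lookup_add lookup_minus lookup_single in_keys_iff when_def)
  show "Poly_Mapping.keys ?m' \<subseteq> Poly_Mapping.keys m"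
    by (auto simp: in_keys_iff lookup_minus)
qed

lemma monomial_degree_Suc:
  assumes "total_degree m = Suc k" "m \<in> monomials V"
  obtains x m' where "x \<in> V" "m = Poly_Mapping.single x 1 + m'" "m' \<in> monomials V"
    "total_degree m' = k"
proof -
  from assms(1) have "m \<noteq> 0" by auto
  then obtain x where x: "x \<in> Poly_Mapping.keys m" by fastforce
  obtain m' where "m = Poly_Mapping.single x 1 + m'" "Poly_Mapping.keys m' \<subseteq> Poly_Mapping.keys m"
    using monomial_split_variable[OF x] .
  with that[of x m'] x assms show thesis
    by (auto simp: monomials_def)
qed

lemma monomials_0 [simp]: "0 \<in> monomials V"
  by (simp add: monomials_def)

lemma monomials_add [intro]: "m \<in> monomials V \<Longrightarrow> m' \<in> monomials V \<Longrightarrow> m + m' \<in> monomials V"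
  using Poly_Mapping.keys_add[of m m'] by (auto simp: monomials_def)

lemma monomials_add_iff: "m + m' \<in> monomials V \<longleftrightarrow> m \<in> monomials V \<and> m' \<in> monomials V"
  by (auto simp: monomials_def subset_iff in_keys_iff lookup_add)

lemma monomials_single: "Poly_Mapping.single x (Suc k) \<in> monomials V \<longleftrightarrow> x \<in> V"
  by (simp add: monomials_def)

definition linear_extension ::
  "('k::comm_ring_1 \<Rightarrow> 'a::ab_group_add \<Rightarrow> 'a) \<Rightarrow> ('m \<Rightarrow> 'a) \<Rightarrow> ('m \<Rightarrow>\<^sub>0 'k) \<Rightarrow> 'a" where
  "linear_extension smul e p =
     (\<Sum>m\<in>Poly_Mapping.keys p. smul (Poly_Mapping.lookup p m) (e m))"

lemma poly_eval_eq: "poly_eval smul a = linear_extension smul (monomial_value a)"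
  by (simp add: fun_eq_iff poly_eval_def linear_extension_def monomial_value_def)

lemma poly_mapping_sum_single:
  "p = (\<Sum>m\<in>Poly_Mapping.keys p. Poly_Mapping.single m (Poly_Mapping.lookup p m))"
  by (rule poly_mapping_eqI) (auto simp: lookup_sum lookup_single when_def in_keys_iff sum.If_cases
      Int_def conj_commute cong: conj_cong)

context Modules.module
begin

lemma linear_extension_superset:
  assumes "finite V" "Poly_Mapping.keys p \<subseteq> V"
  shows "linear_extension scale e p = (\<Sum>m\<in>V. scale (Poly_Mapping.lookup p m) (e m))"
  unfolding linear_extension_def
  by (rule sum.mono_neutral_left) (use assms in \<open>auto simp: in_keys_iff\<close>)

lemma linear_extension_add:
  "linear_extension scale e (p + q) = linear_extension scale e p + linear_extension scale e q"
proof -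
  let ?V = "Poly_Mapping.keys p \<union> Poly_Mapping.keys q"
  have "Poly_Mapping.keys (p + q) \<subseteq> ?V"
    by (rule Poly_Mapping.keys_add)
  then show ?thesis
    by (simp add: linear_extension_superset[of ?V] lookup_add scale_left_distrib sum.distrib)
qed

lemma linear_extension_0 [simp]: "linear_extension scale e 0 = 0"
  by (simp add: linear_extension_def)

lemma linear_extension_minus: "linear_extension scale e (- p) = - linear_extension scale e p"
  using linear_extension_add[of e p "- p"] by (simp add: eq_neg_iff_add_eq_0 add.commute)

lemma linear_extension_diff:
  "linear_extension scale e (p - q) = linear_extension scale e p - linear_extension scale e q"
  using linear_extension_add[of e p "- q"] by (simp add: linear_extension_minus)

lemma linear_extension_sum:
  "linear_extension scale e (sum f A) = (\<Sum>x\<in>A. linear_extension scale e (f x))"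
  by (induction A rule: infinite_finite_induct) (simp_all add: linear_extension_add)

lemma linear_extension_single [simp]:
  "linear_extension scale e (Poly_Mapping.single m c) = scale c (e m)"
  by (cases "c = 0") (simp_all add: linear_extension_def)

lemma linear_extension_mono [simp]: "linear_extension scale e (mono_poly m) = e m"
  by (simp add: mono_poly_def)

lemma linear_extension_mult:
  "linear_extension scale e (p * q) = (\<Sum>m\<in>Poly_Mapping.keys p.
     scale (Poly_Mapping.lookup p m) (linear_extension scale (\<lambda>m'. e (m + m')) q))"
proof -
  have single: "linear_extension scale e (Poly_Mapping.single m c * q)
      = scale c (linear_extension scale (\<lambda>m'. e (m + m')) q)" for m c
  proof -
    have "Poly_Mapping.single m c * q
      = (\<Sum>m'\<in>Poly_Mapping.keys q. Poly_Mapping.single (m + m') (c * Poly_Mapping.lookup q m'))"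
      by (subst poly_mapping_sum_single[of q]) (simp add: sum_distrib_left mult_single)
    then show ?thesis
      by (simp add: linear_extension_sum linear_extension_def[of _ _ q] scale_sum_right)
  qed
  have "p * q = (\<Sum>m\<in>Poly_Mapping.keys p. Poly_Mapping.single m (Poly_Mapping.lookup p m) * q)"
    by (subst poly_mapping_sum_single[of p]) (simp add: sum_distrib_right)
  then show ?thesis
    by (simp add: linear_extension_sum single)
qed

lemma linear_extension_poly_scale:
  "linear_extension scale e (poly_scale c p) = scale c (linear_extension scale e p)"
  unfolding poly_scale_def by (cases "c = 0") (simp_all add: linear_extension_mult)

lemma linear_extension_linear_combination:
  "linear_extension scale e (w - (\<Sum>b\<in>B. poly_scale (c b) (mono_poly b)))
    = linear_extension scale e w - (\<Sum>b\<in>B. scale (c b) (e b))"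
  by (simp add: linear_extension_diff linear_extension_sum linear_extension_poly_scale)

end

interpretation field_module: Modules.module "(*) :: 'k::field \<Rightarrow> 'k \<Rightarrow> 'k"
  by unfold_locales (simp_all add: algebra_simps)

(* For multiplication of scalars this simplification rule reverses associativity. *)
declare field_module.scale_scale [simp del]

lemma poly_eval_mult:
  assumes "Modules.module smul" and sm: "\<And>c x y. smul c x * y = smul c (x * y)"
  shows "poly_eval smul a (p * q) = poly_eval smul a p * poly_eval smul a q"
proof -
  interpret Modules.module smul by fact
  have sm': "x * smul c y = smul c (x * y)" for c x y
    using sm[of c y x] by (simp only: mult.commute)
  have le: "linear_extension smul (\<lambda>m'. x * e m') q = x * linear_extension smul e q"
    for x and e :: "'c monomial \<Rightarrow> 'b"
    by (simp only: linear_extension_def sum_distrib_left sm')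
  have shift: "linear_extension smul (\<lambda>m'. monomial_value a (m + m')) q
      = monomial_value a m * linear_extension smul (monomial_value a) q" for m
    unfolding monomial_value_add by (rule le)
  have "linear_extension smul (monomial_value a) (p * q) = (\<Sum>m\<in>Poly_Mapping.keys p.
      smul (Poly_Mapping.lookup p m) (monomial_value a m) * linear_extension smul (monomial_value a) q)"
    unfolding linear_extension_mult by (intro sum.cong refl) (simp only: shift sm)
  also have "\<dots> = linear_extension smul (monomial_value a) p * linear_extension smul (monomial_value a) q"
    unfolding linear_extension_def[of smul _ p] by (rule sum_distrib_right[symmetric])
  finally show ?thesis
    by (simp only: poly_eval_eq)
qed

lemma is_quot_basis_image:
  fixes smul :: "'k::field \<Rightarrow> 'v::ab_group_add \<Rightarrow> 'v" and v :: "'b \<Rightarrow> 'v"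
  assumes basis: "is_quot_basis smul W U B v" and inj: "inj_on v B"
  shows "is_quot_basis smul W U (v ` B) (\<lambda>b. b)"
  unfolding is_quot_basis_def
proof (intro conjI ballI)
  show "finite (v ` B)" "(\<lambda>b. b) ` v ` B \<subseteq> W"
    using basis by (auto simp: is_quot_basis_def)
  fix w assume "w \<in> W"
  then have ex: "\<exists>!c. quot_coords smul U B v w c"
    using basis by (auto simp: is_quot_basis_def)
  define pull where "pull c = (\<lambda>b. if b \<in> B then c (v b) else 0)" for c :: "'v \<Rightarrow> 'k"
  define push where "push c = (\<lambda>p. if p \<in> v ` B then c (the_inv_into B v p) else 0)" for c :: "'b \<Rightarrow> 'k"
  have iff: "quot_coords smul U (v ` B) (\<lambda>b. b) w c
      \<longleftrightarrow> (\<forall>p. p \<notin> v ` B \<longrightarrow> c p = 0) \<and> quot_coords smul U B v w (pull c)" for c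
    by (simp add: quot_coords_def pull_def sum.reindex[OF inj])
  have pp: "pull (push c) = c" if "\<forall>b. b \<notin> B \<longrightarrow> c b = 0" for c
    using that inj by (auto simp: pull_def push_def fun_eq_iff the_inv_into_f_f)
  have inj_pull: "c = c'" if "\<forall>p. p \<notin> v ` B \<longrightarrow> c p = 0" "\<forall>p. p \<notin> v ` B \<longrightarrow> c' p = 0"
    "pull c = pull c'" for c c'
  proof
    fix p show "c p = c' p"
      using that by (cases "p \<in> v ` B") (auto simp: pull_def fun_eq_iff split: if_splits)
  qed
  obtain c where c: "quot_coords smul U B v w c" using ex by blast
  show "\<exists>!c. quot_coords smul U (v ` B) (\<lambda>b. b) w c"
  proof (rule ex1I[of _ "push c"])
    have "pull (push c) = c"
      using c by (intro pp) (simp add: quot_coords_def)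
    with c show "quot_coords smul U (v ` B) (\<lambda>b. b) w (push c)"
      by (auto simp: iff) (auto simp: push_def)
  next
    fix c' assume c': "quot_coords smul U (v ` B) (\<lambda>b. b) w c'"
    have "pull c' = c"
      using c' c ex by (auto simp: iff)
    moreover have "pull (push c) = c"
      using c by (intro pp) (simp add: quot_coords_def)
    ultimately show "c' = push c"
      using c' by (intro inj_pull) (auto simp: iff push_def)
  qed
qed

lemma polys_0 [simp]: "0 \<in> polys V"
  by (simp add: polys_def)

lemma polys_1 [simp]: "1 \<in> polys V"
  by (simp add: polys_def)

lemma polys_add: "p \<in> polys V \<Longrightarrow> q \<in> polys V \<Longrightarrow> p + q \<in> polys V"
  using Poly_Mapping.keys_add[of p q] by (auto simp: polys_def)

lemma polys_diff: "p \<in> polys V \<Longrightarrow> q \<in> polys V \<Longrightarrow> p - q \<in> polys V"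
  using Poly_Mapping.keys_diff[of p q] by (auto simp: polys_def)

lemma polys_mult: "p \<in> polys V \<Longrightarrow> q \<in> polys V \<Longrightarrow> p * q \<in> polys V"
  using Poly_Mapping.keys_mult[of p q] by (fastforce simp: polys_def)

lemma polys_sum: "(\<And>x. x \<in> A \<Longrightarrow> f x \<in> polys V) \<Longrightarrow> sum f A \<in> polys V"
  by (induction A rule: infinite_finite_induct) (auto intro: polys_add)

lemma polys_power: "p \<in> polys V \<Longrightarrow> p ^ k \<in> polys V"
  by (induction k) (auto intro: polys_mult)

lemma polys_single: "m \<in> monomials V \<Longrightarrow> Poly_Mapping.single m c \<in> polys V"
  by (auto simp: polys_def)

lemma polys_mono: "m \<in> monomials V \<Longrightarrow> mono_poly m \<in> polys V"
  by (simp add: mono_poly_def polys_single)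

lemma polys_scale: "p \<in> polys V \<Longrightarrow> poly_scale c p \<in> polys V"
  by (simp add: poly_scale_def polys_mult polys_single)

section \<open>Annihilators of functionals\<close>

text \<open>
  The largest ideal in the kernel of the functional that extends \<open>e\<close> linearly from monomials to
  polynomials.
\<close>

definition annihilator :: "nat \<Rightarrow> (nat monomial \<Rightarrow> 'k::field) \<Rightarrow> (nat, 'k) mpoly set" where
  "annihilator N e = {q \<in> polys {..<N}.
     \<forall>m\<in>monomials {..<N}. linear_extension (*) (\<lambda>m'. e (m + m')) q = 0}"

lemma annihilator_ideal:
  fixes e :: "nat monomial \<Rightarrow> 'k::field"
  shows "is_ideal (polys {..<N}) (annihilator N e)"
  unfolding is_ideal_def
proof (intro conjI ballI)
  fix r q :: "(nat, 'k) mpoly" assume r: "r \<in> polys {..<N}" and q: "q \<in> annihilator N e"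
  have "linear_extension (*) (\<lambda>m'. e (m + m')) (r * q) = 0" if m: "m \<in> monomials {..<N}" for m
  proof -
    have "linear_extension (*) (\<lambda>m'. e (m + (k + m'))) q = 0" if "k \<in> Poly_Mapping.keys r" for k
    proof -
      have "m + k \<in> monomials {..<N}"
        using m that r by (auto simp: polys_def)
      with q show ?thesis
        by (auto simp: annihilator_def add.assoc)
    qed
    then show ?thesis
      by (simp add: field_module.linear_extension_mult)
  qed
  then show "r * q \<in> annihilator N e"
    using r q by (simp add: annihilator_def polys_mult)
qed (auto simp: annihilator_def polys_add field_module.linear_extension_add)

lemma annihilator_mult:
  assumes "q \<in> annihilator N e" "r \<in> polys {..<N}"
  shows "linear_extension (*) e (r * q) = 0"
proof -
  have "r * q \<in> annihilator N e"
    using annihilator_ideal assms unfolding is_ideal_def by blast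
  then show ?thesis
    by (auto simp: annihilator_def dest: bspec[OF _ monomials_0])
qed

section \<open>Determinants of square arrays\<close>

text \<open>
  The entries of the matrices below depend on a parameter, so square matrices are represented by plain
  functions of two indices.
\<close>

definition array_det :: "nat \<Rightarrow> (nat \<Rightarrow> nat \<Rightarrow> 'k::comm_ring_1) \<Rightarrow> 'k" where
  "array_det d g = det (mat d d (\<lambda>(i, j). g i j))"

definition array_adj :: "nat \<Rightarrow> (nat \<Rightarrow> nat \<Rightarrow> 'k::comm_ring_1) \<Rightarrow> nat \<Rightarrow> nat \<Rightarrow> 'k" where
  "array_adj d g i j = adj_mat (mat d d (\<lambda>(i, j). g i j)) $$ (i, j)"

lemma array_adj_left:
  assumes "i < d" "j < d"
  shows "(\<Sum>k<d. array_adj d g i k * g k j) = (if i = j then array_det d g else 0)"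
proof -
  let ?A = "mat d d (\<lambda>(i, j). g i j)"
  have A: "?A \<in> carrier_mat d d" by simp
  have "(adj_mat ?A * ?A) $$ (i, j) = (\<Sum>k<d. array_adj d g i k * g k j)"
    using assms adj_mat(1)[OF A]
    by (auto simp: scalar_prod_def array_adj_def atLeast0LessThan intro!: sum.cong)
  then show ?thesis
    using assms by (cases "i = j") (simp_all add: adj_mat(3)[OF A] array_det_def)
qed

lemma array_adj_right:
  assumes "i < d" "j < d"
  shows "(\<Sum>k<d. g i k * array_adj d g k j) = (if i = j then array_det d g else 0)"
proof -
  let ?A = "mat d d (\<lambda>(i, j). g i j)"
  have A: "?A \<in> carrier_mat d d" by simp
  have "(?A * adj_mat ?A) $$ (i, j) = (\<Sum>k<d. g i k * array_adj d g k j)"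
    using assms adj_mat(1)[OF A]
    by (auto simp: scalar_prod_def array_adj_def atLeast0LessThan intro!: sum.cong)
  then show ?thesis
    using assms by (cases "i = j") (simp_all add: adj_mat(2)[OF A] array_det_def)
qed

lemma array_det_mult:
  "array_det d (\<lambda>i j. \<Sum>k<d. a i k * b k j) = array_det d a * array_det d b"
proof -
  have "mat d d (\<lambda>(i, j). \<Sum>k<d. a i k * b k j)
      = mat d d (\<lambda>(i, j). a i j) * mat d d (\<lambda>(i, j). b i j)"
    by (rule eq_matI) (auto simp: scalar_prod_def atLeast0LessThan)
  then show ?thesis
    by (simp add: array_det_def det_mult[of _ d])
qed

lemma array_det_cong:
  assumes "\<And>i j. i < d \<Longrightarrow> j < d \<Longrightarrow> a i j = b i j"
  shows "array_det d a = array_det d b"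
proof -
  have "mat d d (\<lambda>(i, j). a i j) = mat d d (\<lambda>(i, j). b i j)"
    using assms by (intro eq_matI) auto
  then show ?thesis by (simp add: array_det_def)
qed

lemma array_det_0_kernel:
  fixes g :: "nat \<Rightarrow> nat \<Rightarrow> 'k::field"
  assumes "array_det d g = 0"
  obtains c i where "i < d" "c i \<noteq> 0" "\<And>i. i < d \<Longrightarrow> (\<Sum>j<d. g i j * c j) = 0"
proof -
  let ?A = "mat d d (\<lambda>(i, j). g i j)"
  obtain v where v: "v \<in> carrier_vec d" "v \<noteq> 0\<^sub>v d" "?A *\<^sub>v v = 0\<^sub>v d"
    using assms det_0_iff_vec_prod_zero_field[of ?A d] by (auto simp: array_det_def)
  from v(1,2) obtain i where i: "i < d" "v $ i \<noteq> 0"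
    by (metis carrier_vecD eq_vecI index_zero_vec(1) index_zero_vec(2))
  have "(\<Sum>j<d. g i j * v $ j) = 0" if "i < d" for i
  proof -
    have "(?A *\<^sub>v v) $ i = (\<Sum>j<d. g i j * v $ j)"
      using that v(1) by (auto simp: scalar_prod_def atLeast0LessThan intro!: sum.cong)
    with v(3) that show ?thesis by simp
  qed
  with i show thesis by (rule that)
qed

lemma array_solve_iff:
  fixes g :: "nat \<Rightarrow> nat \<Rightarrow> 'k::field"
  assumes det: "array_det d g \<noteq> 0"
  shows "(\<forall>j<d. (\<Sum>i<d. c i * g j i) = r j)
    \<longleftrightarrow> (\<forall>i<d. c i = (\<Sum>j<d. array_adj d g i j * r j) / array_det d g)"
    (is "?L \<longleftrightarrow> ?R")
proof
  assume L: ?L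
  show ?R
  proof (intro allI impI)
    fix i assume i: "i < d"
    have r: "r j = (\<Sum>k<d. c k * g j k)" if "j < d" for j
      using L that by simp
    have "(\<Sum>j<d. array_adj d g i j * r j) = (\<Sum>j<d. \<Sum>k<d. array_adj d g i j * (c k * g j k))"
      by (intro sum.cong refl) (simp only: r lessThan_iff sum_distrib_left)
    also have "\<dots> = (\<Sum>k<d. \<Sum>j<d. array_adj d g i j * (c k * g j k))"
      by (rule sum.swap)
    also have "\<dots> = (\<Sum>k<d. c k * (\<Sum>j<d. array_adj d g i j * g j k))"
      by (simp only: sum_distrib_left mult.left_commute)
    also have "\<dots> = (\<Sum>k<d. if k = i then c k * array_det d g else 0)"
      using i by (intro sum.cong) (auto simp: array_adj_left)
    also have "\<dots> = c i * array_det d g"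
      using i by (simp add: sum.delta)
    finally show "c i = (\<Sum>j<d. array_adj d g i j * r j) / array_det d g"
      using det by simp
  qed
next
  assume R: ?R
  show ?L
  proof (intro allI impI)
    fix j assume j: "j < d"
    have R': "g j i * (\<Sum>k<d. array_adj d g i k * r k) = array_det d g * (c i * g j i)"
      if "i < d" for i
      using R det that by simp
    have "array_det d g * (\<Sum>i<d. c i * g j i)
        = (\<Sum>i<d. g j i * (\<Sum>k<d. array_adj d g i k * r k))"
      by (subst sum_distrib_left, intro sum.cong refl) (simp only: R' lessThan_iff)
    also have "\<dots> = (\<Sum>i<d. \<Sum>k<d. g j i * array_adj d g i k * r k)"
      by (simp only: sum_distrib_left mult.assoc)
    also have "\<dots> = (\<Sum>k<d. \<Sum>i<d. g j i * array_adj d g i k * r k)"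
      by (rule sum.swap)
    also have "\<dots> = (\<Sum>k<d. (\<Sum>i<d. g j i * array_adj d g i k) * r k)"
      by (simp add: sum_distrib_right)
    also have "\<dots> = (\<Sum>k<d. if k = j then array_det d g * r k else 0)"
      using j by (intro sum.cong) (auto simp: array_adj_right)
    also have "\<dots> = array_det d g * r j"
      using j by (simp add: sum.delta)
    finally show "(\<Sum>i<d. c i * g j i) = r j"
      using det by simp
  qed
qed


section \<open>Hankel forms and charts\<close>

text \<open>
  The infinite matrix with entries \<open>e (m + m')\<close> has rank at most \<open>d\<close>, witnessed by a factorization
  through a \<open>d\<close>-element set. Pairs of numbers are a convenient type for naming the elements of this set.
\<close>

definition hankel_rank_le :: "nat \<Rightarrow> nat \<Rightarrow> (nat monomial \<Rightarrow> 'k::field) \<Rightarrow> bool" where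
  "hankel_rank_le N d e \<longleftrightarrow> (\<exists>(K :: (nat \<times> nat) set) \<alpha> \<beta>. finite K \<and> card K = d \<and>
     (\<forall>m\<in>monomials {..<N}. \<forall>m'\<in>monomials {..<N}. e (m + m') = (\<Sum>k\<in>K. \<alpha> k m * \<beta> k m')))"

text \<open>
  The Gram matrix is the product of two \<open>d \<times> d\<close> matrices that come from the rank factorization, so both
  are invertible. Hence the rows of the monomials \<open>bs j\<close> already span the row space.
\<close>

lemma hankel_row_reduction:
  fixes e :: "nat monomial \<Rightarrow> 'k::field"
  assumes rank: "hankel_rank_le N d e"
    and bs: "\<And>i. i < d \<Longrightarrow> bs i \<in> monomials {..<N}"
    and det: "array_det d (\<lambda>i j. e (bs i + bs j)) \<noteq> 0"
    and m: "m \<in> monomials {..<N}"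
  obtains y where "\<And>m'. m' \<in> monomials {..<N} \<Longrightarrow> e (m + m') = (\<Sum>j<d. y j * e (bs j + m'))"
proof -
  obtain K :: "(nat \<times> nat) set" and \<alpha> \<beta> where K: "finite K" "card K = d"
    and e: "\<And>m m'. m \<in> monomials {..<N} \<Longrightarrow> m' \<in> monomials {..<N} \<Longrightarrow>
      e (m + m') = (\<Sum>k\<in>K. \<alpha> k m * \<beta> k m')"
    using rank unfolding hankel_rank_le_def by metis
  obtain \<kappa> where \<kappa>: "bij_betw \<kappa> {..<d} K"
    using ex_bij_betw_nat_finite[OF K(1)] K(2) by (auto simp: atLeast0LessThan)
  have e': "e (m + m') = (\<Sum>k<d. \<alpha> (\<kappa> k) m * \<beta> (\<kappa> k) m')"
    if "m \<in> monomials {..<N}" "m' \<in> monomials {..<N}" for m m'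
    using e[OF that] sum.reindex_bij_betw[OF \<kappa>, of "\<lambda>k. \<alpha> k m * \<beta> k m'"] by simp
  let ?a = "\<lambda>i k. \<alpha> (\<kappa> k) (bs i)" and ?b = "\<lambda>k j. \<beta> (\<kappa> k) (bs j)"
  have "array_det d (\<lambda>i j. e (bs i + bs j)) = array_det d (\<lambda>i j. \<Sum>k<d. ?a i k * ?b k j)"
    by (rule array_det_cong) (simp add: e' bs)
  also have "\<dots> = array_det d ?a * array_det d ?b"
    by (rule array_det_mult)
  finally have deta: "array_det d ?a \<noteq> 0"
    using det by auto
  define y where "y = (\<lambda>i. (\<Sum>k<d. \<alpha> (\<kappa> k) m * array_adj d ?a k i) / array_det d ?a)"
  have y: "(\<Sum>i<d. y i * \<alpha> (\<kappa> k) (bs i)) = \<alpha> (\<kappa> k) m" if k: "k < d" for k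
  proof -
    have yi: "array_det d ?a * y i = (\<Sum>k<d. \<alpha> (\<kappa> k) m * array_adj d ?a k i)" for i
      using deta by (simp add: y_def)
    have "array_det d ?a * (\<Sum>i<d. y i * \<alpha> (\<kappa> k) (bs i))
        = (\<Sum>i<d. array_det d ?a * y i * \<alpha> (\<kappa> k) (bs i))"
      by (simp only: sum_distrib_left mult.assoc)
    also have "\<dots> = (\<Sum>i<d. \<Sum>l<d. \<alpha> (\<kappa> l) m * array_adj d ?a l i * \<alpha> (\<kappa> k) (bs i))"
      by (simp only: yi sum_distrib_right)
    also have "\<dots> = (\<Sum>l<d. \<Sum>i<d. \<alpha> (\<kappa> l) m * array_adj d ?a l i * \<alpha> (\<kappa> k) (bs i))"
      by (rule sum.swap)
    also have "\<dots> = (\<Sum>l<d. \<alpha> (\<kappa> l) m * (\<Sum>i<d. array_adj d ?a l i * \<alpha> (\<kappa> k) (bs i)))"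
      by (simp only: sum_distrib_left mult.assoc)
    also have "\<dots> = (\<Sum>l<d. if l = k then array_det d ?a * \<alpha> (\<kappa> l) m else 0)"
      using array_adj_left[OF _ k, of _ ?a] by (intro sum.cong refl) (simp add: mult.commute)
    also have "\<dots> = array_det d ?a * \<alpha> (\<kappa> k) m"
      using k by (simp add: sum.delta)
    finally show ?thesis using deta by simp
  qed
  have "e (m + m') = (\<Sum>j<d. y j * e (bs j + m'))" if m': "m' \<in> monomials {..<N}" for m'
  proof -
    have "(\<Sum>j<d. y j * e (bs j + m')) = (\<Sum>j<d. \<Sum>k<d. y j * (\<alpha> (\<kappa> k) (bs j) * \<beta> (\<kappa> k) m'))"
      by (simp add: e' bs m' sum_distrib_left)
    also have "\<dots> = (\<Sum>k<d. \<Sum>j<d. y j * (\<alpha> (\<kappa> k) (bs j) * \<beta> (\<kappa> k) m'))"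
      by (rule sum.swap)
    also have "\<dots> = (\<Sum>k<d. (\<Sum>j<d. y j * \<alpha> (\<kappa> k) (bs j)) * \<beta> (\<kappa> k) m')"
      by (simp only: sum_distrib_right mult.assoc)
    also have "\<dots> = e (m + m')"
      by (simp add: y e' m m')
    finally show ?thesis ..
  qed
  then show thesis by (rule that)
qed

lemma inj_mono_poly: "inj (mono_poly :: 'x monomial \<Rightarrow> ('x, 'k::field) mpoly)"
proof (rule injI)
  fix m m' :: "'x monomial" assume "(mono_poly m :: ('x, 'k) mpoly) = mono_poly m'"
  then have "Poly_Mapping.keys (Poly_Mapping.single m (1::'k)) = Poly_Mapping.keys (Poly_Mapping.single m' (1::'k))"
    by (simp add: mono_poly_def)
  then show "m = m'" by simp
qed

lemma chartI:
  fixes I :: "(nat, 'k::field) mpoly set"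
  assumes "is_ideal (polys {..<N}) I" "is_quot_basis poly_scale (polys {..<N}) I B mono_poly"
    "card B = d"
  shows "I \<in> chart N d B"
proof -
  have "inj_on (mono_poly :: _ \<Rightarrow> (nat, 'k) mpoly) B"
    using inj_mono_poly by (rule inj_on_subset) simp
  then have "has_quot_dim poly_scale (polys {..<N}) I d"
    unfolding has_quot_dim_def
    using is_quot_basis_image[OF assms(2)] assms(3) by (metis card_image)
  then show ?thesis
    using assms by (simp add: chart_def hilb_def)
qed

lemma quot_coords_annihilator:
  fixes e :: "nat monomial \<Rightarrow> 'k::field"
  assumes "w \<in> polys {..<N}" "B \<subseteq> monomials {..<N}"
  shows "quot_coords poly_scale (annihilator N e) B mono_poly w c \<longleftrightarrow>
    (\<forall>b. b \<notin> B \<longrightarrow> c b = 0) \<and> (\<forall>m\<in>monomials {..<N}.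
       (\<Sum>b\<in>B. c b * e (m + b)) = linear_extension (*) (\<lambda>m'. e (m + m')) w)"
proof -
  have "w - (\<Sum>b\<in>B. poly_scale (c b) (mono_poly b)) \<in> polys {..<N}"
    using assms by (intro polys_diff polys_sum polys_scale polys_mono) auto
  then show ?thesis
    unfolding quot_coords_def annihilator_def
    by (auto simp: field_module.linear_extension_linear_combination)
qed

context
  fixes N d :: nat and e :: "nat monomial \<Rightarrow> 'k::field" and B :: "nat monomial set"
    and bs :: "nat \<Rightarrow> nat monomial"
  assumes bij: "bij_betw bs {..<d} B" and B: "B \<subseteq> monomials {..<N}"
begin

abbreviation "gram \<equiv> (\<lambda>i j. e (bs i + bs j))"

text \<open>
  A vector in the kernel of the Gram matrix is a combination of \<open>B\<close> orthogonal to \<open>B\<close>. Modulo the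
  annihilator every monomial is a combination of \<open>B\<close>, so this vector is orthogonal to everything and
  belongs to the annihilator, which contradicts the independence of \<open>B\<close>.
\<close>

lemma chart_imp_gram_det_nonzero:
  assumes "annihilator N e \<in> chart N d B"
  shows "array_det d gram \<noteq> 0"
proof
  assume "array_det d gram = 0"
  then obtain a i0 where i0: "i0 < d" "a i0 \<noteq> 0"
    and a: "\<And>i. i < d \<Longrightarrow> (\<Sum>j<d. e (bs i + bs j) * a j) = 0"
    by (rule array_det_0_kernel) blast
  define c where "c b = (if b \<in> B then a (the_inv_into {..<d} bs b) else 0)" for b
  have cbs: "c (bs j) = a j" if "j < d" for j
    using that bij by (auto simp: c_def bij_betw_def the_inv_into_f_f)
  have sumB: "(\<Sum>b\<in>B. f b * c b) = (\<Sum>j<d. f (bs j) * a j)" for f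
    using sum.reindex_bij_betw[OF bij, of "\<lambda>b. f b * c b"] by (simp add: cbs)
  have bB: "(\<Sum>b\<in>B. c b * e (b + b')) = 0" if b': "b' \<in> B" for b'
  proof -
    obtain i where i: "i < d" "b' = bs i"
      using b' bij by (auto simp: bij_betw_def)
    have "(\<Sum>b\<in>B. c b * e (b + b')) = (\<Sum>b\<in>B. e (b' + b) * c b)"
      by (intro sum.cong refl) (simp only: mult.commute add.commute)
    also have "\<dots> = 0"
      using a[OF i(1)] by (simp only: sumB i(2))
    finally show ?thesis .
  qed
  have basis: "is_quot_basis poly_scale (polys {..<N}) (annihilator N e) B mono_poly"
    using assms by (simp add: chart_def)
  have "(\<Sum>b\<in>B. c b * e (m + b)) = 0" if m: "m \<in> monomials {..<N}" for m
  proof -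
    obtain y where y: "quot_coords poly_scale (annihilator N e) B mono_poly (mono_poly m) y"
      using basis polys_mono[OF m] unfolding is_quot_basis_def by blast
    then have y: "e (m + b) = (\<Sum>b'\<in>B. y b' * e (b + b'))" if "b \<in> B" for b
      using that m B unfolding quot_coords_annihilator[OF polys_mono[OF m] B] add.commute[of m b]
      by (auto simp: subset_iff)
    have "(\<Sum>b\<in>B. c b * e (m + b)) = (\<Sum>b\<in>B. \<Sum>b'\<in>B. c b * (y b' * e (b + b')))"
      by (intro sum.cong refl) (simp only: y sum_distrib_left)
    also have "\<dots> = (\<Sum>b'\<in>B. \<Sum>b\<in>B. c b * (y b' * e (b + b')))"
      by (rule sum.swap)
    also have "\<dots> = (\<Sum>b'\<in>B. y b' * (\<Sum>b\<in>B. c b * e (b + b')))"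
      by (intro sum.cong refl) (simp only: sum_distrib_left mult.left_commute)
    also have "\<dots> = 0"
      by (simp add: bB)
    finally show ?thesis .
  qed
  then have "quot_coords poly_scale (annihilator N e) B mono_poly 0 c"
    using B by (subst quot_coords_annihilator) (auto simp: c_def)
  moreover have "quot_coords poly_scale (annihilator N e) B mono_poly 0 (\<lambda>_. 0)"
    using B by (subst quot_coords_annihilator) auto
  moreover have "\<exists>!c. quot_coords poly_scale (annihilator N e) B mono_poly 0 c"
    using basis by (auto simp: is_quot_basis_def)
  ultimately have "c = (\<lambda>_. 0)" by blast
  then show False
    using cbs[OF i0(1)] i0 by simp
qed

text \<open>
  By \<open>hankel_row_reduction\<close> the equations for the monomials in \<open>B\<close> imply all others, and these \<open>d\<close>
  equations are solved by Cramer's rule.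
\<close>

lemma quot_coords_gram:
  assumes rank: "hankel_rank_le N d e" and det: "array_det d gram \<noteq> 0" and w: "w \<in> polys {..<N}"
  shows "quot_coords poly_scale (annihilator N e) B mono_poly w c \<longleftrightarrow>
    (\<forall>b. b \<notin> B \<longrightarrow> c b = 0) \<and> (\<forall>i<d. c (bs i) =
      (\<Sum>j<d. array_adj d gram i j * linear_extension (*) (\<lambda>m'. e (bs j + m')) w)
        / array_det d gram)"
proof -
  have bsN: "bs i \<in> monomials {..<N}" if "i < d" for i
    using that bij B by (auto simp: bij_betw_def)
  have sumB: "(\<Sum>b\<in>B. f b) = (\<Sum>j<d. f (bs j))" for f :: "nat monomial \<Rightarrow> 'k"
    using sum.reindex_bij_betw[OF bij, of f] by simp
  have "(\<forall>m\<in>monomials {..<N}.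
       (\<Sum>b\<in>B. c b * e (m + b)) = linear_extension (*) (\<lambda>m'. e (m + m')) w)
    \<longleftrightarrow> (\<forall>j<d. (\<Sum>i<d. c (bs i) * gram j i) = linear_extension (*) (\<lambda>m'. e (bs j + m')) w)"
    (is "?A \<longleftrightarrow> ?B")
  proof
    assume ?A then show ?B using bsN by (simp add: sumB)
  next
    assume R: ?B
    show ?A
    proof
      fix m :: "nat monomial" assume m: "m \<in> monomials {..<N}"
      have R': "linear_extension (*) (\<lambda>m'. e (bs j + m')) w = (\<Sum>i<d. c (bs i) * gram j i)"
        if "j < d" for j
        using R that by simp
      obtain y where y: "\<And>m'. m' \<in> monomials {..<N} \<Longrightarrow> e (m + m') = (\<Sum>j<d. y j * e (bs j + m'))"
        using hankel_row_reduction[OF rank bsN det m] by blast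
      have "(\<Sum>b\<in>B. c b * e (m + b)) = (\<Sum>i<d. \<Sum>j<d. c (bs i) * (y j * gram j i))"
        by (simp add: sumB y bsN sum_distrib_left)
      also have "\<dots> = (\<Sum>j<d. \<Sum>i<d. c (bs i) * (y j * gram j i))"
        by (rule sum.swap)
      also have "\<dots> = (\<Sum>j<d. y j * linear_extension (*) (\<lambda>m'. e (bs j + m')) w)"
        by (intro sum.cong refl) (simp only: R' lessThan_iff sum_distrib_left mult.left_commute)
      also have "\<dots> = (\<Sum>j<d. \<Sum>m'\<in>Poly_Mapping.keys w.
          Poly_Mapping.lookup w m' * (y j * e (bs j + m')))"
        by (simp only: linear_extension_def sum_distrib_left mult.left_commute)
      also have "\<dots> = (\<Sum>m'\<in>Poly_Mapping.keys w. \<Sum>j<d.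
          Poly_Mapping.lookup w m' * (y j * e (bs j + m')))"
        by (rule sum.swap)
      also have "\<dots> = (\<Sum>m'\<in>Poly_Mapping.keys w. Poly_Mapping.lookup w m' * e (m + m'))"
        using w by (intro sum.cong) (auto simp: y polys_def sum_distrib_left)
      also have "\<dots> = linear_extension (*) (\<lambda>m'. e (m + m')) w"
        by (simp add: linear_extension_def)
      finally show "(\<Sum>b\<in>B. c b * e (m + b)) = linear_extension (*) (\<lambda>m'. e (m + m')) w" .
    qed
  qed
  then show ?thesis
    unfolding quot_coords_annihilator[OF w B]
    using array_solve_iff[OF det, of "\<lambda>i. c (bs i)"] by simp
qed

lemma quot_coords_gram_ex1:
  assumes rank: "hankel_rank_le N d e" and det: "array_det d gram \<noteq> 0" and w: "w \<in> polys {..<N}"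
  shows "\<exists>!c. quot_coords poly_scale (annihilator N e) B mono_poly w c"
proof -
  let ?v = "\<lambda>i. (\<Sum>j<d. array_adj d gram i j * linear_extension (*) (\<lambda>m'. e (bs j + m')) w)
        / array_det d gram"
  let ?c = "\<lambda>b. if b \<in> B then ?v (the_inv_into {..<d} bs b) else 0"
  have inj: "inj_on bs {..<d}" and im: "bs ` {..<d} = B"
    using bij by (auto simp: bij_betw_def)
  have "?c (bs i) = ?v i" if "i < d" for i
    using that im by (auto simp: the_inv_into_f_f[OF inj])
  then have 1: "quot_coords poly_scale (annihilator N e) B mono_poly w ?c"
    by (subst quot_coords_gram[OF assms]) auto
  moreover have "c = c'" if "quot_coords poly_scale (annihilator N e) B mono_poly w c"
    "quot_coords poly_scale (annihilator N e) B mono_poly w c'" for c c'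
  proof
    fix b show "c b = c' b"
      using that im by (cases "b \<in> B") (auto simp: quot_coords_gram[OF assms])
  qed
  ultimately show ?thesis by blast
qed

lemma gram_det_nonzero_imp_chart:
  assumes rank: "hankel_rank_le N d e" and det: "array_det d gram \<noteq> 0"
  shows "annihilator N e \<in> chart N d B"
proof (rule chartI)
  have "finite B" using bij bij_betw_finite by blast
  then show "is_quot_basis poly_scale (polys {..<N}) (annihilator N e) B mono_poly"
    using quot_coords_gram_ex1[OF assms] B by (auto simp: is_quot_basis_def intro!: polys_mono)
  show "card B = d"
    using bij_betw_same_card[OF bij] by simp
qed (rule annihilator_ideal)

lemma chart_coord_gram:
  assumes rank: "hankel_rank_le N d e" and det: "array_det d gram \<noteq> 0"
    and m: "m \<in> monomials {..<N}" and i: "i < d"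
  shows "chart_coord B (m, bs i) (annihilator N e)
    = (\<Sum>j<d. array_adj d gram i j * e (bs j + m)) / array_det d gram"
proof -
  let ?c = "THE c. quot_coords poly_scale (annihilator N e) B mono_poly (mono_poly m) c"
  have w: "(mono_poly m :: (nat, 'k) mpoly) \<in> polys {..<N}" using m by (rule polys_mono)
  have "quot_coords poly_scale (annihilator N e) B mono_poly (mono_poly m) ?c"
    using theI'[OF quot_coords_gram_ex1[OF rank det w]] .
  then show ?thesis
    using i by (auto simp: quot_coords_gram[OF rank det w] chart_coord_def)
qed

end

section \<open>Families of functionals\<close>

text \<open>
  The regular functions on a parameter space. Only closure under the ring operations matters, so the
  same arguments serve for functions of one variable and of infinitely many.
\<close>

locale function_ring =
  fixes P :: "('p \<Rightarrow> 'k::field) set"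
  assumes const: "(\<lambda>_. c) \<in> P"
    and add: "f \<in> P \<Longrightarrow> g \<in> P \<Longrightarrow> (\<lambda>p. f p + g p) \<in> P"
    and mult: "f \<in> P \<Longrightarrow> g \<in> P \<Longrightarrow> (\<lambda>p. f p * g p) \<in> P"
begin

lemma sum: "(\<And>x. x \<in> A \<Longrightarrow> f x \<in> P) \<Longrightarrow> (\<lambda>p. \<Sum>x\<in>A. f x p) \<in> P"
  by (induction A rule: infinite_finite_induct) (auto intro: const add)

lemma prod: "(\<And>x. x \<in> A \<Longrightarrow> f x \<in> P) \<Longrightarrow> (\<lambda>p. \<Prod>x\<in>A. f x p) \<in> P"
  by (induction A rule: infinite_finite_induct) (auto intro: const mult)

lemma power: "f \<in> P \<Longrightarrow> (\<lambda>p. f p ^ n) \<in> P"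
  by (induction n) (auto intro: const mult)

lemma array_det:
  assumes "\<And>i j. i < d \<Longrightarrow> j < d \<Longrightarrow> (\<lambda>p. g p i j) \<in> P"
  shows "(\<lambda>p. array_det d (g p)) \<in> P"
proof -
  have eq: "array_det d (g p) = (\<Sum>\<pi> | \<pi> permutes {0..<d}. of_int (sign \<pi>) * (\<Prod>i = 0..<d. g p i (\<pi> i)))" for p
    by (auto simp: array_det_def det_def permutes_in_image intro!: sum.cong prod.cong)
  have "(\<lambda>p. of_int (sign \<pi>) * (\<Prod>i = 0..<d. g p i (\<pi> i))) \<in> P" if "\<pi> permutes {0..<d}" for \<pi>
    using that permutes_in_image[OF that] by (intro mult const prod assms) auto
  then show ?thesis
    unfolding eq by (intro sum) auto
qed

lemma array_adj:
  assumes g: "\<And>i j. i < d \<Longrightarrow> j < d \<Longrightarrow> (\<lambda>p. g p i j) \<in> P" and ij: "i < d" "j < d"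
  shows "(\<lambda>p. array_adj d (g p) i j) \<in> P"
proof -
  let ?s = "\<lambda>i' i. if i' < i then i' else Suc i'"
  have "array_adj d (g p) i j
      = (-1) ^ (j + i) * array_det (d - 1) (\<lambda>i' j'. g p (?s i' j) (?s j' i))" for p
  proof -
    have "mat_delete (mat d d (\<lambda>(i, j). g p i j)) j i
        = mat (d - 1) (d - 1) (\<lambda>(i', j'). g p (?s i' j) (?s j' i))"
      by (rule eq_matI) (auto simp: mat_delete_def)
    then show ?thesis
      using ij by (simp add: array_adj_def adj_mat_def cofactor_def array_det_def)
  qed
  moreover have "(\<lambda>p. (-1) ^ (j + i) * array_det (d - 1) (\<lambda>i' j'. g p (?s i' j) (?s j' i))) \<in> P"
    by (intro mult const array_det g) auto
  ultimately show ?thesis by simp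
qed

text \<open>
  The localization of \<open>P\<close> at \<open>\<Delta>\<close>: the functions that agree with \<open>G / \<Delta> ^ k\<close> for some \<open>G\<close> in \<open>P\<close> wherever
  \<open>\<Delta>\<close> does not vanish.
\<close>

definition fractions :: "('p \<Rightarrow> 'k) \<Rightarrow> ('p \<Rightarrow> 'k) set" where
  "fractions \<Delta> = {g. \<exists>k. \<exists>G\<in>P. \<forall>p. \<Delta> p \<noteq> 0 \<longrightarrow> G p = \<Delta> p ^ k * g p}"

lemma fractionsI:
  assumes "G \<in> P" "\<And>p. \<Delta> p \<noteq> 0 \<Longrightarrow> G p = \<Delta> p ^ k * g p"
  shows "g \<in> fractions \<Delta>"
  unfolding fractions_def using assms by (intro CollectI exI[of _ k] bexI[of _ G]) auto

lemma fractionsE: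
  assumes "g \<in> fractions \<Delta>"
  obtains G k where "G \<in> P" "\<And>p. \<Delta> p \<noteq> 0 \<Longrightarrow> G p = \<Delta> p ^ k * g p"
  using assms unfolding fractions_def by blast

lemma function_ring_fractions:
  assumes \<Delta>: "\<Delta> \<in> P"
  shows "function_ring (fractions \<Delta>)"
proof
  fix c show "(\<lambda>_. c) \<in> fractions \<Delta>"
    by (rule fractionsI[OF const, where k = 0]) simp
next
  fix f g assume f: "f \<in> fractions \<Delta>" and g: "g \<in> fractions \<Delta>"
  from f obtain k F where F: "F \<in> P" "\<And>p. \<Delta> p \<noteq> 0 \<Longrightarrow> F p = \<Delta> p ^ k * f p"
    by (rule fractionsE) (rule that)
  from g obtain l G where G: "G \<in> P" "\<And>p. \<Delta> p \<noteq> 0 \<Longrightarrow> G p = \<Delta> p ^ l * g p"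
    by (rule fractionsE) (rule that)
  have "(\<lambda>p. \<Delta> p ^ l * F p + \<Delta> p ^ k * G p) \<in> P"
    by (intro add mult power F G \<Delta>)
  moreover have "\<Delta> p ^ l * F p + \<Delta> p ^ k * G p = \<Delta> p ^ (k + l) * (f p + g p)"
    if "\<Delta> p \<noteq> 0" for p
    by (simp only: F(2)[OF that] G(2)[OF that] power_add distrib_left mult.assoc mult.left_commute)
  ultimately show "(\<lambda>p. f p + g p) \<in> fractions \<Delta>"
    by (rule fractionsI)
  have "(\<lambda>p. F p * G p) \<in> P"
    by (intro mult F G)
  moreover have "F p * G p = \<Delta> p ^ (k + l) * (f p * g p)" if "\<Delta> p \<noteq> 0" for p
    by (simp only: F(2)[OF that] G(2)[OF that] power_add mult.assoc mult.left_commute)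
  ultimately show "(\<lambda>p. f p * g p) \<in> fractions \<Delta>"
    by (rule fractionsI)
qed

text \<open>
  Let \<open>\<Delta>\<close> be the Gram determinant of \<open>B\<close>. Membership in the chart of \<open>B\<close> means \<open>\<Delta> \<noteq> 0\<close>, and there the
  chart coordinates, hence also \<open>F\<close>, are fractions with denominator a power of \<open>\<Delta>\<close>. The function
  wanted is \<open>\<Delta>\<close> times the numerator of \<open>F\<close>.
\<close>

lemma principal_open_family:
  assumes e: "\<And>m. m \<in> monomials {..<N} \<Longrightarrow> (\<lambda>p. e p m) \<in> P"
    and rank: "\<And>p. hankel_rank_le N d (e p)"
    and B: "finite B" "card B = d" "B \<subseteq> monomials {..<N}" and F: "F \<in> polys (monomials {..<N} \<times> B)"
    and p0: "annihilator N (e p0) \<in> principal_open N d B F"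
  shows "\<exists>f\<in>P. f p0 \<noteq> 0 \<and> (\<forall>p. f p \<noteq> 0 \<longrightarrow> annihilator N (e p) \<in> principal_open N d B F)"
proof -
  obtain bs where bs: "bij_betw bs {..<d} B"
    using ex_bij_betw_nat_finite[OF B(1)] B(2) by (auto simp: atLeast0LessThan)
  have bsN: "bs i \<in> monomials {..<N}" if "i < d" for i
    using that bs B by (auto simp: bij_betw_def)
  let ?g = "\<lambda>p i j. e p (bs i + bs j)"
  define \<Delta> where "\<Delta> p = array_det d (?g p)" for p
  have g: "(\<lambda>p. ?g p i j) \<in> P" if "i < d" "j < d" for i j
    using that by (intro e monomials_add bsN)
  have \<Delta>: "\<Delta> \<in> P"
    unfolding \<Delta>_def by (rule array_det) (rule g)
  interpret Fr: function_ring "fractions \<Delta>"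
    by (rule function_ring_fractions[OF \<Delta>])
  define co where "co mb p = (if \<Delta> p = 0 then 0 else chart_coord B mb (annihilator N (e p)))" for mb p
  have co: "co mb \<in> fractions \<Delta>" if mb: "mb \<in> monomials {..<N} \<times> B" for mb
  proof -
    obtain m i where m: "mb = (m, bs i)" "m \<in> monomials {..<N}" "i < d"
      using mb bs by (auto simp: bij_betw_def)
    have "(\<lambda>p. \<Sum>j<d. array_adj d (?g p) i j * e p (bs j + m)) \<in> P"
      using m by (intro sum mult array_adj g e monomials_add bsN) auto
    moreover have "(\<Sum>j<d. array_adj d (?g p) i j * e p (bs j + m)) = \<Delta> p ^ 1 * co mb p"
      if "\<Delta> p \<noteq> 0" for p
      using that chart_coord_gram[OF bs B(3) rank _ m(2,3)] m(1) by (simp add: co_def \<Delta>_def)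
    ultimately show ?thesis
      by (rule fractionsI)
  qed
  have "(\<lambda>p. poly_eval (*) (\<lambda>mb. co mb p) F) \<in> fractions \<Delta>"
    unfolding poly_eval_def
    using F by (intro Fr.sum Fr.mult Fr.const Fr.prod Fr.power co) (auto simp: polys_def monomials_def)
  then obtain k G where G: "G \<in> P"
    "\<And>p. \<Delta> p \<noteq> 0 \<Longrightarrow> G p = \<Delta> p ^ k * poly_eval (*) (\<lambda>mb. co mb p) F"
    by (rule fractionsE) (rule that)
  have iff: "annihilator N (e p) \<in> principal_open N d B F \<longleftrightarrow> \<Delta> p * G p \<noteq> 0" for p
  proof (cases "\<Delta> p = 0")
    case True
    then show ?thesis
      using chart_imp_gram_det_nonzero[OF bs B(3)] by (auto simp: principal_open_def \<Delta>_def)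
  next
    case False
    then have "annihilator N (e p) \<in> chart N d B"
      using gram_det_nonzero_imp_chart[OF bs B(3) rank] by (simp add: \<Delta>_def)
    then show ?thesis
      using False G(2)[OF False] by (simp add: principal_open_def co_def)
  qed
  have inP: "(\<lambda>p. \<Delta> p * G p) \<in> P"
    by (intro mult \<Delta> G)
  have nz: "\<Delta> p0 * G p0 \<noteq> 0"
    using p0 by (rule iff[THEN iffD1])
  have all: "\<forall>p. \<Delta> p * G p \<noteq> 0 \<longrightarrow> annihilator N (e p) \<in> principal_open N d B F"
    by (intro allI impI) (rule iff[THEN iffD2])
  show ?thesis
    by (rule bexI[where x = "\<lambda>p. \<Delta> p * G p"]) (rule conjI[OF nz all], rule inP)
qed

text \<open>
  The principal open sets are a subbasis; a finite intersection of them is handled by the product of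
  the functions found for its members.
\<close>

lemma open_family:
  assumes e: "\<And>m. m \<in> monomials {..<N} \<Longrightarrow> (\<lambda>p. e p m) \<in> P"
    and rank: "\<And>p. hankel_rank_le N d (e p)"
    and U: "openin (hilb_topology N d) U" and p0: "annihilator N (e p0) \<in> U"
  shows "\<exists>f\<in>P. f p0 \<noteq> 0 \<and> (\<forall>p. f p \<noteq> 0 \<longrightarrow> annihilator N (e p) \<in> U)"
  using openin_topology_generated_by[OF U[unfolded hilb_topology_def]] p0
proof induction
  case (Int a b)
  then obtain f g where f: "f \<in> P" "f p0 \<noteq> 0" "\<forall>p. f p \<noteq> 0 \<longrightarrow> annihilator N (e p) \<in> a"
    and g: "g \<in> P" "g p0 \<noteq> 0" "\<forall>p. g p \<noteq> 0 \<longrightarrow> annihilator N (e p) \<in> b"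
    by blast
  have "(\<lambda>p. f p * g p) \<in> P"
    by (intro mult f g)
  then show ?case
    using f g by (intro bexI[of _ "\<lambda>p. f p * g p"]) auto
next
  case (UN K)
  then obtain k where k: "k \<in> K" "annihilator N (e p0) \<in> k" by blast
  then obtain f where f: "f \<in> P" "f p0 \<noteq> 0" "\<forall>p. f p \<noteq> 0 \<longrightarrow> annihilator N (e p) \<in> k"
    using UN.IH[OF k] by blast
  have "\<forall>p. f p \<noteq> 0 \<longrightarrow> annihilator N (e p) \<in> \<Union>K"
    using f(3) k(1) by blast
  with f(1,2) show ?case by blast
next
  case (Basis s)
  then obtain B F where s: "s = principal_open N d B F" and B: "finite B" "card B = d"
    "B \<subseteq> monomials {..<N}" "F \<in> polys (monomials {..<N} \<times> B)"
    by auto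
  show ?case
    unfolding s by (rule principal_open_family[OF e rank B]) (use Basis.prems in \<open>simp_all only: s\<close>)
qed simp

end

section \<open>Polynomial functions and curves\<close>

inductive_set polynomial_functions :: "(('i \<Rightarrow> 'k::field) \<Rightarrow> 'k) set" where
  const: "(\<lambda>_. c) \<in> polynomial_functions"
| coord: "(\<lambda>x. x i) \<in> polynomial_functions"
| add: "f \<in> polynomial_functions \<Longrightarrow> g \<in> polynomial_functions \<Longrightarrow> (\<lambda>x. f x + g x) \<in> polynomial_functions"
| mult: "f \<in> polynomial_functions \<Longrightarrow> g \<in> polynomial_functions \<Longrightarrow> (\<lambda>x. f x * g x) \<in> polynomial_functions"

interpretation polyfun: function_ring polynomial_functions
  by unfold_locales (auto intro: polynomial_functions.intros)

definition univariate_functions :: "('k::field \<Rightarrow> 'k) set" where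
  "univariate_functions = range poly"

lemma univariate_functionsE:
  assumes "f \<in> univariate_functions"
  obtains p where "\<And>s. poly p s = f s"
  using assms unfolding univariate_functions_def by blast

lemma function_ring_univariate: "function_ring (univariate_functions :: ('k::field \<Rightarrow> 'k) set)"
proof
  show "(\<lambda>_. c) \<in> univariate_functions" for c :: 'k
    unfolding univariate_functions_def by (rule range_eqI[of _ _ "[:c:]"]) (simp add: fun_eq_iff)
next
  fix f g :: "'k \<Rightarrow> 'k"
  assume "f \<in> univariate_functions" "g \<in> univariate_functions"
  then obtain p q where pq: "f = poly p" "g = poly q"
    by (auto simp: univariate_functions_def)
  show "(\<lambda>x. f x + g x) \<in> univariate_functions"
    unfolding univariate_functions_def by (rule range_eqI[of _ _ "p + q"]) (simp add: pq fun_eq_iff)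
  show "(\<lambda>x. f x * g x) \<in> univariate_functions"
    unfolding univariate_functions_def by (rule range_eqI[of _ _ "p * q"]) (simp add: pq fun_eq_iff)
qed

lemma polynomial_function_on_curve:
  assumes "f \<in> polynomial_functions"
  shows "(\<lambda>s. f (\<lambda>i. poly (Y i) s)) \<in> univariate_functions"
proof -
  interpret U: function_ring univariate_functions by (rule function_ring_univariate)
  from assms show ?thesis
  proof induction
    case (coord i)
    then show ?case by (auto simp: univariate_functions_def)
  qed (auto intro: U.const U.add U.mult)
qed

text \<open>
  The Taylor expansion of \<open>f\<close> at \<open>y0\<close>: the coefficient of degree \<open>e\<close> of \<open>Q x\<close> is the homogeneous
  component of degree \<open>e\<close> of \<open>x \<mapsto> f (y0 + x)\<close>.
\<close>

lemma homogeneous_expansion: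
  fixes y0 :: "'i \<Rightarrow> 'k::field"
  assumes "f \<in> polynomial_functions"
  shows "\<exists>(Q :: ('i \<Rightarrow> 'k) \<Rightarrow> 'k poly) D. (\<forall>e. (\<lambda>x. coeff (Q x) e) \<in> polynomial_functions)
    \<and> (\<forall>x s. poly (Q x) s = f (\<lambda>i. y0 i + s * x i)) \<and> (\<forall>x. degree (Q x) \<le> D)"
  using assms
proof induction
  case (const c)
  have "(\<lambda>x. coeff ((\<lambda>_. [:c:]) x) e) \<in> polynomial_functions" for e :: nat
    by (rule polynomial_functions.const)
  then show ?case
    by (intro exI[of _ "\<lambda>_. [:c:]"] exI[of _ 0]) auto
next
  case (coord i)
  have "(\<lambda>x. coeff [:y0 i, x i:] e) \<in> polynomial_functions" for e :: nat
  proof -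
    consider "e = 0" | "e = 1" | "e > 1" by linarith
    then show ?thesis
    proof cases
      case 3
      then have "coeff [:y0 i, c:] e = 0" for c
        by (auto simp: coeff_pCons split: nat.splits)
      then show ?thesis by (simp add: polynomial_functions.const)
    qed (simp_all add: polynomial_functions.const polynomial_functions.coord)
  qed
  moreover have "degree [:y0 i, c:] \<le> 1" for c
    by simp
  ultimately show ?case
    by (intro exI[of _ "\<lambda>x. [:y0 i, x i:]"] exI[of _ 1]) auto
next
  case (add f g)
  then obtain Q D R E where
    Q: "\<And>e. (\<lambda>x. coeff (Q x) e) \<in> polynomial_functions"
      "\<And>x s. poly (Q x) s = f (\<lambda>i. y0 i + s * x i)" "\<And>x. degree (Q x) \<le> D" and
    R: "\<And>e. (\<lambda>x. coeff (R x) e) \<in> polynomial_functions"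
      "\<And>x s. poly (R x) s = g (\<lambda>i. y0 i + s * x i)" "\<And>x. degree (R x) \<le> E"
    by metis
  have "degree (Q x + R x) \<le> max D E" for x
    using Q(3)[of x] R(3)[of x] degree_add_le_max[of "Q x" "R x"] by linarith
  then show ?case
    using Q R by (intro exI[of _ "\<lambda>x. Q x + R x"] exI[of _ "max D E"])
      (auto intro: polynomial_functions.add)
next
  case (mult f g)
  then obtain Q D R E where
    Q: "\<And>e. (\<lambda>x. coeff (Q x) e) \<in> polynomial_functions"
      "\<And>x s. poly (Q x) s = f (\<lambda>i. y0 i + s * x i)" "\<And>x. degree (Q x) \<le> D" and
    R: "\<And>e. (\<lambda>x. coeff (R x) e) \<in> polynomial_functions"
      "\<And>x s. poly (R x) s = g (\<lambda>i. y0 i + s * x i)" "\<And>x. degree (R x) \<le> E"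
    by metis
  have "degree (Q x * R x) \<le> D + E" for x
    using Q(3)[of x] R(3)[of x] degree_mult_le[of "Q x" "R x"] by linarith
  moreover have "(\<lambda>x. coeff (Q x * R x) e) \<in> polynomial_functions" for e
    unfolding coeff_mult by (intro polyfun.sum polynomial_functions.mult Q(1) R(1))
  ultimately show ?case
    using Q(2) R(2) by (intro exI[of _ "\<lambda>x. Q x * R x"] exI[of _ "D + E"]) auto
qed

lemma poly_eq_sum:
  fixes p :: "'k::field poly"
  assumes "degree p \<le> D"
  shows "poly p s = (\<Sum>e\<le>D. coeff p e * s ^ e)"
  unfolding poly_altdef
  by (rule sum.mono_neutral_left) (use assms in \<open>auto simp: coeff_eq_0\<close>)

text \<open>
  Let \<open>d\<close> be the lowest degree in which the Taylor expansion of \<open>f\<close> at \<open>y0\<close> has a nonzero component,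
  and choose \<open>z\<close> where this component does not vanish. Along a curve \<open>Y = y0 + s * V\<close> with \<open>V 0 = z\<close> the
  function \<open>f\<close> is \<open>s ^ d\<close> times a polynomial in \<open>s\<close> whose value at \<open>0\<close> is that component at \<open>z\<close>. In
  particular, a nonzero polynomial function does not vanish identically on a variety whose tangent
  space at some point is the whole space.
\<close>

lemma nonzero_on_curves_in_some_direction:
  fixes f :: "('i \<Rightarrow> 'k::field_char_0) \<Rightarrow> 'k" and y0 :: "'i \<Rightarrow> 'k"
  assumes f: "f \<in> polynomial_functions" and y1: "f y1 \<noteq> 0"
  shows "\<exists>z. \<forall>Y. (\<forall>i. coeff (Y i) 0 = y0 i \<and> coeff (Y i) 1 = z i) \<longrightarrow>
    finite {s. f (\<lambda>i. poly (Y i) s) = 0}"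
proof -
  interpret U: function_ring univariate_functions by (rule function_ring_univariate)
  obtain Q :: "('i \<Rightarrow> 'k) \<Rightarrow> 'k poly" and D where
    Q: "\<And>e. (\<lambda>x. coeff (Q x) e) \<in> polynomial_functions"
      "\<And>x s. poly (Q x) s = f (\<lambda>i. y0 i + s * x i)" "\<And>x. degree (Q x) \<le> D"
    using homogeneous_expansion[OF f, of y0] by auto
  have "poly (Q (\<lambda>i. y1 i - y0 i)) 1 \<noteq> 0"
    using y1 by (simp add: Q(2))
  then have "Q (\<lambda>i. y1 i - y0 i) \<noteq> 0" by auto
  then have "\<exists>e x. coeff (Q x) e \<noteq> 0"
    by (auto simp: poly_eq_iff)
  define d where "d = (LEAST e. \<exists>x. coeff (Q x) e \<noteq> 0)"
  obtain z where z: "coeff (Q z) d \<noteq> 0"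
    using LeastI_ex[OF \<open>\<exists>e x. coeff (Q x) e \<noteq> 0\<close>] unfolding d_def by blast
  have below: "coeff (Q x) e = 0" if "e < d" for e x
    using not_less_Least[of e "\<lambda>e. \<exists>x. coeff (Q x) e \<noteq> 0"] that unfolding d_def by blast
  have dD: "d \<le> D"
    using z Q(3)[of z] le_degree[of "Q z" d] by simp
  show ?thesis
  proof (intro exI[of _ z] allI impI)
    fix Y :: "'i \<Rightarrow> 'k poly"
    assume Y: "\<forall>i. coeff (Y i) 0 = y0 i \<and> coeff (Y i) 1 = z i"
    then have Y0: "coeff (Y i) 0 = y0 i" and Y1: "coeff (Y i) 1 = z i" for i
      by simp_all
    have "\<exists>v. Y i = pCons (y0 i) v" for i
    proof -
      obtain a v where "Y i = pCons a v" by (cases "Y i")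
      then have "Y i = pCons (y0 i) v" using Y0[of i] by simp
      then show ?thesis ..
    qed
    then obtain V where V: "\<And>i. Y i = pCons (y0 i) (V i)"
      by metis
    have V0: "poly (V i) 0 = z i" for i
      using Y1[of i] by (simp add: V poly_0_coeff_0)
    have "(\<lambda>s. \<Sum>e\<in>{d..D}. coeff (Q (\<lambda>i. poly (V i) s)) e * s ^ (e - d)) \<in> univariate_functions"
    proof (intro U.sum U.mult)
      show "(\<lambda>s. coeff (Q (\<lambda>i. poly (V i) s)) e) \<in> univariate_functions" for e
        using polynomial_function_on_curve[OF Q(1)[of e]] by simp
      show "(\<lambda>s. s ^ k) \<in> univariate_functions" for k :: nat
        unfolding univariate_functions_def
        by (rule range_eqI[of _ _ "monom 1 k"]) (simp add: poly_monom fun_eq_iff)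
    qed
    then obtain g where g: "poly g s
        = (\<Sum>e\<in>{d..D}. coeff (Q (\<lambda>i. poly (V i) s)) e * s ^ (e - d))" for s
      by (rule univariate_functionsE) (rule that)
    have "poly g 0 = (\<Sum>e\<in>{d..D}. if e = d then coeff (Q z) d else 0)"
      unfolding g by (intro sum.cong) (auto simp: V0)
    then have g0: "poly g 0 \<noteq> 0"
      using z dD by simp
    have eq: "f (\<lambda>i. poly (Y i) s) = s ^ d * poly g s" for s
    proof -
      let ?v = "\<lambda>i. poly (V i) s"
      have "f (\<lambda>i. poly (Y i) s) = poly (Q ?v) s"
        by (simp add: Q(2) V)
      also have "\<dots> = (\<Sum>e\<le>D. coeff (Q ?v) e * s ^ e)"
        by (rule poly_eq_sum[OF Q(3)])
      also have "\<dots> = (\<Sum>e\<in>{d..D}. coeff (Q ?v) e * s ^ e)"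
        by (rule sum.mono_neutral_right) (auto simp: below not_le)
      also have "\<dots> = (\<Sum>e\<in>{d..D}. s ^ d * (coeff (Q ?v) e * s ^ (e - d)))"
      proof (rule sum.cong)
        fix e assume "e \<in> {d..D}"
        then have "s ^ e = s ^ d * s ^ (e - d)"
          by (simp flip: power_add)
        then show "coeff (Q ?v) e * s ^ e = s ^ d * (coeff (Q ?v) e * s ^ (e - d))"
          by (simp only: mult.left_commute)
      qed simp
      finally show ?thesis
        by (simp only: g sum_distrib_left)
    qed
    have "g \<noteq> 0" using g0 by auto
    then have "finite (insert 0 {s. poly g s = 0})"
      by (simp add: poly_roots_finite)
    then show "finite {s. f (\<lambda>i. poly (Y i) s) = 0}"
      by (rule rev_finite_subset) (auto simp: eq)
  qed
qed

section \<open>Sums of cubes of linear forms\<close>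

lemma sum_of_thirds: "s / 3 + s / 3 + s / 3 = (s :: 'k::field_char_0)"
  by (simp add: field_simps)

text \<open>
  Modulo the squares of the variables, the square of \<open>x\<^sub>1 + \<dots> + x\<^sub>n\<close> times \<open>x\<^sub>i\<close> is twice the sum of
  the squarefree cubic monomials that contain \<open>x\<^sub>i\<close>. Solvability means that these multiples span all
  squarefree cubic forms. There is one unknown for each variable and one equation for each such
  monomial; this is where \<open>n \<le> 4\<close> is needed, since five variables have ten squarefree cubic monomials.
\<close>

lemma triple_sum_system:
  fixes t :: "nat monomial \<Rightarrow> 'k::field_char_0"
  assumes "n \<le> 4"
  defines "X \<equiv> \<lambda>i::nat. Poly_Mapping.single i (1::nat)"
  shows "\<exists>a. \<forall>i<n. \<forall>j<n. \<forall>k<n. i \<noteq> j \<longrightarrow> j \<noteq> k \<longrightarrow> i \<noteq> k \<longrightarrow>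
    a i + a j + a k = t (X i + X j + X k)"
proof -
  have "\<exists>a. \<forall>i j k. i < j \<longrightarrow> j < k \<longrightarrow> k < n \<longrightarrow> a i + a j + a k = t (X i + X j + X k)"
  proof -
    consider "n \<le> 2" | "n = 3" | "n = 4" using assms by linarith
    then show ?thesis
    proof cases
      case 1
      then have "\<not> (i < j \<and> j < k \<and> k < n)" for i j k
        by linarith
      then show ?thesis by blast
    next
      case 2
      define a where "a i = (if i = 0 then t (X 0 + X 1 + X 2) else 0)" for i :: nat
      have "a i + a j + a k = t (X i + X j + X k)" if "i < j" "j < k" "k < n" for i j k
      proof -
        have "i = 0" "j = 1" "k = 2"
          using that 2 by linarith+
        then show ?thesis by (simp add: a_def)
      qed
      then show ?thesis by blast
    next
      case 3
      define y where "y l = (if l = 0 then t (X 1 + X 2 + X 3) else if l = 1 then t (X 0 + X 2 + X 3)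
        else if l = 2 then t (X 0 + X 1 + X 3) else t (X 0 + X 1 + X 2))" for l :: nat
      \<comment> \<open>Each variable is in three of the four triples, so the sum of the right-hand sides is
        three times the sum of the unknowns; \<open>y l\<close> belongs to the triple that omits \<open>l\<close>.\<close>
      define S where "S = y 0 + y 1 + y 2 + y 3"
      define a where "a l = S / 3 - y l" for l
      have "a i + a j + a k = t (X i + X j + X k)" if ijk: "i < j" "j < k" "k < n" for i j k
      proof -
        have "a i + a j + a k = (S / 3 + S / 3 + S / 3) - (y i + y j + y k)"
          by (simp only: a_def) (simp only: diff_conv_add_uminus minus_add_distrib add_ac)
        then have "a i + a j + a k = (y 0 + y 1 + y 2 + y 3) - (y i + y j + y k)"
          by (simp only: sum_of_thirds S_def)
        moreover have "i = 0 \<and> j = 1 \<and> k = 2 \<or> i = 0 \<and> j = 1 \<and> k = 3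
          \<or> i = 0 \<and> j = 2 \<and> k = 3 \<or> i = 1 \<and> j = 2 \<and> k = 3"
          using ijk 3 by presburger
        ultimately show ?thesis
          by (elim disjE conjE) (simp_all add: y_def)
      qed
      then show ?thesis by blast
    qed
  qed
  then obtain a where a: "\<And>i j k. i < j \<Longrightarrow> j < k \<Longrightarrow> k < n \<Longrightarrow> a i + a j + a k = t (X i + X j + X k)"
    by blast
  have "a i + a j + a k = t (X i + X j + X k)"
    if ijk: "i < n" "j < n" "k < n" "i \<noteq> j" "j \<noteq> k" "i \<noteq> k" for i j k
  proof -
    consider "i < j" "j < k" | "i < k" "k < j" | "j < i" "i < k" | "j < k" "k < i"
      | "k < i" "i < j" | "k < j" "j < i"
      using ijk(4-6) nat_neq_iff[of i j] nat_neq_iff[of j k] nat_neq_iff[of i k] by blast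
    then show ?thesis
    proof cases
      case 1 from a[OF this ijk(3)] show ?thesis by (simp only: add_ac)
    next
      case 2 from a[OF this ijk(2)] show ?thesis by (simp only: add_ac)
    next
      case 3 from a[OF this ijk(3)] show ?thesis by (simp only: add_ac)
    next
      case 4 from a[OF this ijk(1)] show ?thesis by (simp only: add_ac)
    next
      case 5 from a[OF this ijk(2)] show ?thesis by (simp only: add_ac)
    next
      case 6 from a[OF this ijk(1)] show ?thesis by (simp only: add_ac)
    qed
  qed
  then show ?thesis by blast
qed

lemma coeff_1_mult: "coeff (p * q) (Suc 0) = coeff p 0 * coeff q (Suc 0) + coeff p (Suc 0) * coeff q 0"
  by (simp add: coeff_mult)

lemma monomial_degree_3:
  assumes "total_degree m = 3" "m \<in> monomials V"
  obtains i j k where "i \<in> V" "j \<in> V" "k \<in> V"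
    "m = Poly_Mapping.single i 1 + Poly_Mapping.single j 1 + Poly_Mapping.single k 1"
proof -
  have "total_degree m = Suc 2" using assms by simp
  then obtain i m' where i: "i \<in> V" "m = Poly_Mapping.single i 1 + m'" "m' \<in> monomials V" "total_degree m' = 2"
    using monomial_degree_Suc assms(2) by blast
  have "total_degree m' = Suc 1" using i by simp
  then obtain j m'' where j: "j \<in> V" "m' = Poly_Mapping.single j 1 + m''" "m'' \<in> monomials V" "total_degree m'' = 1"
    using monomial_degree_Suc i(3) by blast
  have "total_degree m'' = Suc 0" using j by simp
  then obtain k m3 where k: "k \<in> V" "m'' = Poly_Mapping.single k 1 + m3" "total_degree m3 = 0"
    using monomial_degree_Suc j(3) by blast
  have "m3 = 0"
    using k(3) by (simp only: total_degree_eq_0_iff)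
  with i j k that[of i j k] show thesis
    by (simp add: add.assoc)
qed

text \<open>
  A curve of sums of \<open>n + 1\<close> cubes through \<open>x\<^sub>1\<^sup>3 + \<dots> + x\<^sub>n\<^sup>3 + (x\<^sub>1 + \<dots> + x\<^sub>n)\<^sup>3\<close> in an arbitrary tangent
  direction \<open>z\<close>. The velocity \<open>a\<close> of the last linear form is determined by the squarefree part of \<open>z\<close>;
  the velocities \<open>c j\<close> of the others then adjust the coefficients of the monomials with a repeated
  variable. The last form is kept a combination of the others with nonzero coefficients \<open>b j\<close>, because
  the construction of the points needs a linear relation between the forms.
\<close>

lemma cube_sums_tangent_space:
  fixes z :: "nat monomial \<Rightarrow> 'k::field_char_0"
  assumes n: "n \<le> 4"
  obtains l :: "nat \<Rightarrow> nat \<Rightarrow> 'k poly" and b :: "nat \<Rightarrow> 'k poly"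
  where "\<And>j. b j \<noteq> 0" "\<And>i. l n i = (\<Sum>j<n. b j * l j i)"
    "\<And>m. m \<in> monomials {..<n} \<Longrightarrow> total_degree m = 3 \<Longrightarrow>
      coeff (\<Sum>j\<le>n. monomial_value (l j) m) 0
        = (\<Sum>j<n. monomial_value (\<lambda>i. if i = j then 1 else 0) m) + 1"
    "\<And>m. m \<in> monomials {..<n} \<Longrightarrow> total_degree m = 3 \<Longrightarrow>
      coeff (\<Sum>j\<le>n. monomial_value (l j) m) 1 = z m"
proof -
  define X where "X i = Poly_Mapping.single i (1::nat)" for i :: nat
  obtain a where a: "a i + a j + a k = z (X i + X j + X k)"
    if "i < n" "j < n" "k < n" "i \<noteq> j" "j \<noteq> k" "i \<noteq> k" for i j k
    using triple_sum_system[OF n, of z] unfolding X_def[symmetric] by blast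
  define c where "c j i = (if i = j then (z (X j + X j + X j) - 3 * a j) / 3
    else z (X j + X j + X i) - 2 * a j - a i)" for i j
  \<comment> \<open>The slope of \<open>b j\<close> compensates the motion of the other forms, so that \<open>l n\<close> has velocity \<open>a\<close>.\<close>
  define b where "b j = [:1, a j - (\<Sum>i<n. c i j):]" for j
  define l0 where "l0 j i = [:if i = j then 1 else 0, c j i:]" for j i
  define l where "l j i = (if j = n then \<Sum>j<n. b j * l0 j i else l0 j i)" for j i
  have ln0: "coeff (l n i) 0 = 1" if "i < n" for i
    using that by (simp add: l_def l0_def b_def coeff_sum coeff_mult_0)
  have ln1: "coeff (l n i) (Suc 0) = a i" if "i < n" for i
  proof -
    have "coeff (l n i) (Suc 0)
        = (\<Sum>j<n. c j i + (if j = i then a j - (\<Sum>k<n. c k j) else 0))"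
      by (auto simp: l_def l0_def b_def coeff_sum coeff_1_mult intro!: sum.cong)
    also have "\<dots> = a i"
      using that by (simp add: sum.distrib)
    finally show ?thesis .
  qed
  have lj: "l j i = l0 j i" if "j < n" for j i
    using that by (simp add: l_def)
  have val: "(\<Sum>j\<le>n. monomial_value (l j) (X i + X k + X q))
      = (\<Sum>j<n. l0 j i * l0 j k * l0 j q) + l n i * l n k * l n q" for i k q
    by (simp add: lessThan_Suc_atMost[symmetric] X_def monomial_value_add lj)
  show thesis
  proof (rule that[of b l])
    show "b j \<noteq> 0" for j by (simp add: b_def)
    show "l n i = (\<Sum>j<n. b j * l j i)" for i
      by (simp add: l_def)
  next
    fix m assume m: "m \<in> monomials {..<n}" "total_degree m = 3"
    then obtain i k q where ikq: "i < n" "k < n" "q < n" and mX: "m = X i + X k + X q"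
      unfolding X_def by (metis lessThan_iff monomial_degree_3)
    show "coeff (\<Sum>j\<le>n. monomial_value (l j) m) 0
        = (\<Sum>j<n. monomial_value (\<lambda>i. if i = j then 1 else 0) m) + 1"
      unfolding mX val using ikq
      by (simp add: coeff_sum coeff_mult_0 ln0 l0_def X_def monomial_value_add)
        (auto intro!: sum.cong)
    have "coeff (\<Sum>j\<le>n. monomial_value (l j) m) 1
      = (\<Sum>j<n. (if j = k then if j = q then c j i else 0 else 0)
          + (if j = i then if j = q then c j k else 0 else 0)
          + (if j = i then if j = k then c j q else 0 else 0)) + (a i + a k + a q)"
      unfolding mX val using ikq
      by (auto simp: coeff_sum coeff_mult_0 coeff_1_mult ln0 ln1 l0_def intro!: sum.cong)
    also have "\<dots> = (if k = q then c k i else 0) + (if i = q then c i k else 0)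
        + (if i = k then c i q else 0) + (a i + a k + a q)"
      using ikq by (auto simp: sum.distrib sum.delta)
    also have "\<dots> = z m"
    proof -
      consider "i = k" "k = q" | "i = k" "k \<noteq> q" | "i = q" "k \<noteq> q" | "k = q" "i \<noteq> q"
        | "i \<noteq> k" "k \<noteq> q" "i \<noteq> q" by blast
      then show ?thesis
      proof cases
        case 1
        have "c q q + c q q + c q q = z (X q + X q + X q) - 3 * a q"
          by (simp only: c_def refl if_True sum_of_thirds)
        with 1 show ?thesis
          by (simp add: mX add_ac)
      next
        case 5
        then show ?thesis
          using a[OF ikq] by (simp add: mX)
      qed (simp_all add: mX c_def add_ac)
    qed
    finally show "coeff (\<Sum>j\<le>n. monomial_value (l j) m) 1 = z m" .
  qed
qed

section \<open>Functionals supported at points\<close>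

lemma point_eval_mult: "poly_eval (*) a (p * q) = poly_eval (*) a p * poly_eval (*) (a :: _ \<Rightarrow> 'k::field) q"
  by (rule poly_eval_mult) (simp_all add: field_module.module_axioms mult.assoc)

lemma point_eval_power: "poly_eval (*) (a :: _ \<Rightarrow> 'k::field) (p ^ c) = poly_eval (*) a p ^ c"
proof (induction c)
  case 0
  show ?case
    by (simp add: poly_eval_eq linear_extension_def)
qed (simp add: point_eval_mult)

text \<open>
  If \<open>P\<close> vanishes at the nonzero elements of \<open>Y\<close> and \<open>P 0 = 1\<close>, then \<open>1 - P\<close> is divisible by the variable,
  and the quotient \<open>k\<close> takes the value \<open>1 / y\<close> at every nonzero \<open>y\<close> in \<open>Y\<close>.
\<close>

lemma power_inverse_interpolation:
  fixes Y :: "'k::field set"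
  assumes "finite Y"
  obtains h where "\<And>y. y \<in> Y \<Longrightarrow> y ^ c * poly h y = y"
proof -
  define P where "P = (\<Prod>y\<in>Y - {0}. [:1, - (1 / y):])"
  have P0: "poly P 0 = 1"
    by (simp add: P_def poly_prod)
  have PY: "poly P y = 0" if "y \<in> Y" "y \<noteq> 0" for y
    unfolding P_def poly_prod using that assms by (intro prod_zero) auto
  obtain a k where ak: "1 - P = pCons a k" by (cases "1 - P")
  have "poly (1 - P) 0 = 0" by (simp add: P0)
  then have k: "1 - P = pCons 0 k" unfolding ak by simp
  have ky: "y * poly k y = 1" if "y \<in> Y" "y \<noteq> 0" for y
  proof -
    have "poly (1 - P) y = 1" by (simp add: PY that)
    then show ?thesis unfolding k by simp
  qed
  show thesis
  proof (rule that)
    fix y assume y: "y \<in> Y"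
    show "y ^ c * poly ([:0, 1:] * k ^ c) y = y"
    proof (cases "y = 0")
      case False
      have "y ^ c * poly ([:0, 1:] * k ^ c) y = y * (y * poly k y) ^ c"
        by (simp add: power_mult_distrib)
      then show ?thesis by (simp add: ky[OF y False])
    qed simp
  qed
qed

lemma point_functional_on_polynomial:
  fixes w :: "'b \<Rightarrow> 'k::field"
  assumes e: "\<And>m. m \<in> monomials {..<N} \<Longrightarrow> e m = (\<Sum>k\<in>K. w k * monomial_value (pt k) m)"
    and r: "r \<in> polys {..<N}"
  shows "linear_extension (*) e r = (\<Sum>k\<in>K. w k * poly_eval (*) (pt k) r)"
proof -
  have "linear_extension (*) e r = (\<Sum>m\<in>Poly_Mapping.keys r. \<Sum>k\<in>K.
      Poly_Mapping.lookup r m * (w k * monomial_value (pt k) m))"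
    unfolding linear_extension_def
    by (rule sum.cong) (use r in \<open>auto simp: polys_def e sum_distrib_left\<close>)
  also have "\<dots> = (\<Sum>k\<in>K. \<Sum>m\<in>Poly_Mapping.keys r.
      Poly_Mapping.lookup r m * (w k * monomial_value (pt k) m))"
    by (rule sum.swap)
  also have "\<dots> = (\<Sum>k\<in>K. w k * poly_eval (*) (pt k) r)"
    by (simp only: poly_eval_eq linear_extension_def sum_distrib_left mult.left_commute)
  finally show ?thesis .
qed

lemma linear_extension_mono_mult:
  "linear_extension (*) (\<lambda>m'. e (m + m')) (q :: ('x, 'k::field) mpoly) = linear_extension (*) e (mono_poly m * q)"
  by (simp add: field_module.linear_extension_mult mono_poly_def)

text \<open>
  With \<open>h\<close> from \<open>power_inverse_interpolation\<close>, the polynomials \<open>q\<close> and \<open>h(q) * q ^ c\<close> have the same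
  values at all points, so the functional does not distinguish their multiples.
\<close>

lemma point_functional_radical:
  fixes w :: "'b \<Rightarrow> 'k::field"
  assumes e: "\<And>m. m \<in> monomials {..<N} \<Longrightarrow> e m = (\<Sum>k\<in>K. w k * monomial_value (pt k) m)"
    and K: "finite K" and q: "q \<in> polys {..<N}" and qc: "q ^ c \<in> annihilator N e"
  shows "q \<in> annihilator N e"
proof -
  let ?ev = "\<lambda>k. poly_eval (*) (pt k)"
  obtain h where h: "\<And>y. y \<in> (\<lambda>k. ?ev k q) ` K \<Longrightarrow> y ^ c * poly h y = y"
    using power_inverse_interpolation[of "(\<lambda>k. ?ev k q) ` K" c] K by blast
  define H where "H = (\<Sum>i\<le>degree h. poly_scale (coeff h i) (q ^ i))"
  have H: "H \<in> polys {..<N}"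
    unfolding H_def by (intro polys_sum polys_scale polys_power q)
  have evH: "?ev k H = poly h (?ev k q)" for k
    by (simp add: H_def poly_altdef poly_eval_eq field_module.linear_extension_sum
        field_module.linear_extension_poly_scale point_eval_power[unfolded poly_eval_eq])
  have "linear_extension (*) (\<lambda>m'. e (m + m')) q = 0" if m: "m \<in> monomials {..<N}" for m
  proof -
    note mN = polys_mono[OF m]
    have rN: "(mono_poly m * H) * q ^ c \<in> polys {..<N}"
      by (intro polys_mult polys_power mN H q)
    have "linear_extension (*) (\<lambda>m'. e (m + m')) q = linear_extension (*) e (mono_poly m * q)"
      by (rule linear_extension_mono_mult)
    also have "\<dots> = (\<Sum>k\<in>K. w k * ?ev k (mono_poly m * q))"
      by (rule point_functional_on_polynomial[OF e polys_mult[OF mN q]])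
    also have "\<dots> = (\<Sum>k\<in>K. w k * ?ev k ((mono_poly m * H) * q ^ c))"
    proof (rule sum.cong)
      fix k assume "k \<in> K"
      then have "?ev k q ^ c * poly h (?ev k q) = ?ev k q" by (intro h) simp
      then show "w k * ?ev k (mono_poly m * q) = w k * ?ev k ((mono_poly m * H) * q ^ c)"
        by (simp only: point_eval_mult point_eval_power evH mult.assoc mult.commute[of "poly h _"])
    qed simp
    also have "\<dots> = linear_extension (*) e ((mono_poly m * H) * q ^ c)"
      by (rule point_functional_on_polynomial[OF e rN, symmetric])
    also have "\<dots> = 0"
      by (rule annihilator_mult[OF qc polys_mult[OF mN H]])
    finally show ?thesis .
  qed
  with q show ?thesis
    by (simp add: annihilator_def)
qed

lemma point_functional_rank:
  fixes w :: "nat \<times> nat \<Rightarrow> 'k::field"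
  assumes e: "\<And>m. m \<in> monomials {..<N} \<Longrightarrow> e m = (\<Sum>k\<in>K. w k * monomial_value (pt k) m)"
    and K: "finite K" "card K = d"
  shows "hankel_rank_le N d e"
  unfolding hankel_rank_le_def
  by (intro exI[of _ K] exI[of _ "\<lambda>k m. w k * monomial_value (pt k) m"]
      exI[of _ "\<lambda>k. monomial_value (pt k)"])
    (use K in \<open>auto simp: e monomials_add monomial_value_add mult.assoc\<close>)

section \<open>Cubic functionals\<close>

text \<open>
  The dual generator with cubic part \<open>T\<close> in the variables below \<open>n\<close> and the sum of the squares of the
  variables from \<open>n\<close> to \<open>h - 1\<close>. Values of \<open>T\<close> at other monomials do not enter, which leaves all
  functions on monomials as a parameter space.
\<close>

definition cubic_functional ::
  "nat \<Rightarrow> nat \<Rightarrow> (nat monomial \<Rightarrow> 'k::field) \<Rightarrow> nat monomial \<Rightarrow> 'k" where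
  "cubic_functional n h T m =
    (if m \<in> monomials {..<n} \<and> total_degree m = 3 then T m
     else if \<exists>k\<in>{n..<h}. m = Poly_Mapping.single k 2 then 1 else 0)"

lemma monomial_degree_1:
  assumes "total_degree m = 1" "m \<in> monomials V"
  obtains x where "x \<in> V" "m = Poly_Mapping.single x 1"
proof -
  have "total_degree m = Suc 0" using assms by simp
  then obtain x m' where "x \<in> V" "m = Poly_Mapping.single x 1 + m'" "total_degree m' = 0"
    using monomial_degree_Suc assms(2) by blast
  then show thesis
    using that[of x] by (simp only: total_degree_eq_0_iff) simp
qed

lemma single_add_eq_double_iff:
  "Poly_Mapping.single a (1::nat) + Poly_Mapping.single b 1 = Poly_Mapping.single k 2
    \<longleftrightarrow> a = k \<and> b = k"
proof
  assume eq: "Poly_Mapping.single a (1::nat) + Poly_Mapping.single b 1 = Poly_Mapping.single k 2"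
  have "Poly_Mapping.lookup (Poly_Mapping.single a (1::nat) + Poly_Mapping.single b 1) x
    = Poly_Mapping.lookup (Poly_Mapping.single k 2) x" for x
    by (simp only: eq)
  from this[of k] show "a = k \<and> b = k"
    by (auto simp: lookup_add lookup_single when_def split: if_splits)
next
  assume "a = k \<and> b = k"
  then show "Poly_Mapping.single a (1::nat) + Poly_Mapping.single b 1 = Poly_Mapping.single k 2"
    by (metis one_add_one single_add)
qed

lemma sum_Times: "sum f (A \<times> B) = (\<Sum>x\<in>A. \<Sum>y\<in>B. f (x, y))"
  by (simp add: sum.cartesian_product)

text \<open>
  A product of monomials on which the functional is nonzero splits as \<open>1\<close> times everything, a variable
  below \<open>n\<close> times a quadratic monomial, or a variable from \<open>n\<close> to \<open>h - 1\<close> times itself. Counting the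
  first two kinds of splitting in both orders gives \<open>2 + 2 * n + (h - n)\<close> summands.
\<close>

lemma cubic_functional_rank:
  fixes T :: "nat monomial \<Rightarrow> 'k::field"
  assumes nh: "n \<le> h"
  shows "hankel_rank_le N (n + h + 2) (cubic_functional n h T)"
proof -
  let ?e = "cubic_functional n h T"
  define X where "X i = Poly_Mapping.single i (1::nat)" for i :: nat
  define G where "G l m = (if m \<in> monomials {..<n} \<and> total_degree m = 2 then T (X l + m) else 0)"
    for l m
  define I where "I P = (if P then 1 else 0 :: 'k)" for P
  \<comment> \<open>The second component of an index names the kind of splitting, the first one the variable.\<close>
  define K where "K = {(0::nat, 0::nat), (0, 1)} \<union> {..<n} \<times> {2, 3} \<union> {n..<h} \<times> {4}"
  define \<alpha> where "\<alpha> k m = (case k of (l, c) \<Rightarrow> if c = 0 then I (m = 0) else if c = 1 then ?e m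
      else if c = 2 then I (m = X l) else if c = 3 then G l m else I (m = X l))"
    for k :: "nat \<times> nat" and m
  define \<beta> where "\<beta> k m = (case k of (l, c) \<Rightarrow> if c = 0 then ?e m else if c = 1 then I (m = 0)
      else if c = 2 then G l m else if c = 3 then I (m = X l) else I (m = X l))"
    for k :: "nat \<times> nat" and m
  have degX: "total_degree (X i) = 1" for i
    by (simp add: X_def)
  have X0: "X i \<noteq> 0" for i
    using degX[of i] by auto
  have Xinj: "X i = X j \<longleftrightarrow> i = j" for i j
    unfolding X_def by (metis keys_single one_neq_zero singleton_inject)
  have Xn: "X i \<in> monomials {..<n} \<longleftrightarrow> i < n" for i
    using monomials_single[of i 0] by (simp add: X_def)
  have e_deg: "?e m = 0" if "total_degree m \<noteq> 2" "total_degree m \<noteq> 3" for m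
    using that by (auto simp: cubic_functional_def)
  have G_deg: "G l m = 0" if "total_degree m \<noteq> 2" for l m
    using that by (simp add: G_def)
  have e_cubic: "?e (X a + m) = (if a < n then G a m else 0)" if m: "total_degree m = 2" for a m
  proof -
    have deg: "total_degree (X a + m) = 3"
      by (simp only: weighted_degree_add degX m)
    have "X a + m \<noteq> Poly_Mapping.single k 2" for k
    proof
      assume "X a + m = Poly_Mapping.single k 2"
      then have "total_degree (X a + m) = 2" by (simp only: weighted_degree_single)
      with deg show False by simp
    qed
    moreover have "X a + m \<in> monomials {..<n} \<longleftrightarrow> a < n \<and> m \<in> monomials {..<n}"
      by (simp only: monomials_add_iff Xn)
    ultimately show ?thesis
      using deg m by (simp add: cubic_functional_def G_def)
  qed
  have sumK: "(\<Sum>k\<in>K. \<alpha> k m * \<beta> k m') = I (m = 0) * ?e m' + ?e m * I (m' = 0)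
      + (\<Sum>l<n. I (m = X l) * G l m') + (\<Sum>l<n. G l m * I (m' = X l))
      + (\<Sum>l\<in>{n..<h}. I (m = X l) * I (m' = X l))" for m m'
  proof -
    have "(\<Sum>k\<in>{..<n} \<times> {2, 3}. \<alpha> k m * \<beta> k m')
      = (\<Sum>l<n. I (m = X l) * G l m') + (\<Sum>l<n. G l m * I (m' = X l))"
      by (simp add: sum_Times \<alpha>_def \<beta>_def sum.distrib)
    moreover have "(\<Sum>k\<in>{n..<h} \<times> {4}. \<alpha> k m * \<beta> k m') = (\<Sum>l\<in>{n..<h}. I (m = X l) * I (m' = X l))"
      by (simp add: sum_Times \<alpha>_def \<beta>_def)
    moreover have "(\<Sum>k\<in>{(0, 0), (0, 1)}. \<alpha> k m * \<beta> k m') = I (m = 0) * ?e m' + ?e m * I (m' = 0)"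
      by (simp add: \<alpha>_def \<beta>_def)
    moreover have "(\<Sum>k\<in>K. \<alpha> k m * \<beta> k m') = (\<Sum>k\<in>{(0, 0), (0, 1)}. \<alpha> k m * \<beta> k m')
        + (\<Sum>k\<in>{..<n} \<times> {2, 3}. \<alpha> k m * \<beta> k m') + (\<Sum>k\<in>{n..<h} \<times> {4}. \<alpha> k m * \<beta> k m')"
      unfolding K_def by (subst sum.union_disjoint; (subst sum.union_disjoint)?) auto
    ultimately show ?thesis by simp
  qed
  have cardK: "card K = n + h + 2" "finite K"
  proof -
    have "card K = card ({(0::nat, 0::nat), (0, 1)} \<union> {..<n} \<times> {2, 3}) + card ({n..<h} \<times> {4::nat})"
      unfolding K_def by (rule card_Un_disjoint) auto
    also have "card ({(0::nat, 0::nat), (0, 1)} \<union> {..<n} \<times> {2, 3})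
      = card {(0::nat, 0::nat), (0, 1)} + card ({..<n} \<times> {2::nat, 3})"
      by (rule card_Un_disjoint) auto
    finally show "card K = n + h + 2"
      using nh by (simp add: card_cartesian_product)
    show "finite K" by (simp add: K_def)
  qed
  have main: "?e (m + m') = (\<Sum>k\<in>K. \<alpha> k m * \<beta> k m')"
    if m: "m \<in> monomials {..<N}" and m': "m' \<in> monomials {..<N}" for m m'
  proof -
    consider "m = 0" | "m' = 0" "m \<noteq> 0" | "total_degree m = 1" "total_degree m' = 1"
      | "total_degree m = 1" "total_degree m' = 2" | "total_degree m = 2" "total_degree m' = 1"
      | "m \<noteq> 0" "m' \<noteq> 0" "total_degree m + total_degree m' > 3"
    proof -
      have "m = 0 \<or> total_degree m \<ge> 1" "m' = 0 \<or> total_degree m' \<ge> 1"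
        using total_degree_eq_0_iff[of m] total_degree_eq_0_iff[of m'] by linarith+
      moreover have "total_degree m = 1 \<and> total_degree m' = 1 \<or> total_degree m = 1 \<and> total_degree m' = 2
         \<or> total_degree m = 2 \<and> total_degree m' = 1 \<or> total_degree m + total_degree m' > 3"
        if "total_degree m \<ge> 1" "total_degree m' \<ge> 1"
        using that by linarith
      ultimately show thesis using that by blast
    qed
    then show ?thesis
    proof cases
      case 1
      have "?e 0 = 0" by (rule e_deg) simp_all
      then show ?thesis
        unfolding sumK 1 using X0 by (auto simp: I_def G_def)
    next
      case 2
      have "?e 0 = 0" by (rule e_deg) simp_all
      with 2 show ?thesis
        unfolding sumK 2 using X0[symmetric] by (auto simp: I_def G_def)
    next
      case 3
      obtain a where a: "m = X a" using monomial_degree_1[OF 3(1) m] unfolding X_def by blast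
      obtain b where b: "m' = X b" using monomial_degree_1[OF 3(2) m'] unfolding X_def by blast
      have "?e (m + m') = (if \<exists>k\<in>{n..<h}. a = k \<and> b = k then 1 else 0)"
        using 3 single_add_eq_double_iff[of a b] by (auto simp: cubic_functional_def a b X_def)
      moreover have "(\<Sum>l\<in>{n..<h}. I (m = X l) * I (m' = X l))
        = (\<Sum>l\<in>{n..<h}. if l = a then I (a = b) else 0)"
        by (intro sum.cong) (auto simp: a b Xinj I_def)
      ultimately show ?thesis
        unfolding sumK using 3 by (auto simp: I_def G_def a b X0 sum.delta)
    next
      case 4
      obtain a where a: "m = X a" using monomial_degree_1[OF 4(1) m] unfolding X_def by blast
      have m'0: "m' \<noteq> 0" "m' \<noteq> X l" for l
        using 4 degX[of l] by auto
      have "?e (m + m') = (if a < n then G a m' else 0)"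
        unfolding a by (rule e_cubic[OF 4(2)])
      moreover have "(\<Sum>l<n. I (m = X l) * G l m') = (\<Sum>l<n. if l = a then G a m' else 0)"
        by (intro sum.cong) (auto simp: a Xinj I_def)
      ultimately show ?thesis
        unfolding sumK using 4 m'0 by (auto simp: I_def a X0 sum.delta)
    next
      case 5
      obtain a where a: "m' = X a" using monomial_degree_1[OF 5(2) m'] unfolding X_def by blast
      have m0: "m \<noteq> 0" "m \<noteq> X l" for l
        using 5 degX[of l] by auto
      have "?e (m + m') = (if a < n then G a m else 0)"
        unfolding a add.commute[of m] by (rule e_cubic[OF 5(1)])
      moreover have "(\<Sum>l<n. G l m * I (m' = X l)) = (\<Sum>l<n. if l = a then G a m else 0)"
        by (intro sum.cong) (auto simp: a Xinj I_def)
      ultimately show ?thesis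
        unfolding sumK using 5 m0 by (auto simp: I_def a X0 sum.delta)
    next
      case 6
      have e0: "?e (m + m') = 0"
        using 6 by (intro e_deg) auto
      have z1: "I (m = X l) * G l m' = 0" for l
        using 6 degX[of l] by (auto simp: I_def G_def)
      have z2: "G l m * I (m' = X l) = 0" for l
        using 6 degX[of l] by (auto simp: I_def G_def)
      have z3: "I (m = X l) * I (m' = X l) = 0" for l
        using 6 degX[of l] by (auto simp: I_def)
      show ?thesis
        unfolding sumK e0 z1 z2 z3 using 6 by (simp add: I_def)
    qed
  qed
  show ?thesis
    unfolding hankel_rank_le_def
    by (intro exI[of _ K] exI[of _ \<alpha>] exI[of _ \<beta>]) (use cardK main in auto)
qed

section \<open>Points that converge to a cubic functional\<close>

lemma monomial_value_cong:
  assumes "\<And>x. x \<in> Poly_Mapping.keys m \<Longrightarrow> a x = b x"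
  shows "monomial_value a m = monomial_value b m"
  unfolding monomial_value_def by (rule prod.cong) (simp_all add: assms)

lemma monomial_value_axis:
  "monomial_value (\<lambda>i. if i = k then u else 0) m
    = (if Poly_Mapping.keys m \<subseteq> {k} then u ^ total_degree m else (0 :: 'a::comm_ring_1))"
proof (cases "Poly_Mapping.keys m \<subseteq> {k}")
  case True
  then have "Poly_Mapping.keys m = {} \<or> Poly_Mapping.keys m = {k}" by blast
  then show ?thesis
    by (auto simp: monomial_value_def weighted_degree_def)
next
  case False
  then obtain x where x: "x \<in> Poly_Mapping.keys m" "x \<noteq> k" by blast
  have "monomial_value (\<lambda>i. if i = k then u else 0) m = 0"
    unfolding monomial_value_def
    by (rule prod_zero) (use x in \<open>auto simp: in_keys_iff zero_power intro!: bexI[of _ x]\<close>)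
  with False show ?thesis by simp
qed

lemma monomial_value_weighted:
  "monomial_value (\<lambda>i. c * (u ^ W i * Q i)) m
    = c ^ total_degree m * (u ^ weighted_degree W m * monomial_value Q m)"
proof -
  have "monomial_value (\<lambda>i. c) m = c ^ total_degree m"
    using monomial_value_power[of c "\<lambda>_. 1" m] by simp
  then show ?thesis
    by (simp only: monomial_value_mult monomial_value_power)
qed

lemma keys_subset_singleton_iff:
  "Poly_Mapping.keys (m :: 'x monomial) \<subseteq> {k} \<longleftrightarrow> m = Poly_Mapping.single k (total_degree m)"
proof
  assume sub: "Poly_Mapping.keys m \<subseteq> {k}"
  then have "Poly_Mapping.keys m = {} \<or> Poly_Mapping.keys m = {k}" by blast
  then have deg: "total_degree m = Poly_Mapping.lookup m k"
    by (auto simp: weighted_degree_def in_keys_iff)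
  show "m = Poly_Mapping.single k (total_degree m)"
    unfolding deg by (rule poly_mapping_eqI) (use sub in \<open>auto simp: lookup_single when_def in_keys_iff\<close>)
next
  assume eq: "m = Poly_Mapping.single k (total_degree m)"
  show "Poly_Mapping.keys m \<subseteq> {k}"
    by (subst eq) (simp add: keys_single)
qed

text \<open>
  In what follows, the point with index \<open>(j, 0)\<close> or \<open>(j, 1)\<close> has coordinates
  \<open>\<plusminus> u\<^sup>2 * \<kappa> j * l j\<close> in the directions below \<open>n\<close> and \<open>\<mp> u ^ 5 * (\<kappa> j)\<^sup>3 / (n + 1)\<close> in the directions from \<open>n\<close>
  to \<open>h - 1\<close>; the point with index \<open>(k, 2)\<close> lies on the axis \<open>k\<close> at distance \<open>u\<close>.

  The odd part \<open>\<plusminus> 1 / (2 * (\<kappa> j)\<^sup>3 * u ^ 6)\<close> of the weights is chosen such that the points reproduce the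
  sum of the cubes of the \<open>l j\<close>. On variables below \<open>n\<close> it yields \<open>u\<close> to the power \<open>-4\<close> times the sum of
  the \<open>\<alpha> j * l j\<close>, which is zero. The weight \<open>1 / u\<^sup>2\<close> at a point of an axis produces the value \<open>1\<close> on the
  square of that variable, but also the values \<open>1 / u\<close> on the variable and \<open>1 / u\<^sup>2\<close> on the monomial \<open>1\<close>.
  The small coordinates of the pairs in the directions from \<open>n\<close> on cancel the former, the constant part
  of their weights cancels the latter. All other contributions are multiples of \<open>u\<close>.
\<close>

context
  fixes n h :: nat and l :: "nat \<Rightarrow> nat \<Rightarrow> 'k::field_char_0" and T :: "nat monomial \<Rightarrow> 'k"
    and \<alpha> \<kappa> :: "nat \<Rightarrow> 'k"
  assumes nh: "n \<le> h"
    and T: "\<And>m. m \<in> monomials {..<n} \<Longrightarrow> total_degree m = 3 \<Longrightarrow> T m = (\<Sum>j\<le>n. monomial_value (l j) m)"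
    and rel: "\<And>i. i < n \<Longrightarrow> (\<Sum>j\<le>n. \<alpha> j * l j i) = 0"
    and \<alpha>: "\<And>j. j \<le> n \<Longrightarrow> \<alpha> j \<noteq> 0" and \<kappa>: "\<And>j. j \<le> n \<Longrightarrow> \<kappa> j ^ 2 = 1 / \<alpha> j"
begin

definition "coordinate_weight i = (if i < n then 2 else 5 :: nat)" for i :: nat
definition "rescaled_form j i = (if i < n then \<kappa> j * l j i else if i < h then - (\<kappa> j ^ 3 / of_nat (n + 1)) else 0)" for i j
text \<open>
  The pairs contribute \<open>odd_moment\<close> to the values on monomials of odd degree, \<open>even_moment\<close> to those of
  even degree, and the axis points contribute \<open>axis_moment\<close>, each times a power of \<open>u\<close>. Replacing these
  powers by monomials of the polynomial ring gives \<open>moment_poly\<close>. On monomials of degree at most one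
  the contributions cancel.
\<close>

definition "odd_moment m = (\<Sum>j\<le>n. monomial_value (rescaled_form j) m / \<kappa> j ^ 3)"
definition "even_moment m = - (of_nat (h - n) / of_nat (n + 1)) * (\<Sum>j\<le>n. monomial_value (rescaled_form j) m)"
definition "axis_moment m = (of_nat (card {k \<in> {n..<h}. Poly_Mapping.keys m \<subseteq> {k}}) :: 'k)" for m :: "nat monomial"
definition "moment_poly m = (if total_degree m \<le> 1 then 0 else
   (if odd (total_degree m) then monom (odd_moment m) (weighted_degree coordinate_weight m - 6)
    else monom (even_moment m) (weighted_degree coordinate_weight m - 2)) + monom (axis_moment m) (total_degree m - 2))"
  for m
definition "point_indices = {..n} \<times> {0, 1} \<union> {n..<h} \<times> {2::nat}"
definition "point_at u k i = (case k of (j, s) \<Rightarrow> if s = 2 then (if i = j then u else 0)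
   else (if s = 0 then 1 else - 1) * (u ^ coordinate_weight i * rescaled_form j i))" for u and k :: "nat \<times> nat" and i
definition "point_weight u k = (case k of (j, s) \<Rightarrow> if s = 2 then 1 / u ^ 2
   else (if s = 0 then 1 else - 1) / (2 * \<kappa> j ^ 3 * u ^ 6) - of_nat (h - n) / (2 * of_nat (n + 1) * u ^ 2))"
  for u and k :: "nat \<times> nat"

lemma \<kappa>_nonzero: "j \<le> n \<Longrightarrow> \<kappa> j \<noteq> 0"
  using \<kappa>[of j] \<alpha>[of j] by auto

lemma n1_nonzero: "(of_nat (n + 1) :: 'k) \<noteq> 0"
  by (simp only: of_nat_eq_0_iff)

lemma card_point_indices: "finite point_indices" "card point_indices = n + h + 2"
proof -
  show "finite point_indices" by (simp add: point_indices_def)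
  have "card point_indices = card ({..n} \<times> {0::nat, 1}) + card ({n..<h} \<times> {2::nat})"
    unfolding point_indices_def by (rule card_Un_disjoint) auto
  then show "card point_indices = n + h + 2"
    using nh by (simp add: card_cartesian_product)
qed

text \<open>
  By the choice of \<open>\<kappa>\<close>, the factors \<open>\<kappa> j / (\<kappa> j)\<^sup>3\<close> are the coefficients \<open>\<alpha> j\<close> of the relation.
\<close>

lemma odd_moment_cubic_variable:
  assumes "i < n"
  shows "odd_moment (Poly_Mapping.single i 1) = 0"
proof -
  have "odd_moment (Poly_Mapping.single i 1) = (\<Sum>j\<le>n. \<alpha> j * l j i)"
    unfolding odd_moment_def
  proof (rule sum.cong)
    fix j assume j: "j \<in> {..n}"
    have "\<kappa> j * l j i / \<kappa> j ^ 3 = l j i / \<kappa> j ^ 2"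
      using \<kappa>_nonzero[of j] j by (simp add: power3_eq_cube power2_eq_square)
    also have "\<dots> = \<alpha> j * l j i"
      using \<kappa>[of j] \<alpha>[of j] j by simp
    finally show "monomial_value (rescaled_form j) (Poly_Mapping.single i 1) / \<kappa> j ^ 3 = \<alpha> j * l j i"
      using assms by (simp add: rescaled_form_def)
  qed simp
  then show ?thesis using rel[OF assms] by simp
qed

lemma odd_moment_square_variable:
  assumes "n \<le> i" "i < h"
  shows "odd_moment (Poly_Mapping.single i 1) = - 1"
proof -
  have "odd_moment (Poly_Mapping.single i 1) = (\<Sum>j\<le>n. - (1 / of_nat (n + 1)))"
    unfolding odd_moment_def
  proof (rule sum.cong)
    fix j assume "j \<in> {..n}"
    then show "monomial_value (rescaled_form j) (Poly_Mapping.single i 1) / \<kappa> j ^ 3 = - (1 / of_nat (n + 1))"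
      using assms \<kappa>_nonzero[of j] by (simp add: rescaled_form_def)
  qed simp
  also have "\<dots> = - (of_nat (n + 1) * (1 / of_nat (n + 1)))"
    by simp
  also have "\<dots> = -1"
    using n1_nonzero by simp
  finally show ?thesis .
qed

lemma axis_moment_single:
  "axis_moment (Poly_Mapping.single i (Suc k)) = (if i \<in> {n..<h} then 1 else 0)"
proof -
  have "{k' \<in> {n..<h}. Poly_Mapping.keys (Poly_Mapping.single i (Suc k)) \<subseteq> {k'}}
    = (if i \<in> {n..<h} then {i} else {})"
    by auto
  then show ?thesis by (simp add: axis_moment_def)
qed

lemma coordinate_weight_ge: "2 * total_degree m \<le> weighted_degree coordinate_weight m"
  unfolding weighted_degree_def sum_distrib_left
  by (rule sum_mono) (simp add: coordinate_weight_def)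

lemma coordinate_weight_cubic_variables:
  "m \<in> monomials {..<n} \<Longrightarrow> weighted_degree coordinate_weight m = 2 * total_degree m"
  unfolding weighted_degree_def sum_distrib_left
  by (rule sum.cong) (auto simp: coordinate_weight_def monomials_def)

lemma coordinate_weight_gt:
  assumes "m \<notin> monomials {..<n}"
  shows "2 * total_degree m < weighted_degree coordinate_weight m"
proof -
  obtain x where x: "x \<in> Poly_Mapping.keys m" "\<not> x < n"
    using assms by (auto simp: monomials_def)
  obtain m' where m': "m = Poly_Mapping.single x 1 + m'"
    using monomial_split_variable[OF x(1)] by blast
  show ?thesis
    unfolding m' using coordinate_weight_ge[of m'] x by (simp add: coordinate_weight_def)
qed

lemma sum_over_points:
  assumes u: "u \<noteq> 0"
  shows "(\<Sum>k\<in>point_indices. point_weight u k * monomial_value (point_at u k) m)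
    = (if odd (total_degree m) then u ^ weighted_degree coordinate_weight m / u ^ 6 * odd_moment m
       else u ^ weighted_degree coordinate_weight m / u ^ 2 * even_moment m) + u ^ total_degree m / u ^ 2 * axis_moment m"
proof -
  define w where "w = u ^ weighted_degree coordinate_weight m"
  define v where "v j = monomial_value (rescaled_form j) m" for j
  have pm: "monomial_value (point_at u (j, s)) m
      = (if s = 0 then 1 else - 1) ^ total_degree m * (w * v j)" if "s = 0 \<or> s = 1" for j s
  proof -
    have "point_at u (j, s) = (\<lambda>i. (if s = 0 then 1 else - 1) * (u ^ coordinate_weight i * rescaled_form j i))"
      using that by (auto simp: point_at_def fun_eq_iff)
    then show ?thesis
      by (simp only: monomial_value_weighted w_def v_def)
  qed
  have axis: "monomial_value (point_at u (j, 2)) m = (if Poly_Mapping.keys m \<subseteq> {j} then u ^ total_degree m else 0)" for j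
    unfolding monomial_value_axis[symmetric] point_at_def by simp
  have "(\<Sum>k\<in>point_indices. point_weight u k * monomial_value (point_at u k) m)
      = (\<Sum>j\<le>n. point_weight u (j, 0) * monomial_value (point_at u (j, 0)) m + point_weight u (j, 1) * monomial_value (point_at u (j, 1)) m)
      + (\<Sum>j\<in>{n..<h}. point_weight u (j, 2) * monomial_value (point_at u (j, 2)) m)"
    unfolding point_indices_def by (subst sum.union_disjoint) (auto simp: sum_Times)
  also have "(\<Sum>j\<in>{n..<h}. point_weight u (j, 2) * monomial_value (point_at u (j, 2)) m)
      = (\<Sum>j\<in>{n..<h}. if Poly_Mapping.keys m \<subseteq> {j} then u ^ total_degree m / u ^ 2 else 0)"
    by (rule sum.cong) (auto simp: axis point_weight_def)
  also have "\<dots> = (\<Sum>j\<in>{j \<in> {n..<h}. Poly_Mapping.keys m \<subseteq> {j}}. u ^ total_degree m / u ^ 2)"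
    by (simp only: sum.inter_filter[symmetric] finite_atLeastLessThan)
  also have "\<dots> = u ^ total_degree m / u ^ 2 * axis_moment m"
    by (simp add: axis_moment_def)
  also have "(\<Sum>j\<le>n. point_weight u (j, 0) * monomial_value (point_at u (j, 0)) m + point_weight u (j, 1) * monomial_value (point_at u (j, 1)) m)
    = (if odd (total_degree m) then w / u ^ 6 * odd_moment m else w / u ^ 2 * even_moment m)"
  proof (cases "odd (total_degree m)")
    case True
    have "(\<Sum>j\<le>n. point_weight u (j, 0) * monomial_value (point_at u (j, 0)) m + point_weight u (j, 1) * monomial_value (point_at u (j, 1)) m)
      = (\<Sum>j\<le>n. w / u ^ 6 * (v j / \<kappa> j ^ 3))"
    proof (rule sum.cong)
      fix j assume j: "j \<in> {..n}"
      have "point_weight u (j, 0) * monomial_value (point_at u (j, 0)) m + point_weight u (j, 1) * monomial_value (point_at u (j, 1)) m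
        = (point_weight u (j, 0) - point_weight u (j, 1)) * (w * v j)"
        using True by (simp add: pm algebra_simps)
      also have "point_weight u (j, 0) - point_weight u (j, 1) = 1 / (\<kappa> j ^ 3 * u ^ 6)"
        using \<kappa>_nonzero[of j] j u by (simp add: point_weight_def field_simps)
      finally show "point_weight u (j, 0) * monomial_value (point_at u (j, 0)) m + point_weight u (j, 1) * monomial_value (point_at u (j, 1)) m
        = w / u ^ 6 * (v j / \<kappa> j ^ 3)" by simp
    qed simp
    with True show ?thesis
      by (simp add: odd_moment_def v_def sum_distrib_left)
  next
    case False
    have "(\<Sum>j\<le>n. point_weight u (j, 0) * monomial_value (point_at u (j, 0)) m + point_weight u (j, 1) * monomial_value (point_at u (j, 1)) m)
      = (\<Sum>j\<le>n. w / u ^ 2 * (- (of_nat (h - n) / of_nat (n + 1)) * v j))"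
    proof (rule sum.cong)
      fix j assume j: "j \<in> {..n}"
      have "point_weight u (j, 0) * monomial_value (point_at u (j, 0)) m + point_weight u (j, 1) * monomial_value (point_at u (j, 1)) m
        = (point_weight u (j, 0) + point_weight u (j, 1)) * (w * v j)"
        using False by (simp add: pm algebra_simps)
      also have "point_weight u (j, 0) + point_weight u (j, 1) = - 2 * (of_nat (h - n) / (2 * of_nat (n + 1) * u ^ 2))"
        by (simp add: point_weight_def)
      also have "\<dots> = - (of_nat (h - n) / of_nat (n + 1)) / u ^ 2"
      proof -
        have "- 2 * (a / (2 * c * y)) = - (a / c) / y" for a c y :: 'k
          by simp
        then show ?thesis by this
      qed
      finally show "point_weight u (j, 0) * monomial_value (point_at u (j, 0)) m + point_weight u (j, 1) * monomial_value (point_at u (j, 1)) m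
        = w / u ^ 2 * (- (of_nat (h - n) / of_nat (n + 1)) * v j)"
        by (simp add: mult_ac)
    qed simp
    also have "\<dots> = w / u ^ 2 * even_moment m"
      by (simp only: even_moment_def v_def sum_distrib_left)
    finally show ?thesis using False by simp
  qed
  finally show ?thesis
    by (simp only: w_def)
qed

lemma moment_poly_eq_sum_over_points:
  assumes u: "u \<noteq> 0"
  shows "poly (moment_poly m) u = (\<Sum>k\<in>point_indices. point_weight u k * monomial_value (point_at u k) m)"
proof -
  consider "m = 0" | "total_degree m = 1" | "total_degree m \<ge> 2" "even (total_degree m)"
    | "total_degree m \<ge> 3" "odd (total_degree m)"
  proof -
    have "total_degree m = 0 \<or> total_degree m = 1 \<or> total_degree m \<ge> 2 \<and> even (total_degree m)
      \<or> total_degree m \<ge> 3 \<and> odd (total_degree m)" by presburger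
    then show thesis
    proof (elim disjE conjE)
      assume "total_degree m = 0"
      then show thesis by (intro that(1)) (simp only: total_degree_eq_0_iff)
    qed (rule that; assumption)+
  qed
  then show ?thesis
  proof cases
    case 1
    have "even_moment 0 = - of_nat (h - n)"
      using n1_nonzero by (simp add: even_moment_def)
    moreover have "axis_moment 0 = of_nat (h - n)"
    proof -
      have "{k \<in> {n..<h}. Poly_Mapping.keys (0 :: nat monomial) \<subseteq> {k}} = {n..<h}" by auto
      then show ?thesis by (simp only: axis_moment_def card_atLeastLessThan)
    qed
    ultimately show ?thesis
      unfolding sum_over_points[OF u] 1 by (simp add: moment_poly_def)
  next
    case 2
    then obtain i where i: "m = Poly_Mapping.single i 1"
      using monomial_degree_1[of m UNIV] by (auto simp: monomials_def)
    have main: "u ^ weighted_degree coordinate_weight m / u ^ 6 * odd_moment m + u ^ total_degree m / u ^ 2 * axis_moment m = 0"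
    proof -
      consider "i < n" | "n \<le> i" "i < h" | "h \<le> i" by linarith
      then show ?thesis
      proof cases
        case 1
        then show ?thesis
          using odd_moment_cubic_variable[OF 1] axis_moment_single[of i 0] by (simp add: i)
      next
        case 2
        have "u ^ 5 / u ^ 6 = 1 / u" "u / u ^ 2 = 1 / u"
          using u by (simp_all add: power_eq_if power2_eq_square)
        then show ?thesis
          using odd_moment_square_variable[OF 2] axis_moment_single[of i 0] 2 by (simp add: i coordinate_weight_def)
      next
        case 3
        then have "odd_moment m = 0"
          using nh by (simp add: i odd_moment_def rescaled_form_def)
        then show ?thesis
          using axis_moment_single[of i 0] 3 by (simp add: i)
      qed
    qed
    then show ?thesis
      unfolding sum_over_points[OF u] using 2 by (simp add: moment_poly_def)
  next
    case 3
    have "2 \<le> weighted_degree coordinate_weight m"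
      using coordinate_weight_ge[of m] 3 by linarith
    then show ?thesis
      unfolding sum_over_points[OF u] using 3 u
      by (simp add: moment_poly_def poly_monom power_diff mult.commute)
  next
    case 4
    have "6 \<le> weighted_degree coordinate_weight m"
      using coordinate_weight_ge[of m] 4 by linarith
    then show ?thesis
      unfolding sum_over_points[OF u] using 4 u
      by (simp add: moment_poly_def poly_monom power_diff mult.commute)
  qed
qed

lemma poly_monom_0: "poly (monom c k) 0 = (if k = 0 then c else (0 :: 'k))"
  by (simp add: poly_monom power_0_left)

lemma moment_poly_at_0: "poly (moment_poly m) 0 = cubic_functional n h T m"
proof -
  have double: "m = Poly_Mapping.single k 2 \<longleftrightarrow> Poly_Mapping.keys m \<subseteq> {k}" if "total_degree m = 2" for k
    using that keys_subset_singleton_iff[of m k] by simp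
  have not_double: "m \<noteq> Poly_Mapping.single k 2" if "total_degree m \<noteq> 2" for k
    using that by auto
  consider "total_degree m \<le> 1" | "total_degree m = 2" | "total_degree m = 3" "m \<in> monomials {..<n}"
    | "total_degree m = 3" "m \<notin> monomials {..<n}" | "total_degree m \<ge> 4" by linarith
  then show ?thesis
  proof cases
    case 1
    then show ?thesis
      using not_double by (auto simp: moment_poly_def cubic_functional_def)
  next
    case 2
    have "weighted_degree coordinate_weight m \<ge> 4"
      using coordinate_weight_ge[of m] 2 by linarith
    then have "poly (moment_poly m) 0 = axis_moment m"
      using 2 by (simp add: moment_poly_def poly_monom_0)
    also have "\<dots> = cubic_functional n h T m"
    proof (cases "\<exists>k\<in>{n..<h}. m = Poly_Mapping.single k 2")
      case True
      then obtain k where k: "k \<in> {n..<h}" "m = Poly_Mapping.single k (Suc 1)"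
        by (auto simp: numeral_2_eq_2)
      then show ?thesis
        using axis_moment_single[of k 1] True 2 by (auto simp: cubic_functional_def)
    next
      case False
      then have none: "{k \<in> {n..<h}. Poly_Mapping.keys m \<subseteq> {k}} = {}"
        using double[OF 2] by blast
      have "axis_moment m = 0"
        unfolding axis_moment_def none by simp
      then show ?thesis
        using False 2 by (simp add: cubic_functional_def)
    qed
    finally show ?thesis .
  next
    case 3
    have wd: "weighted_degree coordinate_weight m = 6"
      using coordinate_weight_cubic_variables[OF 3(2)] 3(1) by simp
    have "monomial_value (rescaled_form j) m / \<kappa> j ^ 3 = monomial_value (l j) m" if j: "j \<le> n" for j
    proof -
      have "monomial_value (rescaled_form j) m = monomial_value (\<lambda>i. \<kappa> j * (1 ^ 1 * l j i)) m"
        by (rule monomial_value_cong) (use 3(2) in \<open>auto simp: rescaled_form_def monomials_def\<close>)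
      also have "\<dots> = \<kappa> j ^ 3 * monomial_value (l j) m"
        using monomial_value_weighted[of "\<kappa> j" 1 "\<lambda>_. 1" "l j" m] 3(1) by simp
      finally show ?thesis using \<kappa>_nonzero[OF j] by simp
    qed
    then have "odd_moment m = T m"
      using T[OF 3(2,1)] by (simp add: odd_moment_def)
    then show ?thesis
      using 3 wd by (simp add: moment_poly_def poly_monom_0 cubic_functional_def)
  next
    case 4
    then have "weighted_degree coordinate_weight m > 6"
      using coordinate_weight_gt[OF 4(2)] by linarith
    then show ?thesis
      using 4 not_double by (auto simp: moment_poly_def poly_monom_0 cubic_functional_def)
  next
    case 5
    then have "weighted_degree coordinate_weight m \<ge> 8"
      using coordinate_weight_ge[of m] by linarith
    then show ?thesis
      using 5 not_double by (auto simp: moment_poly_def poly_monom_0 cubic_functional_def)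
  qed
qed

lemma points_near_sum_of_cubes:
  assumes U: "openin (hilb_topology N (n + h + 2)) U"
    and T0: "annihilator N (cubic_functional n h T) \<in> U"
  shows "\<exists>I \<in> hilb_reduced N (n + h + 2). I \<in> U"
proof -
  interpret univ: function_ring "univariate_functions :: ('k \<Rightarrow> 'k) set"
    by (rule function_ring_univariate)
  define e where "e u m = poly (moment_poly m) u" for u m
  have e0: "e 0 = cubic_functional n h T"
    by (simp add: e_def moment_poly_at_0 fun_eq_iff)
  have eu: "e u m = (\<Sum>k\<in>point_indices. point_weight u k * monomial_value (point_at u k) m)" if "u \<noteq> 0" for u m
    unfolding e_def by (rule moment_poly_eq_sum_over_points[OF that])
  have rank: "hankel_rank_le N (n + h + 2) (e u)" for u
  proof (cases "u = 0")
    case True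
    then show ?thesis using cubic_functional_rank[OF nh] by (simp add: e0)
  next
    case False
    show ?thesis
      by (rule point_functional_rank[OF eu[OF False] card_point_indices])
  qed
  have "(\<lambda>u. e u m) \<in> univariate_functions" for m
    by (auto simp: e_def univariate_functions_def)
  then have "\<exists>f\<in>univariate_functions. f 0 \<noteq> 0 \<and> (\<forall>u. f u \<noteq> 0 \<longrightarrow> annihilator N (e u) \<in> U)"
    using univ.open_family[of N e "n + h + 2" U 0] rank U T0 by (simp add: e0)
  then obtain f where f: "f \<in> univariate_functions" "f 0 \<noteq> 0"
    "\<And>u. f u \<noteq> 0 \<Longrightarrow> annihilator N (e u) \<in> U" by blast
  from f(1) obtain p where p: "\<And>u. poly p u = f u"
    by (rule univariate_functionsE) (rule that)
  have "p \<noteq> 0" using p[of 0] f(2) by auto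
  then have "finite (insert 0 {u. poly p u = 0})"
    by (simp add: poly_roots_finite)
  then obtain u where u: "u \<notin> insert 0 {u. poly p u = 0}"
    using ex_new_if_finite[OF infinite_UNIV_char_0] by blast
  then have uU: "annihilator N (e u) \<in> U" and u0: "u \<noteq> 0"
    using f(3) p by auto
  have "U \<subseteq> topspace (hilb_topology N (n + h + 2))"
    by (rule openin_subset[OF U])
  also have "\<dots> \<subseteq> hilb N (n + h + 2)"
    unfolding hilb_topology_def topology_generated_by_topspace
    by (auto simp: principal_open_def chart_def)
  finally have "annihilator N (e u) \<in> hilb N (n + h + 2)"
    using uU by blast
  then have "annihilator N (e u) \<in> hilb_reduced N (n + h + 2)"
    unfolding hilb_reduced_def
    using point_functional_radical[OF eu[OF u0] card_point_indices(1)] by blast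
  with uU show ?thesis by blast
qed

end

text \<open>
  A neighbourhood of the given annihilator contains the annihilators of all \<open>T\<close> outside the zero set of
  some polynomial function, hence one for a sum of cubes on the curve of \<open>cube_sums_tangent_space\<close>. Only
  finitely many points of the curve have to be avoided to keep the coefficients of the relation nonzero.
\<close>

lemma cubic_functional_limit_of_points:
  fixes T :: "nat monomial \<Rightarrow> 'k::{alg_closed_field, field_char_0}"
  assumes n: "n \<le> 4" and nh: "n \<le> h"
    and U: "openin (hilb_topology N (n + h + 2)) U"
    and T0: "annihilator N (cubic_functional n h T) \<in> U"
  shows "\<exists>I \<in> hilb_reduced N (n + h + 2). I \<in> U"
proof -
  have "(\<lambda>T. cubic_functional n h T m) \<in> polynomial_functions" for m
    unfolding cubic_functional_def
    by (cases "m \<in> monomials {..<n} \<and> total_degree m = 3")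
      (auto intro: polynomial_functions.coord polynomial_functions.const)
  then have "\<exists>f\<in>polynomial_functions. f T \<noteq> 0 \<and>
      (\<forall>T. f T \<noteq> 0 \<longrightarrow> annihilator N (cubic_functional n h T) \<in> U)"
    by (intro polyfun.open_family[where e = "cubic_functional n h" and d = "n + h + 2"]
        cubic_functional_rank nh U T0)
  then obtain f where f: "f \<in> polynomial_functions" "f T \<noteq> 0"
    "\<And>T. f T \<noteq> 0 \<Longrightarrow> annihilator N (cubic_functional n h T) \<in> U" by blast
  define y0 :: "nat monomial \<Rightarrow> 'k" where
    "y0 m = (\<Sum>j<n. monomial_value (\<lambda>i. if i = j then 1 else 0) m) + 1" for m
  obtain z where z: "\<forall>Y. (\<forall>m. coeff (Y m) 0 = y0 m \<and> coeff (Y m) 1 = z m) \<longrightarrow>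
      finite {s. f (\<lambda>m. poly (Y m) s) = 0}"
    using nonzero_on_curves_in_some_direction[where f = f and ?y1.0 = T and ?y0.0 = y0, OF f(1,2)]
    by (rule exE)
  obtain l :: "nat \<Rightarrow> nat \<Rightarrow> 'k poly" and b where b: "\<And>j. b j \<noteq> 0"
    and ln: "\<And>i. l n i = (\<Sum>j<n. b j * l j i)"
    and l0: "\<And>m. m \<in> monomials {..<n} \<Longrightarrow> total_degree m = 3 \<Longrightarrow>
      coeff (\<Sum>j\<le>n. monomial_value (l j) m) 0
        = (\<Sum>j<n. monomial_value (\<lambda>i. if i = j then 1 else 0) m) + 1"
    and l1: "\<And>m. m \<in> monomials {..<n} \<Longrightarrow> total_degree m = 3 \<Longrightarrow>
      coeff (\<Sum>j\<le>n. monomial_value (l j) m) 1 = z m"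
    by (rule cube_sums_tangent_space[OF n, where z = z]) (rule that)
  define Y where "Y m = (if m \<in> monomials {..<n} \<and> total_degree m = 3
    then \<Sum>j\<le>n. monomial_value (l j) m else [:y0 m, z m:])" for m
  have "finite {s. f (\<lambda>m. poly (Y m) s) = 0}"
    by (rule z[rule_format]) (simp add: Y_def y0_def l0 l1[simplified])
  moreover have "finite {s. poly (b j) s = 0}" for j
    by (rule poly_roots_finite[OF b])
  ultimately have "finite ({s. f (\<lambda>m. poly (Y m) s) = 0} \<union> (\<Union>j<n. {s. poly (b j) s = 0}))"
    by blast
  then obtain s where s: "s \<notin> {s. f (\<lambda>m. poly (Y m) s) = 0} \<union> (\<Union>j<n. {s. poly (b j) s = 0})"
    using ex_new_if_finite[OF infinite_UNIV_char_0] by blast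
  let ?T = "\<lambda>m. poly (Y m) s"
  define \<alpha> where "\<alpha> j = (if j = n then - 1 else poly (b j) s)" for j
  have "\<exists>y. y ^ 2 = 1 / \<alpha> j" for j
    by (rule nth_root_exists) simp
  then obtain \<kappa> where \<kappa>: "\<And>j. \<kappa> j ^ 2 = 1 / \<alpha> j" by metis
  show ?thesis
  proof (rule points_near_sum_of_cubes[OF nh])
    fix m assume m: "m \<in> monomials {..<n}" "total_degree m = 3"
    have "poly (monomial_value (l j) m) s = monomial_value (\<lambda>i. poly (l j i) s) m" for j
      by (simp add: monomial_value_def poly_prod)
    with m show "?T m = (\<Sum>j\<le>n. monomial_value (\<lambda>i. poly (l j i) s) m)"
      by (simp add: Y_def poly_sum)
  next
    fix i
    show "(\<Sum>j\<le>n. \<alpha> j * poly (l j i) s) = 0"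
      by (simp add: lessThan_Suc_atMost[symmetric] \<alpha>_def ln poly_sum)
  next
    show "\<alpha> j \<noteq> 0" if "j \<le> n" for j
      using that s by (auto simp: \<alpha>_def)
    show "\<kappa> j ^ 2 = 1 / \<alpha> j" for j by (rule \<kappa>)
    show "annihilator N (cubic_functional n h ?T) \<in> U"
      using s by (intro f(3)) simp
  qed (rule U)
qed

section \<open>Linear algebra in an Artinian algebra\<close>

context artinian_algebra
begin

definition "chosen_basis = (SOME B. finite B \<and> independent B \<and> span B = UNIV)"

lemma chosen_basis: "finite chosen_basis \<and> independent chosen_basis \<and> span chosen_basis = UNIV"
proof -
  obtain B where B: "finite B" "span B = UNIV" using finite_dim by blast
  obtain D where D: "D \<subseteq> B" "independent D" "B \<subseteq> span D"
    using maximal_independent_subset[of B] by blast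
  have "span D = UNIV"
    using B(2) span_minimal[OF D(3)] by auto
  moreover have "finite D" using D(1) B(1) by (rule finite_subset)
  ultimately have "\<exists>B. finite B \<and> independent B \<and> span B = UNIV"
    using D(2) by blast
  then show ?thesis unfolding chosen_basis_def by (rule someI_ex)
qed

sublocale finite_dimensional_vector_space smul chosen_basis
  using chosen_basis by unfold_locales auto

lemma smul_mult_right: "x * smul c y = smul c (x * y)"
  using smul_mult[of c y x] by (simp only: mult.commute)

lemma ideal_subspace:
  assumes "is_ideal UNIV J"
  shows "subspace J"
proof (rule subspaceI)
  fix c x assume "x \<in> J"
  then have "smul c 1 * x \<in> J" using assms by (auto simp: is_ideal_def)
  then show "smul c x \<in> J" by (simp add: smul_mult)
qed (use assms in \<open>auto simp: is_ideal_def\<close>)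

lemma ideal_mult: "is_ideal UNIV J \<Longrightarrow> x \<in> J \<Longrightarrow> r * x \<in> J" "is_ideal UNIV J \<Longrightarrow> x \<in> J \<Longrightarrow> x * r \<in> J"
  by (auto simp: is_ideal_def mult.commute)

definition functional :: "('a \<Rightarrow> 'k) \<Rightarrow> bool" where
  "functional f \<longleftrightarrow> (\<forall>x y. f (x + y) = f x + f y) \<and> (\<forall>c x. f (smul c x) = c * f x)"

lemma functional_add: "functional f \<Longrightarrow> f (x + y) = f x + f y"
  and functional_scale: "functional f \<Longrightarrow> f (smul c x) = c * f x"
  by (auto simp: functional_def)

lemma functional_0: "functional f \<Longrightarrow> f 0 = 0"
  using functional_scale[of f 0 0] by simp

lemma functional_diff: "functional f \<Longrightarrow> f (x - y) = f x - f y"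
  using functional_add[of f "x - y" y] by simp

lemma functional_sum:
  assumes "functional f"
  shows "f (sum g A) = (\<Sum>x\<in>A. f (g x))"
  by (induction A rule: infinite_finite_induct)
    (simp_all add: functional_0[OF assms] functional_add[OF assms])

lemma functional_mult: "functional f \<Longrightarrow> functional (\<lambda>y. f (x * y))"
  by (simp add: functional_def distrib_left smul_mult_right)

lemmas functional_simps = functional_add functional_scale functional_0 functional_diff functional_sum

lemma functional_extend:
  assumes "independent D"
  obtains f where "functional f" "\<And>x. x \<in> D \<Longrightarrow> f x = g x"
proof -
  interpret K: vector_space "(*) :: 'k \<Rightarrow> 'k \<Rightarrow> 'k"
    by unfold_locales (simp_all add: algebra_simps)
  interpret vector_space_pair smul "(*) :: 'k \<Rightarrow> 'k \<Rightarrow> 'k" ..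
  obtain f where f: "Vector_Spaces.linear smul (*) f" "\<forall>x\<in>D. f x = g x"
    using linear_independent_extend[OF assms, of g] by blast
  interpret f: Vector_Spaces.linear smul "(*) :: 'k \<Rightarrow> 'k \<Rightarrow> 'k" f by (rule f(1))
  have "functional f"
    by (simp add: functional_def f.add f.scale)
  with f(2) that show thesis by blast
qed

lemma chosen_basis_coordinates: obtains c where "y = (\<Sum>b\<in>chosen_basis. smul (c b) b)"
proof -
  have "y \<in> span chosen_basis" using chosen_basis by simp
  then obtain c where "y = (\<Sum>b\<in>chosen_basis. smul (c b) b)"
    unfolding span_finite[OF finite_Basis] by blast
  then show thesis by (rule that)
qed

lemma functional_eqI:
  assumes "functional f" "functional g" "\<And>b. b \<in> chosen_basis \<Longrightarrow> f b = g b"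
  shows "f y = g y"
proof -
  obtain c where "y = (\<Sum>b\<in>chosen_basis. smul (c b) b)" by (rule chosen_basis_coordinates)
  then show ?thesis by (simp add: functional_simps[OF assms(1)] functional_simps[OF assms(2)] assms(3))
qed

definition nondegenerate :: "('a \<Rightarrow> 'k) \<Rightarrow> bool" where
  "nondegenerate f \<longleftrightarrow> functional f \<and> (\<forall>x. (\<forall>y. f (x * y) = 0) \<longrightarrow> x = 0)"

text \<open>
  A nondegenerate form identifies the algebra with its dual: in coordinates, \<open>\<Phi>\<close> sends \<open>x\<close> to the
  functional \<open>y \<mapsto> \<epsilon> (x * y)\<close>, and injectivity implies surjectivity.
\<close>

lemma nondegenerate_represents:
  assumes \<epsilon>: "nondegenerate \<epsilon>" and f: "functional f"
  obtains x where "\<And>y. \<epsilon> (x * y) = f y"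
proof -
  have F: "functional \<epsilon>" using \<epsilon> by (simp add: nondegenerate_def)
  define \<Phi> where "\<Phi> x = (\<Sum>b\<in>chosen_basis. smul (\<epsilon> (x * b)) b)" for x
  have coeffs: "c b = c' b"
    if "(\<Sum>b\<in>chosen_basis. smul (c b) b) = (\<Sum>b\<in>chosen_basis. smul (c' b) b)" "b \<in> chosen_basis" for c c' b
  proof -
    have "(\<Sum>b\<in>chosen_basis. smul (c b - c' b) b) = 0"
      using that(1) by (simp add: scale_left_diff_distrib sum_subtractf)
    then have "c b - c' b = 0"
      using that(2) by (rule independentD[OF independent_Basis finite_Basis subset_refl])
    then show ?thesis by simp
  qed
  have "Vector_Spaces.linear smul smul \<Phi>"
    unfolding Vector_Spaces.linear_iff
    by (simp add: \<Phi>_def vector_space_axioms distrib_right functional_simps[OF F] smul_mult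
        scale_left_distrib sum.distrib scale_sum_right)
  moreover have "inj \<Phi>"
  proof (rule injI)
    fix x y assume "\<Phi> x = \<Phi> y"
    then have "\<epsilon> (x * b) = \<epsilon> (y * b)" if "b \<in> chosen_basis" for b
      using coeffs[of "\<lambda>b. \<epsilon> (x * b)" "\<lambda>b. \<epsilon> (y * b)"] that by (simp add: \<Phi>_def)
    then have "\<epsilon> (x * z) = \<epsilon> (y * z)" for z
      by (rule functional_eqI[OF functional_mult[OF F] functional_mult[OF F]])
    then have "\<epsilon> ((x - y) * z) = 0" for z
      by (simp add: left_diff_distrib functional_diff[OF F])
    then have "x - y = 0"
      using \<epsilon> unfolding nondegenerate_def by blast
    then show "x = y" by simp
  qed
  ultimately have "surj \<Phi>" by (rule linear_inj_imp_surj)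
  then obtain x where "(\<Sum>b\<in>chosen_basis. smul (f b) b) = \<Phi> x" by (rule surjE)
  then have "\<epsilon> (x * b) = f b" if "b \<in> chosen_basis" for b
    using coeffs[of f "\<lambda>b. \<epsilon> (x * b)"] that by (simp add: \<Phi>_def)
  then have "\<epsilon> (x * y) = f y" for y
    by (rule functional_eqI[OF functional_mult[OF F] f])
  then show thesis by (rule that)
qed

text \<open>
  An element outside \<open>U\<close> is separated from \<open>U\<close> by a functional, and the form represents this functional.
\<close>

lemma double_orthogonal:
  assumes \<epsilon>: "nondegenerate \<epsilon>" and U: "subspace U"
    and x: "\<And>y. (\<And>u. u \<in> U \<Longrightarrow> \<epsilon> (y * u) = 0) \<Longrightarrow> \<epsilon> (y * x) = 0"
  shows "x \<in> U"
proof (rule ccontr)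
  assume "x \<notin> U"
  obtain B where B: "B \<subseteq> U" "independent B" "span B = U"
    using basis_subspace_exists[OF U] by metis
  have "independent (insert x B)"
    using B \<open>x \<notin> U\<close> by (intro independent_insertI) auto
  then obtain f where f: "functional f" "\<And>b. b \<in> insert x B \<Longrightarrow> f b = (if b = x then 1 else 0)"
    using functional_extend[of "insert x B" "\<lambda>b. if b = x then 1 else 0"] by blast
  obtain y where y: "\<And>z. \<epsilon> (y * z) = f z"
    using nondegenerate_represents[OF \<epsilon> f(1)] by blast
  have "f u = 0" if "u \<in> U" for u
  proof -
    have "finite B" using B(2) by (rule finiteI_independent)
    have "u \<in> span B" using that B by simp
    then obtain c where "u = (\<Sum>b\<in>B. smul (c b) b)"
      by (auto simp: span_finite[OF \<open>finite B\<close>])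
    moreover have "f b = 0" if "b \<in> B" for b
      using f(2)[of b] that B \<open>x \<notin> U\<close> by auto
    ultimately show ?thesis by (simp add: functional_simps[OF f(1)])
  qed
  then have "\<epsilon> (y * x) = 0" by (intro x) (simp add: y)
  then show False using f(2)[of x] by (simp add: y)
qed

section \<open>Dimensions of quotients\<close>

lemma has_quot_dim_imp:
  assumes U: "subspace U" and W: "subspace W" and UW: "U \<subseteq> W" and k: "has_quot_dim smul W U k"
  shows "dim W = dim U + k"
proof -
  obtain B where B: "is_quot_basis smul W U B (\<lambda>b. b)" "card B = k"
    using k by (auto simp: has_quot_dim_def)
  have finB: "finite B" and BW: "B \<subseteq> W"
    and ex1: "\<And>w. w \<in> W \<Longrightarrow> \<exists>!c. quot_coords smul U B (\<lambda>b. b) w c"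
    using B(1) by (auto simp: is_quot_basis_def)
  obtain C where C: "finite C" "C \<subseteq> U" "independent C" "span C = U" "card C = dim U"
    using basis_subspace_exists[OF U] by metis
  have zero: "c b = 0" if "(\<Sum>b\<in>B. smul (c b) b) \<in> U" "b \<in> B" for c b
  proof -
    let ?c = "\<lambda>b. if b \<in> B then c b else 0"
    have "(\<Sum>b\<in>B. smul (?c b) b) = (\<Sum>b\<in>B. smul (c b) b)" by (intro sum.cong) auto
    then have "quot_coords smul U B (\<lambda>b. b) 0 ?c"
      using subspace_neg[OF U that(1)] by (simp add: quot_coords_def)
    moreover have "quot_coords smul U B (\<lambda>b. b) 0 (\<lambda>_. 0)"
      using subspace_0[OF U] by (simp add: quot_coords_def)
    ultimately have "?c = (\<lambda>_. 0)" using ex1[OF subspace_0[OF W]] by blast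
    then show ?thesis using that(2) by (simp add: fun_eq_iff) metis
  qed
  have disj: "B \<inter> C = {}"
  proof (rule ccontr)
    assume "B \<inter> C \<noteq> {}"
    then obtain b where b: "b \<in> B" "b \<in> C" by blast
    have "(\<Sum>b'\<in>B. smul (if b' = b then 1 else 0) b') = (\<Sum>b'\<in>B. if b' = b then b' else 0)"
      by (intro sum.cong) auto
    also have "\<dots> = b" using b finB by simp
    finally have "(\<Sum>b'\<in>B. smul (if b' = b then 1 else 0) b') \<in> U" using b C by auto
    from zero[OF this b(1)] show False by simp
  qed
  have "independent (B \<union> C)"
  proof
    assume "dependent (B \<union> C)"
    then obtain a v where a0: "(\<Sum>v\<in>B \<union> C. smul (a v) v) = 0" and v: "v \<in> B \<union> C" "a v \<noteq> 0"
      unfolding dependent_finite[OF finite_UnI[OF finB C(1)]] by blast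
    have split: "(\<Sum>v\<in>B. smul (a v) v) + (\<Sum>v\<in>C. smul (a v) v) = 0"
      using a0 by (simp add: sum.union_disjoint[OF finB C(1) disj])
    have CU: "(\<Sum>v\<in>C. smul (a v) v) \<in> U"
      using C by (intro subspace_sum[OF U] subspace_scale[OF U]) auto
    have "(\<Sum>v\<in>B. smul (a v) v) = - (\<Sum>v\<in>C. smul (a v) v)"
      using split by (simp add: eq_neg_iff_add_eq_0)
    then have aB: "a b = 0" if "b \<in> B" for b
      using zero[of a b] that subspace_neg[OF U CU] by simp
    then have "(\<Sum>v\<in>C. smul (a v) v) = 0" using split by simp
    then have "a b = 0" if "b \<in> C" for b
      using that by (rule independentD[OF C(3,1) subset_refl])
    with aB v show False by auto
  qed
  moreover have "W \<subseteq> span (B \<union> C)"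
  proof
    fix w assume "w \<in> W"
    then obtain c where "quot_coords smul U B (\<lambda>b. b) w c" using ex1 by blast
    then have "w - (\<Sum>b\<in>B. smul (c b) b) \<in> span C" using C by (simp add: quot_coords_def)
    then have "w - (\<Sum>b\<in>B. smul (c b) b) \<in> span (B \<union> C)"
      using span_mono[of C "B \<union> C"] by blast
    moreover have "(\<Sum>b\<in>B. smul (c b) b) \<in> span (B \<union> C)"
      by (intro span_sum span_scale span_base) auto
    ultimately show "w \<in> span (B \<union> C)" using span_add[of "w - (\<Sum>b\<in>B. smul (c b) b)"] by fastforce
  qed
  ultimately have "dim W = card (B \<union> C)"
    using BW C(2) UW by (intro dim_unique[of "B \<union> C"]) auto
  then show ?thesis
    using card_Un_disjoint[OF finB C(1) disj] B(2) C(5) by simp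
qed

lemma has_quot_dim_exists:
  assumes U: "subspace U" and W: "subspace W" and UW: "U \<subseteq> W"
  obtains k where "has_quot_dim smul W U k"
proof -
  obtain C where C: "finite C" "C \<subseteq> U" "independent C" "span C = U"
    using basis_subspace_exists[OF U] by metis
  obtain D where D: "C \<subseteq> D" "D \<subseteq> W" "independent D" "W \<subseteq> span D"
    using maximal_independent_subset_extend[of C W] C UW by blast
  have finD: "finite D" using D(3) by (rule finiteI_independent)
  let ?B = "D - C"
  have finB: "finite ?B" using finD by simp
  have "\<exists>!c. quot_coords smul U ?B (\<lambda>b. b) w c" if w: "w \<in> W" for w
  proof -
    have "w \<in> span D" using D(4) w by blast
    then obtain a where a: "w = (\<Sum>d\<in>D. smul (a d) d)" by (auto simp: span_finite[OF finD])
    have "w = (\<Sum>d\<in>?B. smul (a d) d) + (\<Sum>d\<in>C. smul (a d) d)"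
      unfolding a using sum.subset_diff[OF D(1) finD, of "\<lambda>d. smul (a d) d"] by simp
    moreover have "(\<Sum>d\<in>C. smul (a d) d) \<in> U"
      using C by (intro subspace_sum[OF U] subspace_scale[OF U]) auto
    moreover have "(\<Sum>b\<in>?B. smul (if b \<in> ?B then a b else 0) b) = (\<Sum>d\<in>?B. smul (a d) d)"
      by (intro sum.cong) auto
    ultimately have "quot_coords smul U ?B (\<lambda>b. b) w (\<lambda>b. if b \<in> ?B then a b else 0)"
      by (simp add: quot_coords_def)
    moreover have "c = c'" if c: "quot_coords smul U ?B (\<lambda>b. b) w c"
      and c': "quot_coords smul U ?B (\<lambda>b. b) w c'" for c c'
    proof -
      have "w - (\<Sum>b\<in>?B. smul (c' b) b) \<in> U" "w - (\<Sum>b\<in>?B. smul (c b) b) \<in> U"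
        using c c' by (simp_all add: quot_coords_def)
      then have "(w - (\<Sum>b\<in>?B. smul (c' b) b)) - (w - (\<Sum>b\<in>?B. smul (c b) b)) \<in> U"
        by (rule subspace_diff[OF U])
      then have "(\<Sum>b\<in>?B. smul (c b - c' b) b) \<in> span C"
        using C(4) by (simp add: scale_left_diff_distrib sum_subtractf)
      then obtain g where g: "(\<Sum>b\<in>?B. smul (c b - c' b) b) = (\<Sum>b\<in>C. smul (g b) b)"
        by (auto simp: span_finite[OF C(1)])
      let ?a = "\<lambda>d. if d \<in> C then - g d else c d - c' d"
      have "(\<Sum>d\<in>D. smul (?a d) d) = (\<Sum>d\<in>?B. smul (?a d) d) + (\<Sum>d\<in>C. smul (?a d) d)"
        by (rule sum.subset_diff[OF D(1) finD])
      also have "(\<Sum>d\<in>?B. smul (?a d) d) = (\<Sum>d\<in>?B. smul (c d - c' d) d)"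
        by (intro sum.cong) auto
      also have "(\<Sum>d\<in>C. smul (?a d) d) = - (\<Sum>d\<in>C. smul (g d) d)"
        by (simp add: sum_negf)
      finally have "(\<Sum>d\<in>D. smul (?a d) d) = 0" using g by simp
      then have "?a d = 0" if "d \<in> D" for d
        using that by (rule independentD[OF D(3) finD subset_refl])
      then have "c d = c' d" if "d \<in> ?B" for d
        using that by fastforce
      moreover have "c d = c' d" if "d \<notin> ?B" for d
        using c c' that by (simp add: quot_coords_def)
      ultimately show ?thesis by blast
    qed
    ultimately show ?thesis by blast
  qed
  then have "is_quot_basis smul W U ?B (\<lambda>b. b)"
    using finB D by (auto simp: is_quot_basis_def)
  then show thesis using that by (auto simp: has_quot_dim_def)
qed

lemma hilbert_function_dim:
  assumes "is_ideal UNIV (ideal_power M i)" "is_ideal UNIV (ideal_power M (Suc i))"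
    "ideal_power M (Suc i) \<subseteq> ideal_power M i"
  shows "dim (ideal_power M i) = dim (ideal_power M (Suc i)) + hilbert_function smul M i"
proof -
  note sub = ideal_subspace[OF assms(2)] ideal_subspace[OF assms(1)] assms(3)
  obtain k where k: "has_quot_dim smul (ideal_power M i) (ideal_power M (Suc i)) k"
    using has_quot_dim_exists[OF sub] by blast
  have "k' = k" if "has_quot_dim smul (ideal_power M i) (ideal_power M (Suc i)) k'" for k'
    using has_quot_dim_imp[OF sub that] has_quot_dim_imp[OF sub k] by linarith
  with k have "hilbert_function smul M i = k"
    unfolding hilbert_function_def by (rule the_equality)
  then show ?thesis using has_quot_dim_imp[OF sub k] by simp
qed

lemma dual_system_coefficient:
  fixes v d :: "nat \<Rightarrow> 'a"
  assumes F: "functional \<epsilon>"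
    and dual: "\<And>i j. i < k \<Longrightarrow> j < k \<Longrightarrow> \<epsilon> (v i * d j) = (if i = j then 1 else 0)"
    and j: "j < k"
  shows "\<epsilon> ((\<Sum>i<k. smul (c i) (v i)) * d j) = c j"
proof -
  have "\<epsilon> ((\<Sum>i<k. smul (c i) (v i)) * d j) = (\<Sum>i<k. c i * \<epsilon> (v i * d j))"
    by (simp only: sum_distrib_right smul_mult functional_sum[OF F] functional_scale[OF F])
  also have "\<dots> = (\<Sum>i<k. if i = j then c i else 0)"
    using j by (intro sum.cong) (auto simp: dual)
  finally show ?thesis using j by simp
qed

text \<open>
  A system \<open>d\<close> that is dual to \<open>v\<close>, kills \<open>U\<close> and detects membership in \<open>U\<close> makes \<open>v\<close> a basis of \<open>W/U\<close>: the
  coordinates of \<open>w\<close> can only be the numbers \<open>\<epsilon> (w * d j)\<close>.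
\<close>

lemma dim_via_dual_system:
  fixes v d :: "nat \<Rightarrow> 'a"
  assumes U: "subspace U" and W: "subspace W" and UW: "U \<subseteq> W" and F: "functional \<epsilon>"
    and v: "\<And>i. i < k \<Longrightarrow> v i \<in> W"
    and dual: "\<And>i j. i < k \<Longrightarrow> j < k \<Longrightarrow> \<epsilon> (v i * d j) = (if i = j then 1 else 0)"
    and Ud: "\<And>u j. u \<in> U \<Longrightarrow> j < k \<Longrightarrow> \<epsilon> (u * d j) = 0"
    and WU: "\<And>w. w \<in> W \<Longrightarrow> (\<And>j. j < k \<Longrightarrow> \<epsilon> (w * d j) = 0) \<Longrightarrow> w \<in> U"
  shows "dim W = dim U + k"
proof -
  have pair: "\<epsilon> ((\<Sum>i<k. smul (c i) (v i)) * d j) = c j" if "j < k" for c j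
    by (rule dual_system_coefficient[OF F dual that])
  have inj: "inj_on v {..<k}"
  proof (rule inj_onI)
    fix i j assume ij: "i \<in> {..<k}" "j \<in> {..<k}" "v i = v j"
    then show "i = j"
      using dual[of i j] dual[of j j] by (auto split: if_splits)
  qed
  have "\<exists>!c. quot_coords smul U {..<k} v w c" if w: "w \<in> W" for w
  proof (rule ex1I)
    let ?c = "\<lambda>j. if j < k then \<epsilon> (w * d j) else 0"
    have "w - (\<Sum>i<k. smul (?c i) (v i)) \<in> U"
    proof (rule WU)
      show "w - (\<Sum>i<k. smul (?c i) (v i)) \<in> W"
        using v w by (intro subspace_diff[OF W] subspace_sum[OF W] subspace_scale[OF W]) auto
      show "\<epsilon> ((w - (\<Sum>i<k. smul (?c i) (v i))) * d j) = 0" if "j < k" for j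
        using that pair[OF that, of ?c] by (simp add: left_diff_distrib functional_diff[OF F])
    qed
    then show "quot_coords smul U {..<k} v w ?c"
      by (simp add: quot_coords_def)
  next
    fix c assume c: "quot_coords smul U {..<k} v w c"
    show "c = (\<lambda>j. if j < k then \<epsilon> (w * d j) else 0)"
    proof
      fix j
      show "c j = (if j < k then \<epsilon> (w * d j) else 0)"
      proof (cases "j < k")
        case True
        have "\<epsilon> ((w - (\<Sum>i<k. smul (c i) (v i))) * d j) = 0"
          using c True by (intro Ud) (auto simp: quot_coords_def)
        then show ?thesis
          using True pair[OF True, of c] by (simp add: left_diff_distrib functional_diff[OF F])
      qed (use c in \<open>simp add: quot_coords_def\<close>)
    qed
  qed
  then have "is_quot_basis smul W U {..<k} v"
    using v by (auto simp: is_quot_basis_def)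
  then have "has_quot_dim smul W U k"
    using is_quot_basis_image[OF _ inj] card_image[OF inj] unfolding has_quot_dim_def by fastforce
  then show ?thesis by (rule has_quot_dim_imp[OF U W UW])
qed

section \<open>Local algebras\<close>

lemma ring_module: "Modules.module ((*) :: 'a \<Rightarrow> 'a \<Rightarrow> 'a)"
  by unfold_locales (simp_all add: algebra_simps)

lemma ideal_power_ideal:
  fixes M :: "'a set"
  assumes "is_ideal UNIV M"
  shows "is_ideal UNIV (ideal_power M k)"
proof (cases k)
  case (Suc j)
  note span = Modules.module.span_zero[OF ring_module] Modules.module.span_add[OF ring_module]
    Modules.module.span_scale[OF ring_module]
  show ?thesis
    unfolding Suc ideal_power.simps is_ideal_def using span by blast
qed (simp add: is_ideal_def)

lemma ideal_power_mult: "(x :: 'a) \<in> M \<Longrightarrow> y \<in> ideal_power M k \<Longrightarrow> x * y \<in> ideal_power M (Suc k)"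
  unfolding ideal_power.simps by (rule Modules.module.span_base[OF ring_module]) blast

lemma ideal_power_induct [consumes 2, case_names zero add mult]:
  fixes M :: "'a set"
  assumes M: "is_ideal UNIV M" and z: "z \<in> ideal_power M (Suc k)"
    and "P 0" "\<And>x y. P x \<Longrightarrow> P y \<Longrightarrow> P (x + y)"
    and "\<And>x y. x \<in> M \<Longrightarrow> y \<in> ideal_power M k \<Longrightarrow> P (x * y)"
  shows "P z"
proof (rule Modules.module.span_induct_alt[OF ring_module, of z "{x * y |x y. x \<in> M \<and> y \<in> ideal_power M k}"])
  show "z \<in> Modules.module.span (*) {x * y |x y. x \<in> M \<and> y \<in> ideal_power M k}"
    using z by (simp only: ideal_power.simps)
  fix c x y assume x: "x \<in> {x * y |x y. x \<in> M \<and> y \<in> ideal_power M k}" and y: "P y"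
  from x obtain a b where ab: "x = a * b" "a \<in> M" "b \<in> ideal_power M k" by blast
  have "P ((c * a) * b)"
    using ideal_mult(1)[OF M ab(2)] ab(3) by (rule assms(5))
  then show "P (c * x + y)"
    using assms(4)[OF _ y] by (simp add: ab mult.assoc)
qed (rule assms(3))

lemma ideal_power_Suc_subset: "is_ideal UNIV (M :: 'a set) \<Longrightarrow> ideal_power M (Suc k) \<subseteq> ideal_power M k"
proof
  fix z assume M: "is_ideal UNIV M" and z: "z \<in> ideal_power M (Suc k)"
  from M z show "z \<in> ideal_power M k"
  proof (induction rule: ideal_power_induct)
    case zero
    then show ?case using ideal_power_ideal[OF M] by (simp add: is_ideal_def)
  next
    case (add x y)
    then show ?case using ideal_power_ideal[OF M, of k] unfolding is_ideal_def by blast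
  next
    case (mult x y)
    then show ?case using ideal_mult(1)[OF ideal_power_ideal[OF M]] by blast
  qed
qed

lemma ideal_power_1: "is_ideal UNIV (M :: 'a set) \<Longrightarrow> ideal_power M (Suc 0) = M"
proof
  assume M: "is_ideal UNIV M"
  show "M \<subseteq> ideal_power M (Suc 0)"
    using ideal_power_mult[of _ M 1 0] by auto
  show "ideal_power M (Suc 0) \<subseteq> M"
  proof
    fix z assume "z \<in> ideal_power M (Suc 0)"
    with M show "z \<in> M"
    proof (induction rule: ideal_power_induct)
      case (mult x y)
      then show ?case using ideal_mult(2)[OF M] by blast
    qed (use M in \<open>auto simp: is_ideal_def\<close>)
  qed
qed

lemma ideal_power_add:
  fixes M :: "'a set"
  assumes M: "is_ideal UNIV M" and "x \<in> ideal_power M i" "y \<in> ideal_power M j"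
  shows "x * y \<in> ideal_power M (i + j)"
  using assms(2)
proof (induction i arbitrary: x)
  case 0
  show ?case using ideal_mult(1)[OF ideal_power_ideal[OF M] assms(3)] by simp
next
  case (Suc i)
  from M Suc.prems show ?case
  proof (induction rule: ideal_power_induct)
    case zero
    then show ?case using ideal_power_ideal[OF M, of "Suc i + j"] by (simp add: is_ideal_def)
  next
    case (add x1 x2)
    then show ?case
      using ideal_power_ideal[OF M, of "Suc i + j"] unfolding is_ideal_def distrib_right by blast
  next
    case (mult a b)
    then show ?case
      using ideal_power_mult[OF mult(1) Suc.IH[OF mult(2)]] by (simp add: mult.assoc)
  qed
qed

text \<open>
  A proper ideal of largest dimension above \<open>J\<close> is maximal.
\<close>

lemma proper_ideal_subset_maximal:
  fixes M :: "'a set"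
  assumes loc: "local_with M" and J: "is_ideal UNIV J" and 1: "1 \<notin> J"
  shows "J \<subseteq> M"
proof -
  define Q where "Q K \<longleftrightarrow> is_ideal UNIV K \<and> J \<subseteq> K \<and> 1 \<notin> K" for K
  have "Q J" using J 1 by (simp add: Q_def)
  moreover have "\<forall>K. Q K \<longrightarrow> dim K < Suc dimension"
    using dim_subset_UNIV by (simp add: less_Suc_eq_le)
  ultimately obtain K where K: "Q K" "\<And>K'. Q K' \<Longrightarrow> dim K' \<le> dim K"
    using ex_has_greatest_nat[of Q J dim "Suc dimension"] by blast
  have "is_maximal_ideal K"
    unfolding is_maximal_ideal_def
  proof (intro conjI allI impI)
    show "is_ideal UNIV K" using K(1) by (simp add: Q_def)
    show "K \<noteq> UNIV" using K(1) by (auto simp: Q_def)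
    fix L assume L: "is_ideal UNIV L \<and> K \<subseteq> L"
    show "L = K \<or> L = UNIV"
    proof (cases "1 \<in> L")
      case True
      then have "r \<in> L" for r using ideal_mult(1)[of L 1 r] L by simp
      then show ?thesis by blast
    next
      case False
      then have "Q L" using L K(1) by (auto simp: Q_def)
      then have "K = L"
        using L K by (intro subspace_dim_equal ideal_subspace) (auto simp: Q_def)
      then show ?thesis by simp
    qed
  qed
  then have "K = M" using loc by (simp add: local_with_def)
  then show ?thesis using K(1) by (simp add: Q_def)
qed

lemma local_maximal:
  fixes M :: "'a set"
  assumes "local_with M"
  shows "is_ideal UNIV M" "1 \<notin> M"
proof -
  show M: "is_ideal UNIV M" using assms by (simp add: local_with_def is_maximal_ideal_def)
  show "1 \<notin> M"
  proof
    assume "1 \<in> M"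
    then have "r \<in> M" for r using ideal_mult(1)[OF M, of 1 r] by simp
    then show False using assms by (auto simp: local_with_def is_maximal_ideal_def)
  qed
qed

lemma local_unit:
  fixes M :: "'a set"
  assumes loc: "local_with M" and x: "x \<notin> M"
  obtains y where "y * x = 1"
proof -
  have "is_ideal UNIV (range (\<lambda>r. r * x))"
    unfolding is_ideal_def
  proof (intro conjI ballI)
    show "0 \<in> range (\<lambda>r. r * x)" by (rule range_eqI[of _ _ 0]) simp
    fix a b assume "a \<in> range (\<lambda>r. r * x)" "b \<in> range (\<lambda>r. r * x)"
    then obtain r s where "a = r * x" "b = s * x" by blast
    then show "a + b \<in> range (\<lambda>r. r * x)" by (intro range_eqI[of _ _ "r + s"]) (simp add: distrib_right)
  next
    fix r a assume "a \<in> range (\<lambda>r. r * x)"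
    then obtain s where "a = s * x" by blast
    then show "r * a \<in> range (\<lambda>r. r * x)" by (intro range_eqI[of _ _ "r * s"]) (simp add: mult.assoc)
  qed simp
  moreover have "x \<in> range (\<lambda>r. r * x)" by (rule range_eqI[of _ _ 1]) simp
  ultimately have "1 \<in> range (\<lambda>r. r * x)"
    using proper_ideal_subset_maximal[OF loc] x by blast
  then obtain y where "1 = y * x" by blast
  then show thesis using that by metis
qed

text \<open>
  Nakayama's lemma: \<open>M\<close> annihilates \<open>J/J'\<close> for every maximal proper subideal \<open>J'\<close> of \<open>J\<close>. Otherwise
  \<open>J = J' + A * m * j\<close> for some \<open>j\<close> in \<open>J\<close> and \<open>m\<close> in \<open>M\<close>, so \<open>(1 - r * m) * j\<close> is in \<open>J'\<close> for some \<open>r\<close>,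
  although \<open>1 - r * m\<close> is a unit.
\<close>

lemma nakayama_subideal:
  fixes M :: "'a set"
  assumes loc: "local_with M" and J: "is_ideal UNIV J" "J \<noteq> {0}"
  obtains J' where "is_ideal UNIV J'" "J' \<subset> J" "\<And>m j. m \<in> M \<Longrightarrow> j \<in> J \<Longrightarrow> m * j \<in> J'"
proof -
  note M = local_maximal[OF loc]
  define Q where "Q K \<longleftrightarrow> is_ideal UNIV K \<and> K \<subset> J" for K
  have "Q {0}" using J by (auto simp: Q_def is_ideal_def)
  moreover have "\<forall>K. Q K \<longrightarrow> dim K < Suc dimension"
    using dim_subset_UNIV by (simp add: less_Suc_eq_le)
  ultimately obtain K where K: "Q K" "\<And>K'. Q K' \<Longrightarrow> dim K' \<le> dim K"
    using ex_has_greatest_nat[of Q "{0}" dim "Suc dimension"] by blast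
  have KI: "is_ideal UNIV K" and KJ: "K \<subset> J" using K(1) by (auto simp: Q_def)
  have "m * j \<in> K" if m: "m \<in> M" and j: "j \<in> J" for m j
  proof (rule ccontr)
    assume mj: "m * j \<notin> K"
    define L where "L = {a + r * (m * j) | a r. a \<in> K}"
    have LI: "is_ideal UNIV L"
      unfolding is_ideal_def
    proof (intro conjI ballI)
      show "0 \<in> L" unfolding L_def using KI by (auto simp: is_ideal_def intro!: exI[of _ 0])
      fix x y assume "x \<in> L" "y \<in> L"
      then obtain a r b s where "x = a + r * (m * j)" "y = b + s * (m * j)" "a \<in> K" "b \<in> K"
        unfolding L_def by blast
      moreover have "a + b \<in> K" using KI calculation unfolding is_ideal_def by blast
      ultimately show "x + y \<in> L"
        unfolding L_def by (intro CollectI exI[of _ "a + b"] exI[of _ "r + s"]) (simp add: distrib_right add_ac)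
    next
      fix c x assume "x \<in> L"
      then obtain a r where "x = a + r * (m * j)" "a \<in> K" unfolding L_def by blast
      then show "c * x \<in> L"
        unfolding L_def using ideal_mult(1)[OF KI, of a c]
        by (intro CollectI exI[of _ "c * a"] exI[of _ "c * r"]) (simp add: distrib_left mult.assoc)
    qed simp
    have KL: "K \<subseteq> L"
    proof
      fix x assume "x \<in> K"
      then show "x \<in> L" unfolding L_def by (intro CollectI exI[of _ x] exI[of _ 0]) simp
    qed
    have mjL: "m * j \<in> L"
      unfolding L_def using KI by (intro CollectI exI[of _ 0] exI[of _ 1]) (simp add: is_ideal_def)
    have LJ: "L \<subseteq> J"
    proof
      fix x assume "x \<in> L"
      then obtain a r where x: "x = a + r * (m * j)" "a \<in> K" unfolding L_def by blast
      have "r * (m * j) \<in> J" using J(1) j by (intro ideal_mult)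
      then show "x \<in> J" using x KJ J(1) unfolding is_ideal_def by blast
    qed
    have "L = J"
    proof (rule ccontr)
      assume "L \<noteq> J"
      then have "Q L" using LI LJ by (auto simp: Q_def)
      then have "K = L" using K KL LI KI by (intro subspace_dim_equal ideal_subspace) auto
      then show False using mj mjL by simp
    qed
    then obtain a r where ar: "j = a + r * (m * j)" "a \<in> K" using j unfolding L_def by blast
    have "1 - r * m \<notin> M"
    proof
      assume "1 - r * m \<in> M"
      then have "(1 - r * m) + r * m \<in> M" using ideal_mult(1)[OF M(1) m] M(1) unfolding is_ideal_def by blast
      then show False using M(2) by simp
    qed
    then obtain y where y: "y * (1 - r * m) = 1" using local_unit[OF loc] by blast
    have "(1 - r * m) * j = a" using ar(1) by (simp add: left_diff_distrib mult.assoc diff_eq_eq)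
    then have "j = y * a" using y by (metis mult.assoc mult_1)
    then have "j \<in> K" using ideal_mult(1)[OF KI ar(2)] by simp
    then show False using mj ideal_mult(1)[OF KI] by blast
  qed
  then show thesis using that[OF KI KJ] by blast
qed

lemma ideal_power_stationary_zero:
  fixes M :: "'a set"
  assumes loc: "local_with M" and eq: "ideal_power M (Suc k) = ideal_power M k"
  shows "ideal_power M k = {0}"
proof (rule ccontr)
  note M = local_maximal[OF loc]
  assume "ideal_power M k \<noteq> {0}"
  then obtain J' where J': "is_ideal UNIV J'" "J' \<subset> ideal_power M k"
    "\<And>m j. m \<in> M \<Longrightarrow> j \<in> ideal_power M k \<Longrightarrow> m * j \<in> J'"
    using nakayama_subideal[OF loc ideal_power_ideal[OF M(1)]] by metis
  have "z \<in> J'" if "z \<in> ideal_power M (Suc k)" for z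
    using M(1) that
  proof (induction rule: ideal_power_induct)
    case (mult x y)
    then show ?case by (rule J'(3))
  qed (use J'(1) in \<open>auto simp: is_ideal_def\<close>)
  then show False using eq J'(2) by blast
qed

text \<open>
  In an orthonormal family of largest size, the form vanishes on every \<open>z\<close> in \<open>C\<close> orthogonal to the
  family, because \<open>z\<close> could otherwise be rescaled and added. By polarization, two elements orthogonal to
  the family are then orthogonal to each other.
\<close>

lemma orthonormal_family_exists:
  assumes F: "functional \<epsilon>" and C: "subspace C"
    and sqrt: "\<And>c :: 'k. \<exists>t. t ^ 2 = c" and two: "(2 :: 'k) \<noteq> 0"
  obtains r :: nat and w where "\<And>i. i < r \<Longrightarrow> w i \<in> C"
    "\<And>i j. i < r \<Longrightarrow> j < r \<Longrightarrow> \<epsilon> (w i * w j) = (if i = j then 1 else 0)"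
    "\<And>x y. x \<in> C \<Longrightarrow> y \<in> C \<Longrightarrow> (\<And>i. i < r \<Longrightarrow> \<epsilon> (x * w i) = 0) \<Longrightarrow> \<epsilon> (x * y) = 0"
proof -
  define Q where "Q r \<longleftrightarrow> (\<exists>w. (\<forall>i<r. w i \<in> C) \<and>
    (\<forall>i<r. \<forall>j<r. \<epsilon> (w i * w j) = (if i = j then 1 else 0)))" for r :: nat
  have bound: "r \<le> dimension" if Qr: "Q r" for r
  proof -
    obtain w where w: "\<And>i. i < r \<Longrightarrow> w i \<in> C"
      "\<And>i j. i < r \<Longrightarrow> j < r \<Longrightarrow> \<epsilon> (w i * w j) = (if i = j then 1 else 0)"
      using Qr unfolding Q_def by blast
    define U where "U = {x. \<forall>i<r. \<epsilon> (x * w i) = 0}"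
    have "dim (UNIV :: 'a set) = dim U + r"
    proof (rule dim_via_dual_system[OF _ _ _ F, where v = w and d = w])
      show "subspace U"
        unfolding U_def by (intro subspaceI) (auto simp: distrib_right smul_mult functional_simps[OF F])
    qed (auto simp: w U_def)
    then show ?thesis by (simp add: dimension_def dim_UNIV)
  qed
  have "Q 0" by (simp add: Q_def)
  then obtain r where r: "Q r" "\<And>r'. Q r' \<Longrightarrow> r' \<le> r"
    using ex_has_greatest_nat[of Q 0 "\<lambda>r. r" "Suc dimension"] bound by (auto simp: less_Suc_eq_le)
  obtain w where w: "\<And>i. i < r \<Longrightarrow> w i \<in> C"
    "\<And>i j. i < r \<Longrightarrow> j < r \<Longrightarrow> \<epsilon> (w i * w j) = (if i = j then 1 else 0)"
    using r(1) unfolding Q_def by blast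
  have isotropic: "\<epsilon> (z * z) = 0" if z: "z \<in> C" "\<And>i. i < r \<Longrightarrow> \<epsilon> (z * w i) = 0" for z
  proof (rule ccontr)
    assume nz: "\<epsilon> (z * z) \<noteq> 0"
    obtain t where t: "t ^ 2 = 1 / \<epsilon> (z * z)" using sqrt by blast
    define w' where "w' i = (if i = r then smul t z else w i)" for i
    have "\<epsilon> (smul t z * smul t z) = t ^ 2 * \<epsilon> (z * z)"
      by (simp add: smul_mult smul_mult_right functional_simps[OF F] power2_eq_square)
    then have zz: "\<epsilon> (smul t z * smul t z) = 1" using t nz by simp
    have "Q (Suc r)"
      unfolding Q_def
    proof (intro exI[of _ w'] conjI allI impI)
      show "w' i \<in> C" if "i < Suc r" for i
        using that w(1) subspace_scale[OF C z(1)] by (auto simp: w'_def less_Suc_eq)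
      show "\<epsilon> (w' i * w' j) = (if i = j then 1 else 0)" if "i < Suc r" "j < Suc r" for i j
      proof -
        have "\<epsilon> (smul t z * w k) = 0" "\<epsilon> (w k * smul t z) = 0" if "k < r" for k
          using z(2)[OF that] by (simp_all add: smul_mult smul_mult_right functional_simps[OF F] mult.commute)
        then show ?thesis using that w(2) zz by (auto simp: w'_def less_Suc_eq)
      qed
    qed
    then show False using r(2)[of "Suc r"] by simp
  qed
  show thesis
  proof (rule that[of r w])
    fix x y assume x: "x \<in> C" "\<And>i. i < r \<Longrightarrow> \<epsilon> (x * w i) = 0" and y: "y \<in> C"
    \<comment> \<open>Projecting \<open>y\<close> to the orthogonal complement of the family does not change \<open>\<epsilon> (x * y)\<close>.\<close>
    define y' where "y' = y - (\<Sum>i<r. smul (\<epsilon> (y * w i)) (w i))"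
    have y'C: "y' \<in> C"
      unfolding y'_def using y w by (intro subspace_diff[OF C] subspace_sum[OF C] subspace_scale[OF C]) auto
    have y'w: "\<epsilon> (y' * w j) = 0" if "j < r" for j
      using dual_system_coefficient[OF F w(2) that, of "\<lambda>i. \<epsilon> (y * w i)"]
      by (simp add: y'_def left_diff_distrib functional_diff[OF F])
    have "\<epsilon> ((x + y') * (x + y')) = 0"
      using x y'C y'w by (intro isotropic subspace_add[OF C]) (auto simp: distrib_right functional_simps[OF F])
    moreover have "\<epsilon> ((x + y') * (x + y'))
        = \<epsilon> (x * x) + \<epsilon> (x * y') + (\<epsilon> (x * y') + \<epsilon> (y' * y'))"
      by (simp only: distrib_right distrib_left functional_add[OF F] mult.commute[of y' x])
    moreover have "\<epsilon> (x * x) = 0" using x by (rule isotropic)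
    moreover have "\<epsilon> (y' * y') = 0" using y'C y'w by (rule isotropic)
    ultimately have "2 * \<epsilon> (x * y') = 0" by simp
    then have "\<epsilon> (x * y') = 0" using two by simp
    moreover have "\<epsilon> (x * y') = \<epsilon> (x * y)"
      using x(2) by (simp add: y'_def right_diff_distrib functional_simps[OF F] sum_distrib_left smul_mult_right)
    ultimately show "\<epsilon> (x * y) = 0" by simp
  qed (use w in auto)
qed

end

section \<open>Normal form of a Gorenstein algebra with Hilbert function (1, h, n, 1)\<close>

context artinian_algebra
begin

text \<open>
  Let \<open>C\<close> be the annihilator of \<open>M\<^sup>2\<close>, which is also the orthogonal complement of \<open>M\<^sup>2\<close>. A maximal
  orthonormal family \<open>w\<close> in \<open>C\<close> is a basis of \<open>C/M\<^sup>2\<close>: these are the \<open>h - n\<close> variables that occur as squares.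
  A basis of \<open>M/C\<close> can be lifted to a family \<open>v\<close> orthogonal to \<open>w\<close>. The form pairs \<open>M/C\<close> perfectly with
  \<open>M\<^sup>2/M\<^sup>3\<close>, so there is a dual family \<open>y\<close> in \<open>M\<^sup>2\<close> and \<open>v\<close> has \<open>n\<close> elements. Adding to each \<open>v i\<close> an element
  of \<open>M\<^sup>2\<close> makes all \<open>\<epsilon> (v i * v j)\<close> zero without changing products of three elements, since \<open>M\<^sup>4 = 0\<close>;
  adding multiples of the socle generator \<open>s\<close> makes \<open>\<epsilon>\<close> vanish on the variables.
\<close>

lemma gorenstein_normal_form:
  fixes M :: "'a set"
  assumes loc: "local_with M" and gor: "gorenstein smul M"
    and hf: "hilbert_function smul M 0 = 1" "hilbert_function smul M 1 = h"
      "hilbert_function smul M 2 = n" "hilbert_function smul M 3 = 1" "hilbert_function smul M 4 = 0"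
    and sqrt: "\<And>c :: 'k. \<exists>t. t ^ 2 = c" and two: "(2 :: 'k) \<noteq> 0"
  obtains \<epsilon> a where "nondegenerate \<epsilon>" "n \<le> h" "dim (UNIV :: 'a set) = n + h + 2"
    "dim (UNIV :: 'a set) = dim M + 1" "ideal_power M 4 = {0}" "\<epsilon> 1 = 0"
    "\<And>i. i < h \<Longrightarrow> a i \<in> M" "\<And>i. i < h \<Longrightarrow> \<epsilon> (a i) = 0"
    "\<And>i j. i < h \<Longrightarrow> j < h \<Longrightarrow> \<epsilon> (a i * a j) = (if i = j \<and> n \<le> i then 1 else 0)"
    "\<And>i y. n \<le> i \<Longrightarrow> i < h \<Longrightarrow> y \<in> ideal_power M 2 \<Longrightarrow> a i * y = 0"
    "\<And>x. x \<in> M \<Longrightarrow> \<exists>c. x - (\<Sum>i<h. smul (c i) (a i)) \<in> ideal_power M 2"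
proof -
  note M = local_maximal[OF loc]
  note idl = ideal_power_ideal[OF M(1)]
  note sub = ideal_subspace[OF idl]
  have dimI: "dim (ideal_power M k) = dim (ideal_power M (Suc k)) + hilbert_function smul M k" for k
    by (rule hilbert_function_dim[OF idl idl ideal_power_Suc_subset[OF M(1)]])
  have I1: "ideal_power M 1 = M"
    using ideal_power_1[OF M(1)] by simp
  have "ideal_power M (Suc 4) = ideal_power M 4"
    using dimI[of 4] hf(5) by (intro subspace_dim_equal sub ideal_power_Suc_subset[OF M(1)]) simp
  then have I4: "ideal_power M 4 = {0}"
    by (rule ideal_power_stationary_zero[OF loc])
  define M2 where "M2 = ideal_power M 2"
  define M3 where "M3 = ideal_power M 3"
  have dims: "dim (UNIV :: 'a set) = dim M + 1" "dim M = dim M2 + h" "dim M2 = dim M3 + n" "dim M3 = 1"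
    using dimI[of 0] dimI[of 1] dimI[of 2] dimI[of 3] hf I1 I4
    by (simp_all add: M2_def M3_def eval_nat_numeral)
  have M2s: "is_ideal UNIV M2" "subspace M2" and M3s: "subspace M3" and Ms: "subspace M"
    using idl sub ideal_subspace[OF M(1)] by (simp_all add: M2_def M3_def)
  have M2M: "M2 \<subseteq> M" and M32: "M3 \<subseteq> M2"
    using ideal_power_Suc_subset[OF M(1), of 1] ideal_power_Suc_subset[OF M(1), of 2] I1
    by (simp_all add: M2_def M3_def eval_nat_numeral)
  have M22: "x * y = 0" if "x \<in> M2" "y \<in> M2" for x y
    using ideal_power_add[OF M(1), of x 2 y 2] that I4 by (simp add: M2_def)
  have M13: "x * y = 0" if "x \<in> M" "y \<in> M3" for x y
    using ideal_power_add[OF M(1), of x 1 y 3] that I4 I1 by (simp add: M3_def)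
  have M31: "x * y = 0" if "x \<in> M3" "y \<in> M" for x y
    using M13[OF that(2,1)] by (simp only: mult.commute)

  have soc_sub: "subspace (socle M)"
    by (intro subspaceI) (auto simp: socle_def distrib_right smul_mult)
  have M3soc: "M3 = socle M"
    using gor dims M3s M31 soc_sub
    by (intro subspace_dim_equal) (auto simp: gorenstein_def socle_def)
  obtain s where s: "s \<in> M3" "s \<noteq> 0"
  proof -
    have "M3 \<noteq> {0}" using dims(4) by auto
    then show thesis using that subspace_0[OF M3s] by blast
  qed
  have sM: "s * x = 0" if "x \<in> M" for x using M31[OF s(1) that] .
  have Mss: "x * s = 0" if "x \<in> M" for x using M13[OF that s(1)] .
  have s_in: "s \<in> M2" "s \<in> M" using s(1) M32 M2M by blast+
  have M3span: "\<exists>c. x = smul c s" if "x \<in> M3" for x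
  proof -
    have "span {s} \<subseteq> M3" using s(1) M3s by (intro span_minimal) auto
    moreover have "dim (span {s}) = 1"
      using s(2) dim_span_eq_card_independent[of "{s}"] by simp
    ultimately have "span {s} = M3"
      using dims(4) M3s by (intro subspace_dim_equal subspace_span) auto
    then show ?thesis using that by (auto simp: span_singleton)
  qed
  have "span {s} \<subseteq> M" using s_in Ms by (intro span_minimal) auto
  then have "1 \<notin> span {s}" using M(2) by blast
  then have "independent (insert 1 {s})"
    by (rule independent_insertI) (use s(2) in simp)
  then obtain \<epsilon> where F: "functional \<epsilon>" and "\<And>x. x \<in> {1, s} \<Longrightarrow> \<epsilon> x = (if x = s then 1 else 0)"
    using functional_extend[of "{1, s}" "\<lambda>x. if x = s then 1 else 0"] by blast
  moreover have "1 \<noteq> s" using s_in M(2) by auto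
  ultimately have \<epsilon>1: "\<epsilon> 1 = 0" and \<epsilon>s: "\<epsilon> s = 1" by auto
  note Fs = functional_simps[OF F]

  have step: "\<forall>x\<in>ideal_power M k. x \<noteq> 0 \<longrightarrow> (\<exists>y. x * y \<in> socle M \<and> x * y \<noteq> 0)"
    if IH: "\<forall>x\<in>ideal_power M (Suc k). x \<noteq> 0 \<longrightarrow> (\<exists>y. x * y \<in> socle M \<and> x * y \<noteq> 0)" for k
  proof (intro ballI impI)
    fix x assume x: "x \<in> ideal_power M k" "x \<noteq> 0"
    show "\<exists>y. x * y \<in> socle M \<and> x * y \<noteq> 0"
    proof (cases "x \<in> socle M")
      case True
      with x(2) show ?thesis by (intro exI[of _ 1]) simp
    next
      case False
      then obtain m where m: "m \<in> M" "x * m \<noteq> 0" by (auto simp: socle_def)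
      have "x * m \<in> ideal_power M (Suc k)"
        using ideal_power_mult[OF m(1) x(1)] by (simp only: mult.commute)
      then obtain y where "(x * m) * y \<in> socle M" "(x * m) * y \<noteq> 0"
        using IH m(2) by blast
      then show ?thesis by (intro exI[of _ "m * y"]) (simp only: mult.assoc, simp)
    qed
  qed
  \<comment> \<open>Multiplying repeatedly by elements of \<open>M\<close> reaches the socle before the fourth power of \<open>M\<close>.\<close>
  have to_socle: "\<exists>y. x * y \<in> socle M \<and> x * y \<noteq> 0" if "x \<noteq> 0" for x
  proof -
    have four: "4 = Suc (Suc (Suc (Suc 0)))" by simp
    have "\<forall>x\<in>ideal_power M (Suc (Suc (Suc (Suc 0)))). x \<noteq> 0 \<longrightarrow> (\<exists>y. x * y \<in> socle M \<and> x * y \<noteq> 0)"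
      using I4 unfolding four by blast
    then have "\<forall>x\<in>ideal_power M 0. x \<noteq> 0 \<longrightarrow> (\<exists>y. x * y \<in> socle M \<and> x * y \<noteq> 0)"
      by (rule step[OF step[OF step[OF step]]])
    then show ?thesis using that by simp
  qed
  have nd: "nondegenerate \<epsilon>"
    unfolding nondegenerate_def
  proof (intro conjI allI impI F)
    fix x assume zero: "\<forall>y. \<epsilon> (x * y) = 0"
    show "x = 0"
    proof (rule ccontr)
      assume "x \<noteq> 0"
      then obtain y where y: "x * y \<in> socle M" "x * y \<noteq> 0" using to_socle by blast
      then obtain c where c: "x * y = smul c s" using M3span M3soc by blast
      have "\<epsilon> (x * y) = c" unfolding c by (simp add: Fs \<epsilon>s)
      moreover have "\<epsilon> (x * y) = 0" using zero by blast
      ultimately have "x * y = 0" using c by simp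
      with y(2) show False ..
    qed
  qed
  have nondeg: "x = 0" if "\<And>y. \<epsilon> (x * y) = 0" for x
    using nd that unfolding nondegenerate_def by blast

  define C where "C = {x. \<forall>y\<in>M2. x * y = 0}"
  have CM2: "x * y = 0" "y * x = 0" if "x \<in> C" "y \<in> M2" for x y
    using that by (auto simp: C_def mult.commute)
  have Cid: "is_ideal UNIV C"
    unfolding is_ideal_def C_def by (auto simp: distrib_right mult.assoc)
  have Cs: "subspace C" by (rule ideal_subspace[OF Cid])
  have "1 \<notin> C" using s_in(1) s(2) CM2(1)[of 1 s] by auto
  then have CM: "C \<subseteq> M" by (rule proper_ideal_subset_maximal[OF loc Cid])
  have Cperp: "x \<in> M2" if x: "\<And>y. y \<in> C \<Longrightarrow> \<epsilon> (x * y) = 0" for x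
  proof (rule double_orthogonal[OF nd M2s(2)])
    fix y assume y: "\<And>u. u \<in> M2 \<Longrightarrow> \<epsilon> (y * u) = 0"
    have "y \<in> C"
      unfolding C_def
    proof (intro CollectI ballI)
      fix u assume u: "u \<in> M2"
      show "y * u = 0"
      proof (rule nondeg)
        fix z
        have "u * z \<in> M2" using ideal_mult(2)[OF M2s(1) u] .
        then show "\<epsilon> (y * u * z) = 0" using y by (simp only: mult.assoc)
      qed
    qed
    then have "\<epsilon> (x * y) = 0" by (rule x)
    then show "\<epsilon> (y * x) = 0" by (simp only: mult.commute)
  qed

  obtain r :: nat and w where wC: "\<And>i. i < r \<Longrightarrow> w i \<in> C"
    and ww: "\<And>i j. i < r \<Longrightarrow> j < r \<Longrightarrow> \<epsilon> (w i * w j) = (if i = j then 1 else 0)"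
    and wmax: "\<And>x y. x \<in> C \<Longrightarrow> y \<in> C \<Longrightarrow> (\<And>i. i < r \<Longrightarrow> \<epsilon> (x * w i) = 0) \<Longrightarrow> \<epsilon> (x * y) = 0"
    using orthonormal_family_exists[OF F Cs sqrt two] by blast

  obtain BC where BC: "finite BC" "BC \<subseteq> C" "independent BC" "span BC = C"
    using basis_subspace_exists[OF Cs] by metis
  obtain E where E: "BC \<subseteq> E" "E \<subseteq> M" "independent E" "M \<subseteq> span E"
    using maximal_independent_subset_extend[of BC M] BC CM by blast
  have finE: "finite E" using E(3) by (rule finiteI_independent)
  define p where "p = card (E - BC)"
  obtain v0 where v0: "bij_betw v0 {..<p} (E - BC)"
    using ex_bij_betw_nat_finite[of "E - BC"] finE by (auto simp: p_def atLeast0LessThan)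
  have v0E: "v0 i \<in> E - BC" if "i < p" for i
    using that v0 by (auto simp: bij_betw_def)
  have v0inj: "v0 i = v0 j \<longleftrightarrow> i = j" if "i < p" "j < p" for i j
    using that v0 by (auto simp: bij_betw_def inj_on_def)
  define v where "v i = v0 i - (\<Sum>k<r. smul (\<epsilon> (v0 i * w k)) (w k))" for i
  have projC: "(\<Sum>k<r. smul (c k) (w k)) \<in> C" for c
    using wC by (intro subspace_sum[OF Cs] subspace_scale[OF Cs]) auto
  have vM: "v i \<in> M" if "i < p" for i
    unfolding v_def using v0E[OF that] E(2) projC CM by (intro subspace_diff[OF Ms]) auto
  have vw: "\<epsilon> (v i * w j) = 0" if "j < r" for i j
    using dual_system_coefficient[OF F ww that, of "\<lambda>k. \<epsilon> (v0 i * w k)"]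
    by (simp add: v_def left_diff_distrib functional_diff[OF F])
  have expand: "\<exists>c. x - (\<Sum>i<p. smul (c i) (v i)) \<in> C" if "x \<in> M" for x
  proof -
    have "x \<in> span E" using E(4) that by blast
    then obtain a where "x = (\<Sum>e\<in>E. smul (a e) e)" by (auto simp: span_finite[OF finE])
    then have x: "x = (\<Sum>e\<in>E - BC. smul (a e) e) + (\<Sum>e\<in>BC. smul (a e) e)"
      using sum.subset_diff[OF E(1) finE, of "\<lambda>e. smul (a e) e"] by simp
    have "(\<Sum>e\<in>E - BC. smul (a e) e) = (\<Sum>i<p. smul (a (v0 i)) (v0 i))"
      using sum.reindex_bij_betw[OF v0, of "\<lambda>e. smul (a e) e"] by simp
    also have "\<dots> = (\<Sum>i<p. smul (a (v0 i)) (v i))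
        + (\<Sum>i<p. smul (a (v0 i)) (\<Sum>k<r. smul (\<epsilon> (v0 i * w k)) (w k)))"
      by (simp add: v_def sum.distrib[symmetric] scale_right_distrib[symmetric])
    finally have "x - (\<Sum>i<p. smul (a (v0 i)) (v i))
      = (\<Sum>i<p. smul (a (v0 i)) (\<Sum>k<r. smul (\<epsilon> (v0 i * w k)) (w k))) + (\<Sum>e\<in>BC. smul (a e) e)"
      unfolding x by simp
    also have "\<dots> \<in> C"
      using BC by (intro subspace_add[OF Cs] subspace_sum[OF Cs] subspace_scale[OF Cs] projC) auto
    finally show ?thesis by (rule exI[of _ "\<lambda>i. a (v0 i)"])
  qed
  have "\<exists>y. \<forall>x. (x \<in> C \<longrightarrow> \<epsilon> (y * x) = 0) \<and> (\<forall>i<p. \<epsilon> (y * v i) = (if i = j then 1 else 0))"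
    if j: "j < p" for j
  proof -
    obtain f where f: "functional f" "\<And>e. e \<in> E \<Longrightarrow> f e = (if e = v0 j then 1 else 0)"
      using functional_extend[OF E(3), of "\<lambda>e. if e = v0 j then 1 else 0"] by blast
    note fs = functional_simps[OF f(1)]
    have fC: "f x = 0" if xC: "x \<in> C" for x
    proof -
      obtain c where c: "x = (\<Sum>b\<in>BC. smul (c b) b)"
        using xC unfolding BC(4)[symmetric] span_finite[OF BC(1)] by blast
      have "f b = 0" if "b \<in> BC" for b
        using f(2)[of b] that E(1) v0E[OF j] by auto
      then show ?thesis by (simp add: c fs)
    qed
    have fv: "f (v i) = (if i = j then 1 else 0)" if "i < p" for i
      using f(2)[of "v0 i"] v0E[OF that] v0inj[OF that j] fC[OF projC]
      by (simp add: v_def functional_diff[OF f(1)])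
    obtain y where "\<And>x. \<epsilon> (y * x) = f x"
      using nondegenerate_represents[OF nd f(1)] by blast
    then show ?thesis using fC fv by (intro exI[of _ y]) simp
  qed
  then obtain y where yC: "\<And>j x. j < p \<Longrightarrow> x \<in> C \<Longrightarrow> \<epsilon> (y j * x) = 0"
    and yv: "\<And>i j. j < p \<Longrightarrow> i < p \<Longrightarrow> \<epsilon> (y j * v i) = (if i = j then 1 else 0)"
    by metis
  have yM2: "y j \<in> M2" if "j < p" for j
    using yC[OF that] by (rule Cperp)

  have p: "p = n"
  proof -
    have "dim M2 = dim M3 + p"
    proof (rule dim_via_dual_system[OF M3s M2s(2) M32 F, where v = y and d = v])
      show "\<epsilon> (y i * v j) = (if i = j then 1 else 0)" if "i < p" "j < p" for i j
        using yv[OF that] by auto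
      show "\<epsilon> (u * v j) = 0" if "u \<in> M3" "j < p" for u j
        using M31[OF that(1) vM[OF that(2)]] by (simp add: Fs)
      show "z \<in> M3" if z: "z \<in> M2" "\<And>j. j < p \<Longrightarrow> \<epsilon> (z * v j) = 0" for z
        unfolding M3soc socle_def
      proof (intro CollectI ballI)
        fix m assume m: "m \<in> M"
        have zM: "\<epsilon> (z * x) = 0" if x: "x \<in> M" for x
        proof -
          obtain c where c: "x - (\<Sum>i<p. smul (c i) (v i)) \<in> C" using expand[OF x] by blast
          have "z * (x - (\<Sum>i<p. smul (c i) (v i))) = 0" by (rule CM2(2)[OF c z(1)])
          then have "z * x = (\<Sum>i<p. smul (c i) (z * v i))"
            by (simp add: right_diff_distrib sum_distrib_left smul_mult_right)
          then show ?thesis using z(2) by (simp add: Fs)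
        qed
        show "z * m = 0"
        proof (rule nondeg)
          fix x
          have "m * x \<in> M" by (rule ideal_mult(2)[OF M(1) m])
          then show "\<epsilon> (z * m * x) = 0" using zM by (simp only: mult.assoc)
        qed
      qed
    qed (rule yM2)
    then show ?thesis using dims(3) by simp
  qed

  \<comment> \<open>\<open>q i * v j + q j * v i\<close> cancels \<open>v i * v j\<close> under \<open>\<epsilon>\<close>, and \<open>q i * q j\<close> is in the fourth power of \<open>M\<close>.\<close>
  define q where "q i = (\<Sum>j<p. smul (- \<epsilon> (v i * v j) / 2) (y j))" for i
  have qM2: "q i \<in> M2" for i
    unfolding q_def using yM2 by (intro subspace_sum[OF M2s(2)] subspace_scale[OF M2s(2)]) auto
  have qv: "\<epsilon> (q i * v j) = - \<epsilon> (v i * v j) / 2" if "j < p" for i j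
    unfolding q_def by (rule dual_system_coefficient[OF F _ that]) (auto simp: yv)
  \<comment> \<open>The multiple of \<open>s\<close> that is subtracted kills \<open>\<epsilon>\<close> and does not affect products with \<open>M\<close>.\<close>
  define nrm where "nrm x = x - smul (\<epsilon> x) s" for x
  have nrm0: "\<epsilon> (nrm x) = 0" for x
    by (simp add: nrm_def Fs \<epsilon>s)
  have nrm_mult: "nrm x * z = x * z" if "z \<in> M" for x z
    by (simp add: nrm_def left_diff_distrib smul_mult sM[OF that])
  have nrmM: "nrm x \<in> M" if "x \<in> M" for x
    unfolding nrm_def using that s_in by (intro subspace_diff[OF Ms] subspace_scale[OF Ms]) auto
  have nrm_nrm: "nrm x * nrm z = x * z" if "x \<in> M" "z \<in> M" for x z
  proof -
    have "nrm x * nrm z = nrm z * x" using nrm_mult[OF nrmM[OF that(2)]] by (simp only: mult.commute)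
    then show ?thesis using nrm_mult[OF that(1)] by (simp only: mult.commute)
  qed
  define a where "a i = (if i < p then nrm (v i + q i) else nrm (w (i - p)))" for i
  define d where "d i = (if i < p then y i else w (i - p))" for i
  have wM: "w i \<in> M" if "i < r" for i using wC[OF that] CM by blast
  have vqM: "v i + q i \<in> M" if "i < p" for i
    using vM[OF that] qM2 M2M by (intro subspace_add[OF Ms]) auto
  have yM: "y i \<in> M" if "i < p" for i using yM2[OF that] M2M by blast
  have dual: "\<epsilon> (a i * d j) = (if i = j then 1 else 0)" if ij: "i < p + r" "j < p + r" for i j
  proof -
    have vy: "\<epsilon> (v i * y j) = (if i = j then 1 else 0)" if "i < p" "j < p" for i j
      using yv[OF that(2,1)] by (simp only: mult.commute)
    consider "i < p" "j < p" | "i < p" "\<not> j < p" | "\<not> i < p" "j < p" | "\<not> i < p" "\<not> j < p" by blast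
    then show ?thesis
    proof cases
      case 1
      then show ?thesis
        using M22[OF qM2 yM2[OF 1(2)]]
        by (simp add: a_def d_def nrm_mult yM distrib_right Fs vy)
    next
      case 2
      then have j: "j - p < r" using ij by simp
      show ?thesis
        using 2 CM2(2)[OF wC[OF j] qM2] vw[OF j]
        by (auto simp: a_def d_def nrm_mult[OF wM[OF j]] distrib_right Fs)
    next
      case 3
      then have i: "i - p < r" using ij by simp
      show ?thesis
        using 3 CM2(1)[OF wC[OF i] yM2[OF 3(2)]]
        by (auto simp: a_def d_def nrm_mult yM Fs)
    next
      case 4
      then have "i - p < r" "j - p < r" using ij by simp_all
      then show ?thesis
        using 4 by (auto simp: a_def d_def nrm_mult wM ww)
    qed
  qed
  have M2d: "\<epsilon> (u * d j) = 0" if "u \<in> M2" "j < p + r" for u j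
    using that M22[OF that(1) yM2, of j] CM2(2)[OF wC that(1), of "j - p"]
    by (cases "j < p") (auto simp: d_def Fs)
  have in_M2: "z \<in> M2" if z: "z \<in> M" "\<And>j. j < p + r \<Longrightarrow> \<epsilon> (z * d j) = 0" for z
  proof -
    obtain c where c: "z - (\<Sum>i<p. smul (c i) (v i)) \<in> C" using expand[OF z(1)] by blast
    have "c j = 0" if j: "j < p" for j
    proof -
      have "\<epsilon> ((\<Sum>i<p. smul (c i) (v i)) * y j) = c j"
        by (rule dual_system_coefficient[OF F _ j]) (simp add: yv mult.commute[of "v _"])
      moreover have "(z - (\<Sum>i<p. smul (c i) (v i))) * y j = 0"
        by (rule CM2(1)[OF c yM2[OF j]])
      ultimately show ?thesis
        using z(2)[of j] j by (simp add: left_diff_distrib d_def)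
    qed
    then have zC: "z \<in> C" using c by simp
    have "\<epsilon> (z * w i) = 0" if "i < r" for i
      using z(2)[of "p + i"] that by (simp add: d_def)
    then show ?thesis
      using wmax[OF zC] by (intro Cperp) blast
  qed
  have aM: "a i \<in> M" if "i < p + r" for i
    using that vqM wM by (auto simp: a_def intro: nrmM)
  have "dim M = dim M2 + (p + r)"
    by (rule dim_via_dual_system[OF M2s(2) Ms M2M F aM dual M2d in_M2])
  then have h: "h = p + r" using dims(2) by simp
  show thesis
  proof (rule that[of \<epsilon> a])
    show "n \<le> h" using h p by simp
    show "dim (UNIV :: 'a set) = n + h + 2" using dims by simp
    show "\<epsilon> (a i) = 0" for i by (simp add: a_def nrm0)
    show "a i \<in> M" if "i < h" for i using aM that h by simp
    show "\<epsilon> (a i * a j) = (if i = j \<and> n \<le> i then 1 else 0)" if ij: "i < h" "j < h" for i j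
    proof -
      consider "i < p" "j < p" | "i < p" "\<not> j < p" | "\<not> i < p" "j < p" | "\<not> i < p" "\<not> j < p" by blast
      then show ?thesis
      proof cases
        case 1
        have "\<epsilon> (a i * a j) = \<epsilon> (v i * v j) + \<epsilon> (q j * v i) + \<epsilon> (q i * v j)"
          using 1 M22[OF qM2 qM2]
          by (simp add: a_def nrm_nrm vqM distrib_right distrib_left Fs mult.commute[of "v i" "q j"])
        also have "\<dots> = \<epsilon> (v i * v j) - \<epsilon> (v i * v j) / 2 - \<epsilon> (v i * v j) / 2"
          using qv[OF 1(1), of j] qv[OF 1(2), of i] by (simp add: mult.commute[of "v j" "v i"])
        also have "\<dots> = 0" using two by (simp add: field_simps)
        finally show ?thesis using 1 p by simp
      next
        case 2
        then have j: "j - p < r" using ij h by simp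
        have "\<epsilon> (a i * a j) = \<epsilon> ((v i + q i) * w (j - p))"
          using 2 nrm_nrm[OF vqM[OF 2(1)] wM[OF j]] by (simp add: a_def)
        also have "\<dots> = 0"
          using CM2(2)[OF wC[OF j] qM2] vw[OF j] by (simp add: distrib_right Fs)
        finally show ?thesis using 2 by auto
      next
        case 3
        then have i: "i - p < r" using ij h by simp
        have "\<epsilon> (a i * a j) = \<epsilon> ((v j + q j) * w (i - p))"
          using 3 nrm_nrm[OF vqM[OF 3(2)] wM[OF i]] by (simp add: a_def mult.commute[of "nrm (w (i - p))"])
        also have "\<dots> = 0"
          using CM2(2)[OF wC[OF i] qM2] vw[OF i] by (simp add: distrib_right Fs)
        finally show ?thesis using 3 p by auto
      next
        case 4
        then have "i - p < r" "j - p < r" using ij h by simp_all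
        then show ?thesis using 4 p by (auto simp: a_def nrm_nrm wM ww)
      qed
    qed
    show "a i * z = 0" if "n \<le> i" "i < h" "z \<in> ideal_power M 2" for i z
    proof -
      have "i - p < r" "\<not> i < p" "z \<in> M2" using that h p by (simp_all add: M2_def)
      then show ?thesis using CM2(1)[OF wC] nrm_mult M2M by (auto simp: a_def)
    qed
    show "\<exists>c. x - (\<Sum>i<h. smul (c i) (a i)) \<in> ideal_power M 2" if x: "x \<in> M" for x
    proof -
      have "x - (\<Sum>i<p + r. smul (\<epsilon> (x * d i)) (a i)) \<in> M2"
      proof (rule in_M2)
        show "x - (\<Sum>i<p + r. smul (\<epsilon> (x * d i)) (a i)) \<in> M"
          using x aM by (intro subspace_diff[OF Ms] subspace_sum[OF Ms] subspace_scale[OF Ms]) auto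
        show "\<epsilon> ((x - (\<Sum>i<p + r. smul (\<epsilon> (x * d i)) (a i))) * d j) = 0" if "j < p + r" for j
          using dual_system_coefficient[OF F dual that, of "\<lambda>i. \<epsilon> (x * d i)"]
          by (simp add: left_diff_distrib functional_diff[OF F])
      qed
      then show ?thesis unfolding h M2_def by (rule exI[of _ "\<lambda>i. \<epsilon> (x * d i)"])
    qed
  qed (use nd dims I4 \<epsilon>1 in auto)
qed

end

section \<open>Embeddings and their dual functionals\<close>

context artinian_algebra
begin

lemma smul_module: "Modules.module smul"
  by unfold_locales

lemma monomial_value_ideal_power:
  fixes M :: "'a set"
  assumes M: "is_ideal UNIV M" and a: "\<And>i. i \<in> V \<Longrightarrow> a i \<in> M"
  shows "m \<in> monomials V \<Longrightarrow> monomial_value a m \<in> ideal_power M (total_degree m)"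
proof (induction "total_degree m" arbitrary: m)
  case 0
  then show ?case by simp
next
  case (Suc k)
  obtain x m' where x: "x \<in> V" "m = Poly_Mapping.single x 1 + m'" "m' \<in> monomials V" "total_degree m' = k"
    using monomial_degree_Suc[OF Suc.hyps(2)[symmetric] Suc.prems] by metis
  have "a x * monomial_value a m' \<in> ideal_power M (Suc k)"
    using ideal_power_mult[OF a[OF x(1)]] Suc.hyps(1)[of m'] x(3,4) by simp
  then show ?case
    using Suc.hyps(2) by (simp add: x(2) monomial_value_add)
qed

text \<open>
  Generators of \<open>M\<close> modulo \<open>M\<^sup>2\<close> generate the algebra: \<open>M\<close>, \<open>M\<^sup>2\<close> and \<open>M\<^sup>3\<close> are approximated by the image \<open>R\<close>
  of the evaluation modulo the next power, and \<open>M\<^sup>4 = 0\<close>.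
\<close>

lemma closed_embeddingI:
  fixes M :: "'a set"
  assumes M: "is_ideal UNIV M" and M1: "1 \<notin> M" and dimM: "dim (UNIV :: 'a set) = dim M + 1"
    and M4: "ideal_power M 4 = {0}" and hd: "h \<le> d" and aM: "\<And>i. i < h \<Longrightarrow> a i \<in> M"
    and gen: "\<And>x. x \<in> M \<Longrightarrow> \<exists>c. x - (\<Sum>i<h. smul (c i) (a i)) \<in> ideal_power M 2"
  shows "closed_embedding smul d a"
proof -
  define R where "R = poly_eval smul a ` polys {..<d}"
  have R_add: "x + y \<in> R" if xy: "x \<in> R" "y \<in> R" for x y
  proof -
    obtain p q where "x = poly_eval smul a p" "y = poly_eval smul a q" "p \<in> polys {..<d}" "q \<in> polys {..<d}"
      using xy unfolding R_def by blast
    then show ?thesis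
      unfolding R_def by (intro image_eqI[of _ _ "p + q"]) (simp_all add: poly_eval_eq linear_extension_add polys_add)
  qed
  have R_mult: "x * y \<in> R" if xy: "x \<in> R" "y \<in> R" for x y
  proof -
    obtain p q where "x = poly_eval smul a p" "y = poly_eval smul a q" "p \<in> polys {..<d}" "q \<in> polys {..<d}"
      using xy unfolding R_def by blast
    then show ?thesis
      unfolding R_def by (intro image_eqI[of _ _ "p * q"])
        (simp_all add: poly_eval_mult[OF smul_module smul_mult] polys_mult)
  qed
  have R_scale: "smul c x \<in> R" if xy: "x \<in> R" for x c
  proof -
    obtain p where "x = poly_eval smul a p" "p \<in> polys {..<d}"
      using xy unfolding R_def by blast
    then show ?thesis
      unfolding R_def by (intro image_eqI[of _ _ "poly_scale c p"])
        (simp_all add: poly_eval_eq linear_extension_poly_scale polys_scale)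
  qed
  have R_monomial: "monomial_value a m \<in> R" if "m \<in> monomials {..<d}" for m
    unfolding R_def using that
    by (intro image_eqI[of _ _ "mono_poly m"]) (simp_all add: poly_eval_eq polys_mono)
  have R_1: "1 \<in> R"
    using R_monomial[of 0] by simp
  have R_var: "a i \<in> R" if "i < h" for i
    using R_monomial[of "Poly_Mapping.single i 1"] that hd monomials_single[of i 0 "{..<d}"] by simp
  have R_sub: "subspace R"
    using R_scale[OF R_1, of 0] R_add R_scale by (intro subspaceI) auto
  note Ms = ideal_subspace[OF M] and Is = ideal_subspace[OF ideal_power_ideal[OF M]]
  have prod: "x * y \<in> ideal_power M (i + j)" if "x \<in> ideal_power M i" "y \<in> ideal_power M j" for x y i j
    by (rule ideal_power_add[OF M that])
  have I1: "ideal_power M 1 = M"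
    using ideal_power_1[OF M] by simp
  have one: "\<exists>r\<in>R \<inter> M. x - r \<in> ideal_power M 2" if x: "x \<in> M" for x
  proof -
    obtain c where c: "x - (\<Sum>i<h. smul (c i) (a i)) \<in> ideal_power M 2"
      using gen[OF x] by blast
    have "(\<Sum>i<h. smul (c i) (a i)) \<in> R \<inter> M"
      using R_var aM by (auto intro!: subspace_sum[OF R_sub] subspace_scale[OF R_sub]
          subspace_sum[OF Ms] subspace_scale[OF Ms])
    with c show ?thesis by blast
  qed
  have two: "\<exists>r\<in>R \<inter> ideal_power M 2. z - r \<in> ideal_power M 3" if z: "z \<in> ideal_power M 2" for z
  proof -
    have "z \<in> ideal_power M (Suc 1)" using z by (simp add: numeral_2_eq_2)
    with M show ?thesis
    proof (induction rule: ideal_power_induct)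
      case zero
      show ?case
        using subspace_0[OF R_sub] subspace_0[OF Is] by (intro bexI[of _ 0]) auto
    next
      case (add x y)
      then obtain r s where r: "r \<in> R" "r \<in> ideal_power M 2" "x - r \<in> ideal_power M 3"
        and s: "s \<in> R" "s \<in> ideal_power M 2" "y - s \<in> ideal_power M 3" by blast
      have "(x - r) + (y - s) \<in> ideal_power M 3" by (rule subspace_add[OF Is r(3) s(3)])
      then have "(x + y) - (r + s) \<in> ideal_power M 3" by (simp add: algebra_simps)
      with R_add[OF r(1) s(1)] subspace_add[OF Is r(2) s(2)] show ?case by blast
    next
      case (mult x y)
      then have xM: "x \<in> M" and yM: "y \<in> M" by (simp_all add: I1[simplified])
      obtain r where r: "r \<in> R" "r \<in> M" "x - r \<in> ideal_power M 2" using one[OF xM] by blast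
      obtain s where s: "s \<in> R" "s \<in> M" "y - s \<in> ideal_power M 2" using one[OF yM] by blast
      have "(x - r) * y \<in> ideal_power M 3" using prod[of "x - r" 2 y 1] r(3) yM I1 by simp
      moreover have "r * (y - s) \<in> ideal_power M 3" using prod[of r 1 "y - s" 2] s(3) r(2) I1 by (simp add: eval_nat_numeral)
      ultimately have "(x - r) * y + r * (y - s) \<in> ideal_power M 3" by (rule subspace_add[OF Is])
      then have "x * y - r * s \<in> ideal_power M 3" by (simp add: algebra_simps)
      moreover have "r * s \<in> ideal_power M 2" using prod[of r 1 s 1] r(2) s(2) I1 by (simp add: eval_nat_numeral)
      ultimately show ?case using R_mult[OF r(1) s(1)] by blast
    qed
  qed
  have three: "z \<in> R" if z: "z \<in> ideal_power M 3" for z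
  proof -
    have "z \<in> ideal_power M (Suc 2)" using z by (simp add: eval_nat_numeral)
    with M show ?thesis
    proof (induction rule: ideal_power_induct)
      case zero
      show ?case by (rule subspace_0[OF R_sub])
    next
      case (add x y)
      then show ?case by (rule R_add)
    next
      case (mult x y)
      obtain r where r: "r \<in> R" "r \<in> M" "x - r \<in> ideal_power M 2" using one[OF mult(1)] by blast
      obtain s where s: "s \<in> R" "s \<in> ideal_power M 2" "y - s \<in> ideal_power M 3" using two[OF mult(2)] by blast
      have "(x - r) * y = 0" using prod[of "x - r" 2 y 2] r(3) mult(2) M4 by simp
      moreover have "r * (y - s) = 0" using prod[of r 1 "y - s" 3] s(3) r(2) I1 M4 by simp
      ultimately have "x * y = r * s" by (simp add: algebra_simps)
      then show ?case using R_mult[OF r(1) s(1)] by simp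
    qed
  qed
  have R2: "z \<in> R" if z: "z \<in> ideal_power M 2" for z
  proof -
    obtain r where "r \<in> R" "z - r \<in> ideal_power M 3" using two[OF z] by blast
    then show ?thesis using R_add[of r "z - r"] three by simp
  qed
  have RM: "z \<in> R" if z: "z \<in> M" for z
  proof -
    obtain r where "r \<in> R" "z - r \<in> ideal_power M 2" using one[OF z] by blast
    then show ?thesis using R_add[of r "z - r"] R2 by simp
  qed
  have spanM: "span M = M" using Ms by simp
  have "dim (insert 1 M) = dim M + 1"
    using M1 by (simp add: dim_insert spanM)
  then have "span (insert 1 M) = UNIV"
    using dim_eq_full[of "insert 1 M"] dimM by (simp add: dimension_def dim_UNIV)
  moreover have "span (insert 1 M) \<subseteq> R"
    using R_sub R_1 RM by (intro span_minimal) auto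
  ultimately show ?thesis
    by (auto simp: closed_embedding_def R_def)
qed

lemma embedding_ideal_eq_annihilator:
  assumes \<epsilon>: "nondegenerate \<epsilon>" and emb: "closed_embedding smul d a"
  shows "embedding_ideal smul d a = annihilator d (\<lambda>m. \<epsilon> (monomial_value a m))"
proof -
  have F: "functional \<epsilon>" using \<epsilon> by (simp add: nondegenerate_def)
  have shift: "linear_extension (*) (\<lambda>m'. \<epsilon> (monomial_value a (m + m'))) p
      = \<epsilon> (monomial_value a m * poly_eval smul a p)" for m p
    by (simp add: linear_extension_def poly_eval_eq monomial_value_add sum_distrib_left
        smul_mult_right functional_simps[OF F])
  have "poly_eval smul a p = 0"
    if p: "\<And>m. m \<in> monomials {..<d} \<Longrightarrow> \<epsilon> (monomial_value a m * poly_eval smul a p) = 0" for p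
  proof -
    have "\<epsilon> (poly_eval smul a p * y) = 0" for y
    proof -
      obtain r where r: "y = poly_eval smul a r" "r \<in> polys {..<d}"
        using emb unfolding closed_embedding_def by blast
      have "\<epsilon> (poly_eval smul a p * y)
        = (\<Sum>m\<in>Poly_Mapping.keys r. Poly_Mapping.lookup r m * \<epsilon> (monomial_value a m * poly_eval smul a p))"
        by (simp add: r(1) poly_eval_eq linear_extension_def[of smul _ r] sum_distrib_left
            smul_mult_right functional_simps[OF F] mult.commute)
      also have "\<dots> = 0"
        using r(2) p by (intro sum.neutral) (auto simp: polys_def)
      finally show ?thesis .
    qed
    then show ?thesis using \<epsilon> by (simp add: nondegenerate_def)
  qed
  then show ?thesis
    unfolding embedding_ideal_def annihilator_def shift
    by (auto simp: functional_0[OF F])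
qed

text \<open>
  The images of the monomials span the algebra, so some of them form a basis, which gives a chart.
\<close>

lemma embedding_ideal_in_topspace:
  assumes emb: "closed_embedding smul d a" and d: "dim (UNIV :: 'a set) = d"
    and idl: "is_ideal (polys {..<d}) (embedding_ideal smul d a)"
  shows "embedding_ideal smul d a \<in> topspace (hilb_topology d d)"
proof -
  let ?I = "embedding_ideal smul d a"
  let ?S = "monomial_value a ` monomials {..<d}"
  obtain D where D: "D \<subseteq> ?S" "independent D" "?S \<subseteq> span D"
    using maximal_independent_subset[of ?S] by blast
  have finD: "finite D" using D(2) by (rule finiteI_independent)
  have spanD: "span D = UNIV"
  proof -
    have "y \<in> span D" for y
    proof -
      obtain r where r: "y = poly_eval smul a r" "r \<in> polys {..<d}"
        using emb unfolding closed_embedding_def by blast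
      show ?thesis
        unfolding r(1) poly_eval_eq linear_extension_def
        using r(2) D(3) by (intro span_sum span_scale) (auto simp: polys_def)
    qed
    then show ?thesis by blast
  qed
  have "\<forall>x\<in>D. \<exists>m. m \<in> monomials {..<d} \<and> monomial_value a m = x"
    using D(1) by blast
  then obtain g where g: "\<And>x. x \<in> D \<Longrightarrow> g x \<in> monomials {..<d} \<and> monomial_value a (g x) = x"
    by (metis (no_types))
  define B where "B = g ` D"
  have bij: "bij_betw (monomial_value a) B D"
    by (rule bij_betw_byWitness[where f' = g]) (auto simp: B_def g)
  have B: "finite B" "B \<subseteq> monomials {..<d}" "card B = d"
    using finD g bij_betw_same_card[OF bij] dim_unique[of D UNIV "card D"] D(2) spanD d
    by (auto simp: B_def)
  have coords: "quot_coords poly_scale ?I B mono_poly w c \<longleftrightarrow>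
      (\<forall>b. b \<notin> B \<longrightarrow> c b = 0) \<and> poly_eval smul a w = (\<Sum>b\<in>B. smul (c b) (monomial_value a b))"
    if w: "w \<in> polys {..<d}" for w c
  proof -
    have "w - (\<Sum>b\<in>B. poly_scale (c b) (mono_poly b)) \<in> polys {..<d}"
      using w B(2) by (intro polys_diff polys_sum polys_scale polys_mono) auto
    then show ?thesis
      by (simp add: quot_coords_def embedding_ideal_def poly_eval_eq linear_extension_linear_combination)
  qed
  have "is_quot_basis poly_scale (polys {..<d}) ?I B mono_poly"
    unfolding is_quot_basis_def
  proof (intro conjI ballI)
    show "finite B" by (rule B)
    show "mono_poly ` B \<subseteq> polys {..<d}" using B(2) by (auto intro: polys_mono)
    fix w :: "(nat, 'k) mpoly" assume w: "w \<in> polys {..<d}"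
    have sumB: "(\<Sum>b\<in>B. smul (c (monomial_value a b)) (monomial_value a b)) = (\<Sum>x\<in>D. smul (c x) x)" for c
      by (rule sum.reindex_bij_betw[OF bij])
    have "poly_eval smul a w \<in> span D" using spanD by simp
    then obtain c where c: "poly_eval smul a w = (\<Sum>x\<in>D. smul (c x) x)"
      unfolding span_finite[OF finD] by blast
    show "\<exists>!c. quot_coords poly_scale ?I B mono_poly w c"
    proof (rule ex1I)
      let ?c = "\<lambda>b. if b \<in> B then c (monomial_value a b) else 0"
      have "(\<Sum>b\<in>B. smul (?c b) (monomial_value a b)) = (\<Sum>x\<in>D. smul (c x) x)"
        unfolding sumB[symmetric] by (intro sum.cong) auto
      then show "quot_coords poly_scale ?I B mono_poly w ?c"
        by (simp add: coords[OF w] c)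
    next
      fix c' assume c': "quot_coords poly_scale ?I B mono_poly w c'"
      have gB: "g (monomial_value a b) = b" if "b \<in> B" for b
        using that g by (auto simp: B_def)
      have "(\<Sum>b\<in>B. smul (c' b) (monomial_value a b)) = (\<Sum>x\<in>D. smul (c' (g x)) x)"
        unfolding sumB[symmetric] by (intro sum.cong) (auto simp: gB)
      then have "(\<Sum>x\<in>D. smul (c' (g x)) x) = (\<Sum>x\<in>D. smul (c x) x)"
        using c' c by (simp add: coords[OF w])
      then have "(\<Sum>x\<in>D. smul (c' (g x) - c x) x) = 0"
        by (simp add: scale_left_diff_distrib sum_subtractf)
      then have cg: "c' (g x) - c x = 0" if "x \<in> D" for x
        using that by (rule independentD[OF D(2) finD subset_refl])
      have "c' b = c (monomial_value a b)" if "b \<in> B" for b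
        using cg[of "monomial_value a b"] that bij by (simp add: gB bij_betw_apply)
      then show "c' = (\<lambda>b. if b \<in> B then c (monomial_value a b) else 0)"
        using c' by (auto simp: fun_eq_iff coords[OF w])
    qed
  qed
  then have "?I \<in> chart d d B"
    using idl B(3) by (intro chartI)
  moreover have "poly_eval (*) (\<lambda>mb. chart_coord B mb ?I) 1 = 1"
    by (simp add: poly_eval_def)
  ultimately have "?I \<in> principal_open d d B 1"
    by (simp add: principal_open_def)
  then show ?thesis
    unfolding hilb_topology_def topology_generated_by_topspace using B
    by (intro UnionI[of "principal_open d d B 1"]) (auto intro!: exI[of _ B] exI[of _ 1])
qed

end

section \<open>Smoothability\<close>

lemma (in artinian_algebra) functional_on_monomials_is_cubic:
  fixes M :: "'a set" and a :: "nat \<Rightarrow> 'a"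
  assumes M: "is_ideal UNIV M" and F: "functional \<epsilon>" and M4: "ideal_power M 4 = {0}"
    and \<epsilon>1: "\<epsilon> 1 = 0"
    and aM: "\<And>i. i < h \<Longrightarrow> a i \<in> M" and a0: "\<And>i. h \<le> i \<Longrightarrow> a i = 0"
    and \<epsilon>a: "\<And>i. i < h \<Longrightarrow> \<epsilon> (a i) = 0"
    and \<epsilon>aa: "\<And>i j. i < h \<Longrightarrow> j < h \<Longrightarrow> \<epsilon> (a i * a j) = (if i = j \<and> n \<le> i then 1 else 0)"
    and kill: "\<And>i y. n \<le> i \<Longrightarrow> i < h \<Longrightarrow> y \<in> ideal_power M 2 \<Longrightarrow> a i * y = 0"
  shows "\<epsilon> (monomial_value a m) = cubic_functional n h (\<lambda>m. \<epsilon> (monomial_value a m)) m"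
proof -
  note \<epsilon>0 = functional_0[OF F]
  have aM': "a i \<in> M" for i
    using aM[of i] a0[of i] M by (cases "i < h") (auto simp: is_ideal_def)
  have in_power: "monomial_value a m \<in> ideal_power M (total_degree m)" for m
    by (rule monomial_value_ideal_power[OF M, where V = UNIV]) (simp_all add: monomials_def aM')
  have monUNIV: "m \<in> monomials UNIV" for m :: "nat monomial" by (simp add: monomials_def)
  have not_double: "m \<noteq> Poly_Mapping.single k 2" if "total_degree m \<noteq> 2" for k
    using that by auto
  consider "total_degree m = 0" | "total_degree m = 1" | "total_degree m = 2"
    | "total_degree m = 3" "m \<in> monomials {..<n}" | "total_degree m = 3" "m \<notin> monomials {..<n}"
    | "total_degree m \<ge> 4" by linarith
  then show ?thesis
  proof cases
    case 1
    then have "m = 0" by (simp only: total_degree_eq_0_iff)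
    moreover have "cubic_functional n h T m = 0" for T :: "nat monomial \<Rightarrow> 'k"
      using 1 not_double by (auto simp: cubic_functional_def)
    ultimately show ?thesis using \<epsilon>1 by simp
  next
    case 2
    obtain i where i: "m = Poly_Mapping.single i 1"
      using monomial_degree_1[OF 2 monUNIV] by blast
    have "\<epsilon> (a i) = 0" using \<epsilon>a[of i] a0[of i] \<epsilon>0 by (cases "i < h") auto
    then have "\<epsilon> (monomial_value a m) = 0" by (simp add: i)
    then show ?thesis using 2 not_double by (auto simp: cubic_functional_def)
  next
    case 3
    then have "total_degree m = Suc 1" by simp
    then obtain i m' where i: "m = Poly_Mapping.single i 1 + m'" "total_degree m' = 1"
      using monomial_degree_Suc[OF _ monUNIV] by metis
    obtain j where j: "m' = Poly_Mapping.single j 1"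
      using monomial_degree_1[OF i(2) monUNIV] by blast
    have "\<epsilon> (a i * a j) = (if i = j \<and> n \<le> i \<and> i < h then 1 else 0)"
      using \<epsilon>aa[of i j] a0[of i] a0[of j] \<epsilon>0 by (cases "i < h"; cases "j < h") auto
    moreover have "(\<exists>k\<in>{n..<h}. m = Poly_Mapping.single k 2) \<longleftrightarrow> i = j \<and> n \<le> i \<and> i < h"
      unfolding i(1) j single_add_eq_double_iff by auto
    ultimately show ?thesis
      using 3 by (simp add: cubic_functional_def i(1) j monomial_value_add)
  next
    case 4
    then show ?thesis by (simp add: cubic_functional_def)
  next
    case 5
    then have "\<not> Poly_Mapping.keys m \<subseteq> {..<n}" by (simp add: monomials_def)
    then obtain x where x: "x \<in> Poly_Mapping.keys m" "n \<le> x"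
      by (metis lessThan_iff not_less subsetI)
    obtain m' where m': "m = Poly_Mapping.single x 1 + m'"
      using monomial_split_variable[OF x(1)] by blast
    have deg: "total_degree m' = 2" using 5(1) by (simp add: m')
    have "a x * monomial_value a m' = 0"
      using kill[OF x(2), of "monomial_value a m'"] in_power[of m'] deg a0[of x]
      by (cases "x < h") auto
    then have "\<epsilon> (monomial_value a m) = 0" by (simp add: m' monomial_value_add \<epsilon>0)
    then show ?thesis using 5 not_double by (auto simp: cubic_functional_def)
  next
    case 6
    have "ideal_power M (4 + k) \<subseteq> {0}" for k
    proof (induction k)
      case (Suc k)
      then show ?case using ideal_power_Suc_subset[OF M, of "4 + k"] by simp
    qed (simp add: M4)
    from this[of "total_degree m - 4"] 6 have "monomial_value a m = 0"
      using in_power[of m] by auto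
    then show ?thesis using 6 not_double \<epsilon>0 by (auto simp: cubic_functional_def)
  qed
qed

theorem corollary4p3:
  fixes smul :: "'k::{alg_closed_field, field_char_0} \<Rightarrow> 'a::comm_ring_1 \<Rightarrow> 'a"
    and M :: "'a set" and h n :: nat
  assumes "artinian_algebra smul"
    and "local_with M"
    and "gorenstein smul M"
    and "h > 0" and "n > 0"
    and "hilbert_function smul M 0 = 1"
    and "hilbert_function smul M 1 = h"
    and "hilbert_function smul M 2 = n"
    and "hilbert_function smul M 3 = 1"
    and "\<forall>i\<ge>4. hilbert_function smul M i = 0"
    and "n \<le> 4"
  shows "smoothable smul"
proof -
  interpret artinian_algebra smul by fact
  note M = local_maximal[OF assms(2)]
  have hf4: "hilbert_function smul M 4 = 0" using assms(10) by simp
  have sqrt: "\<exists>t. t ^ 2 = c" for c :: 'k by (rule nth_root_exists) simp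
  obtain \<epsilon> b where nd: "nondegenerate \<epsilon>" and nh: "n \<le> h"
    and dim: "dim (UNIV :: 'a set) = n + h + 2" and dimM: "dim (UNIV :: 'a set) = dim M + 1"
    and M4: "ideal_power M 4 = {0}" and \<epsilon>1: "\<epsilon> 1 = 0"
    and bM: "\<And>i. i < h \<Longrightarrow> b i \<in> M" and \<epsilon>b: "\<And>i. i < h \<Longrightarrow> \<epsilon> (b i) = 0"
    and \<epsilon>bb: "\<And>i j. i < h \<Longrightarrow> j < h \<Longrightarrow> \<epsilon> (b i * b j) = (if i = j \<and> n \<le> i then 1 else 0)"
    and kill: "\<And>i y. n \<le> i \<Longrightarrow> i < h \<Longrightarrow> y \<in> ideal_power M 2 \<Longrightarrow> b i * y = 0"
    and gen: "\<And>x. x \<in> M \<Longrightarrow> \<exists>c. x - (\<Sum>i<h. smul (c i) (b i)) \<in> ideal_power M 2"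
    using gorenstein_normal_form[OF assms(2,3,6-9) hf4 sqrt] by auto
  define d where "d = dim (UNIV :: 'a set)"
  have d: "d = n + h + 2" using dim by (simp add: d_def)
  define a where "a i = (if i < h then b i else 0)" for i
  define T where "T m = \<epsilon> (monomial_value a m)" for m
  have F: "functional \<epsilon>" using nd by (simp add: nondegenerate_def)
  have emb: "closed_embedding smul d a"
    by (rule closed_embeddingI[OF M dimM M4, of h]) (auto simp: a_def bM gen d)
  have "\<epsilon> (monomial_value a m) = cubic_functional n h T m" for m
    unfolding T_def
    by (rule functional_on_monomials_is_cubic[OF M(1) F M4 \<epsilon>1]) (auto simp: a_def bM \<epsilon>b \<epsilon>bb kill)
  then have ideal: "embedding_ideal smul d a = annihilator d (cubic_functional n h T)"
    unfolding embedding_ideal_eq_annihilator[OF nd emb] by simp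
  have "embedding_ideal smul d a \<in> topspace (hilb_topology d d)"
    by (rule embedding_ideal_in_topspace[OF emb d_def[symmetric]])
      (simp only: ideal annihilator_ideal)
  moreover have "\<exists>I \<in> hilb_reduced d d. I \<in> U"
    if "embedding_ideal smul d a \<in> U \<and> openin (hilb_topology d d) U" for U
    using cubic_functional_limit_of_points[OF assms(11) nh, of d U T] that
    by (simp only: ideal d[symmetric])
  ultimately have "embedding_ideal smul d a \<in> hilb_gen d d"
    unfolding hilb_gen_def in_closure_of by blast
  with emb show ?thesis
    unfolding smoothable_def Let_def d_def by blast
qed

end
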